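(* Let $n,d\ge1$. Assume that there is a constant $C$ such that $|v|_{1,\infty}\le C|v|_V$ for all $v\in V$. Let $\varepsilon:\mathbb{R}^{nd}\times\mathbb{R}^{nd}\to L(\mathbb{R}^{nd})$ be a Lipschitz and bounded map, and let $B$ be a standard Brownian motion on $\mathbb{R}^{nd}$. Then the solutions of the (Itô) stochastic differential equation $$dp_t=-\partial_xH_0(p_t,x_t)\,dt+\varepsilon(p_t,x_t)\,dB_t,\qquad dx_t=\partial_pH_0(p_t,x_t)\,dt,$$ with initial condition $(p_0,x_0)\in\mathbb{R}^{nd}\times\mathbb{R}^{nd}$, are non exploding: for any such solution, defined up to its explosion time $\tau_\infty$, one has $\tau_\infty=+\infty$ almost surely.
   Context: $V$ is a Hilbert space of vector fields contained in $C^1_0(\mathbb{R}^d,\mathbb{R}^d)$, the space of $C^1$ vector fields vanishing at infinity (together with their first derivatives), with norm $|v|_{1,\infty}=\sup|v|+\sup|dv|$. Under the assumption $|v|_{1,\infty}\le C|v|_V$, $V$ is a reproducing kernel Hilbert space with matrix-valued kernel $K_V:\mathbb{R}^d\times\mathbb{R}^d\to\mathcal{M}_d(\mathbb{R})$, characterized by: for all $z',\alpha'\in\mathbb{R}^d$, $K_V(\cdot,z')\alpha'\in V$ and $\langle v,K_V(\cdot,z')\alpha'\rangle_V=v(z')^T\alpha'$ for all $v\in V$. For $p=(p_1,\dots,p_n)$, $x=(x_1,\dots,x_n)\in(\mathbb{R}^d)^n=\mathbb{R}^{nd}$, $$H_0(p,x)=\tfrac12\sum_{i,j=1}^n p_i^TK_V(x_i,x_j)p_j.$$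 $L(\mathbb{R}^{nd})$ is the space of linear endomorphisms of $\mathbb{R}^{nd}$. A solution up to its explosion time is a continuous adapted process $(p_t,x_t)$ on $[0,\tau_\infty)$ satisfying the equation there, where $\tau_\infty=\lim_{M\to\infty}\tau_M$ with $\tau_M=\inf\{t\ge0:\max(|x_t|,|p_t|)\ge M\}$. *)

theory Defs
  imports "HOL-Probability.Probability"
begin

section \<open>Hilbert spaces of vector fields and their kernels\<close>

definition C1_0_field :: "('a::euclidean_space \<Rightarrow> 'a) \<Rightarrow> bool" where
  "C1_0_field v \<longleftrightarrow> (\<exists>v' :: 'a \<Rightarrow> 'a \<Rightarrow>\<^sub>L 'a.
     (\<forall>z. (v has_derivative blinfun_apply (v' z)) (at z)) \<and> continuous_on UNIV v' \<and>
     (v \<longlongrightarrow> 0) at_infinity \<and> (v' \<longlongrightarrow> 0) at_infinity)"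

text \<open>The norm \<open>\<bar>v\<bar>\<^sub>1\<^sub>,\<^sub>\<infinity>\<close>. Both suprema are over bounded sets when \<open>C1_0_field v\<close> holds.\<close>

definition norm_1_inf :: "('a::euclidean_space \<Rightarrow> 'a) \<Rightarrow> real" where
  "norm_1_inf v = (SUP z. norm (v z)) + (SUP z. onorm (frechet_derivative v (at z)))"

text \<open>A Hilbert space of vector fields contained in \<open>C\<^sup>1\<^sub>0\<close> is given by its abstract Hilbert space
  \<open>'v\<close> together with the map \<open>fld\<close> that sends an element to the vector field it is. The map is
  linear (for the pointwise operations) and injective, so \<open>'v\<close> is identified with the linear
  space \<open>range fld\<close> of vector fields.\<close>

definition hilbert_space_in_C1_0 ::
    "('v::{real_inner, complete_space} \<Rightarrow> 'a::euclidean_space \<Rightarrow> 'a) \<Rightarrow> bool" where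
  "hilbert_space_in_C1_0 fld \<longleftrightarrow>
     (\<forall>z. linear (\<lambda>v. fld v z)) \<and> inj fld \<and> (\<forall>v. C1_0_field (fld v))"

definition reproducing_kernel ::
    "('v::{real_inner, complete_space} \<Rightarrow> real^'d \<Rightarrow> real^'d) \<Rightarrow>
     (real^'d \<Rightarrow> real^'d \<Rightarrow> real^'d^'d) \<Rightarrow> bool" where
  "reproducing_kernel fld K \<longleftrightarrow>
     (\<forall>z' \<alpha>'. \<exists>k. fld k = (\<lambda>z. K z z' *v \<alpha>') \<and> (\<forall>v. inner v k = inner (fld v z') \<alpha>'))"

section \<open>The Hamiltonian\<close>

definition hamiltonian ::
    "(real^'d \<Rightarrow> real^'d \<Rightarrow> real^'d^'d) \<Rightarrow> real^'d^'n \<Rightarrow> real^'d^'n \<Rightarrow> real" where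
  "hamiltonian K p x =
     1/2 * (\<Sum>i\<in>UNIV. \<Sum>j\<in>UNIV. inner (p $ i) (K (x $ i) (x $ j) *v (p $ j)))"

definition gradient :: "('a::real_inner \<Rightarrow> real) \<Rightarrow> 'a \<Rightarrow> 'a" where
  "gradient f x = (THE D. GDERIV f x :> D)"

section \<open>Brownian motion and the Ito integral\<close>

text \<open>Filtrations and processes are indexed by \<open>real\<close>, but only times \<open>t \<ge> 0\<close> matter: any
  filtration on \<open>[0,\<infinity>)\<close> extends to negative times by \<open>F 0\<close>. No completeness or
  right-continuity of the filtration is required.\<close>

definition filtered_prob_space :: "'w measure \<Rightarrow> (real \<Rightarrow> 'w measure) \<Rightarrow> bool" where
  "filtered_prob_space M F \<longleftrightarrow>
     prob_space M \<and> filtration (space M) F \<and> (\<forall>t. subalgebra M (F t))"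

text \<open>The product density below says that the coordinates of \<open>B t - B s\<close> in an orthonormal basis
  are independent centred Gaussians of variance \<open>t - s\<close>.\<close>

definition standard_brownian_motion ::
    "'w measure \<Rightarrow> (real \<Rightarrow> 'w measure) \<Rightarrow> (real \<Rightarrow> 'w \<Rightarrow> 'a::euclidean_space) \<Rightarrow> bool" where
  "standard_brownian_motion M F B \<longleftrightarrow>
     (AE \<omega> in M. B 0 \<omega> = 0 \<and> continuous_on {0..} (\<lambda>t. B t \<omega>)) \<and>
     (\<forall>t\<ge>0. B t \<in> borel_measurable (F t)) \<and>
     (\<forall>s t. 0 \<le> s \<and> s < t \<longrightarrow>
        distributed M lborel (\<lambda>\<omega>. B t \<omega> - B s \<omega>)
          (\<lambda>z. ennreal (\<Prod>b\<in>Basis. normal_density 0 (sqrt (t - s)) (inner z b))) \<and>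
        prob_space.indep_set M (sets (F s))
          {(\<lambda>\<omega>. B t \<omega> - B s \<omega>) -` A \<inter> space M | A. A \<in> sets borel})"

definition progressively_measurable ::
    "(real \<Rightarrow> 'w measure) \<Rightarrow> (real \<Rightarrow> 'w \<Rightarrow> 'b::topological_space) \<Rightarrow> bool" where
  "progressively_measurable F H \<longleftrightarrow>
     (\<forall>t\<ge>0. (\<lambda>(s, \<omega>). H s \<omega>) \<in> borel_measurable (restrict_space borel {0..t} \<Otimes>\<^sub>M F t))"

text \<open>A simple integrand on \<open>[0,T]\<close> takes the value \<open>\<xi> i\<close> on \<open>(r i, r (i+1)]\<close> for \<open>i < k\<close>, where
  \<open>0 = r 0 < \<dots> < r k = T\<close> (and \<open>k = 0\<close> if \<open>T = 0\<close>).\<close>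

definition simple_integrand ::
    "'w measure \<Rightarrow> (real \<Rightarrow> 'w measure) \<Rightarrow> real \<Rightarrow> nat \<Rightarrow> (nat \<Rightarrow> real) \<Rightarrow>
     (nat \<Rightarrow> 'w \<Rightarrow> 'a::euclidean_space \<Rightarrow>\<^sub>L 'a) \<Rightarrow> bool" where
  "simple_integrand M F T k r \<xi> \<longleftrightarrow>
     r 0 = 0 \<and> r k = T \<and> (\<forall>i<k. r i < r (Suc i)) \<and>
     (\<forall>i<k. \<xi> i \<in> borel_measurable (F (r i)) \<and> bounded (\<xi> i ` space M))"

definition simple_process ::
    "nat \<Rightarrow> (nat \<Rightarrow> real) \<Rightarrow> (nat \<Rightarrow> 'w \<Rightarrow> 'a::euclidean_space \<Rightarrow>\<^sub>L 'a) \<Rightarrow>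
     real \<Rightarrow> 'w \<Rightarrow> 'a \<Rightarrow>\<^sub>L 'a" where
  "simple_process k r \<xi> s \<omega> = (\<Sum>i<k. indicator {r i <.. r (Suc i)} s *\<^sub>R \<xi> i \<omega>)"

definition simple_ito_integral ::
    "(real \<Rightarrow> 'w \<Rightarrow> 'a::euclidean_space) \<Rightarrow> nat \<Rightarrow> (nat \<Rightarrow> real) \<Rightarrow>
     (nat \<Rightarrow> 'w \<Rightarrow> 'a \<Rightarrow>\<^sub>L 'a) \<Rightarrow> 'w \<Rightarrow> 'a" where
  "simple_ito_integral B k r \<xi> \<omega> =
     (\<Sum>i<k. blinfun_apply (\<xi> i \<omega>) (B (r (Suc i)) \<omega> - B (r i) \<omega>))"

text \<open>\<open>has_ito_integral M F B T H I\<close>: the random variable \<open>I\<close> is (a version of) the Ito integral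
  of \<open>H\<close> against \<open>B\<close> over \<open>[0,T]\<close>, obtained as the \<open>L\<^sup>2\<close> limit of the integrals of simple
  integrands converging to \<open>H\<close> in \<open>L\<^sup>2([0,T] \<times> \<Omega>)\<close>. By the Ito isometry \<open>I\<close> is unique up to
  null sets and does not depend on the approximating sequence.\<close>

definition has_ito_integral ::
    "'w measure \<Rightarrow> (real \<Rightarrow> 'w measure) \<Rightarrow> (real \<Rightarrow> 'w \<Rightarrow> 'a::euclidean_space) \<Rightarrow> real \<Rightarrow>
     (real \<Rightarrow> 'w \<Rightarrow> 'a \<Rightarrow>\<^sub>L 'a) \<Rightarrow> ('w \<Rightarrow> 'a) \<Rightarrow> bool" where
  "has_ito_integral M F B T H I \<longleftrightarrow>
     progressively_measurable F H \<and> I \<in> borel_measurable M \<and>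
     (\<exists>k r \<xi>.
        (\<forall>m::nat. simple_integrand M F T (k m) (r m) (\<xi> m)) \<and>
        (\<lambda>m. \<integral>\<^sup>+\<omega>. (\<integral>\<^sup>+s\<in>{0..T}.
            ennreal ((norm (simple_process (k m) (r m) (\<xi> m) s \<omega> - H s \<omega>))\<^sup>2) \<partial>lborel) \<partial>M)
          \<longlonglongrightarrow> 0 \<and>
        (\<lambda>m. \<integral>\<^sup>+\<omega>. ennreal ((norm (simple_ito_integral B (k m) (r m) (\<xi> m) \<omega> - I \<omega>))\<^sup>2) \<partial>M)
          \<longlonglongrightarrow> 0)"

section \<open>Solutions up to the explosion time\<close>

text \<open>A process living on a random interval \<open>[0,\<zeta>)\<close> is a total function of time whose values at
  times \<open>t \<ge> \<zeta> \<omega>\<close> are irrelevant. The exit time of level \<open>R\<close> only looks at times before \<open>\<zeta>\<close> and is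
  \<open>\<infinity>\<close> if the level is not reached there.\<close>

definition exit_time ::
    "('w \<Rightarrow> ereal) \<Rightarrow> (real \<Rightarrow> 'w \<Rightarrow> 'a::real_normed_vector) \<Rightarrow> (real \<Rightarrow> 'w \<Rightarrow> 'a) \<Rightarrow>
     real \<Rightarrow> 'w \<Rightarrow> ereal" where
  "exit_time \<zeta> p x R \<omega> =
     Inf (ereal ` {t. 0 \<le> t \<and> ereal t < \<zeta> \<omega> \<and> max (norm (x t \<omega>)) (norm (p t \<omega>)) \<ge> R})"

definition adapted_continuous_until ::
    "'w measure \<Rightarrow> (real \<Rightarrow> 'w measure) \<Rightarrow> ('w \<Rightarrow> ereal) \<Rightarrow>
     (real \<Rightarrow> 'w \<Rightarrow> 'a::real_normed_vector) \<Rightarrow> bool" where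
  "adapted_continuous_until M F \<zeta> X \<longleftrightarrow>
     (\<forall>t\<ge>0. {\<omega> \<in> space M. ereal t < \<zeta> \<omega>} \<in> sets (F t) \<and>
        X t \<in> borel_measurable (restrict_space (F t) {\<omega> \<in> space M. ereal t < \<zeta> \<omega>})) \<and>
     (\<forall>\<omega>\<in>space M. continuous_on {t. 0 \<le> t \<and> ereal t < \<zeta> \<omega>} (\<lambda>t. X t \<omega>))"

text \<open>\<open>(p, x)\<close> solves \<open>dp = a(p,x) dt + \<epsilon>(p,x) dB\<close>, \<open>dx = c(p,x) dt\<close> with initial value
  \<open>(p0, x0)\<close> on \<open>[0,\<zeta>)\<close>, where \<open>\<zeta>\<close> is the explosion time, i.e. the limit of the exit times
  \<open>\<tau>\<^sub>R\<close>. Since paths are continuous before \<open>\<zeta>\<close>, this forces \<open>\<tau>\<^sub>R < \<zeta>\<close> for all \<open>R\<close> wherever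
  \<open>\<zeta>\<close> is finite. The stochastic equation on \<open>[0,\<zeta>)\<close> is stated by localization: for every
  \<open>R\<close> and \<open>t\<close> it holds in integrated form at the time \<open>min t \<tau>\<^sub>R\<close>, the Ito integral up to that
  time being the integral over \<open>[0,t]\<close> of the integrand cut off after \<open>\<tau>\<^sub>R\<close>.\<close>

definition sde_solution_until_explosion ::
    "'w measure \<Rightarrow> (real \<Rightarrow> 'w measure) \<Rightarrow> (real \<Rightarrow> 'w \<Rightarrow> 'a::euclidean_space) \<Rightarrow>
     ('a \<times> 'a \<Rightarrow> 'a) \<Rightarrow> ('a \<times> 'a \<Rightarrow> 'a \<Rightarrow>\<^sub>L 'a) \<Rightarrow> ('a \<times> 'a \<Rightarrow> 'a) \<Rightarrow> 'a \<Rightarrow> 'a \<Rightarrow>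
     ('w \<Rightarrow> ereal) \<Rightarrow> (real \<Rightarrow> 'w \<Rightarrow> 'a) \<Rightarrow> (real \<Rightarrow> 'w \<Rightarrow> 'a) \<Rightarrow> bool" where
  "sde_solution_until_explosion M F B a \<epsilon> c p0 x0 \<zeta> p x \<longleftrightarrow>
     adapted_continuous_until M F \<zeta> p \<and> adapted_continuous_until M F \<zeta> x \<and>
     (\<forall>\<omega>\<in>space M. ((\<lambda>R. exit_time \<zeta> p x R \<omega>) \<longlongrightarrow> \<zeta> \<omega>) at_top) \<and>
     (AE \<omega> in M. p 0 \<omega> = p0 \<and> x 0 \<omega> = x0) \<and>
     (AE \<omega> in M. \<forall>t. 0 \<le> t \<and> ereal t < \<zeta> \<omega> \<longrightarrow>
        x t \<omega> = x0 + integral {0..t} (\<lambda>s. c (p s \<omega>, x s \<omega>))) \<and>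
     (\<forall>R. \<forall>t\<ge>0. \<exists>I.
        has_ito_integral M F B t
          (\<lambda>s \<omega>. if ereal s \<le> exit_time \<zeta> p x R \<omega> then \<epsilon> (p s \<omega>, x s \<omega>) else 0) I \<and>
        (AE \<omega> in M. let u = real_of_ereal (min (ereal t) (exit_time \<zeta> p x R \<omega>)) in
           p u \<omega> = p0 + integral {0..u} (\<lambda>s. a (p s \<omega>, x s \<omega>)) + I \<omega>))"

end

theory Submission
  imports Defs
begin

text \<open>The function \<open>\<Phi>(p, x) = H\<^sub>0(p, x) + ln (1 + \<bar>p\<bar>\<^sup>2) + \<bar>x\<bar>\<^sup>2\<close> is a Lyapunov function. Writing
  \<open>H\<^sub>0(p, x) = \<bar>v\<bar>\<^sup>2 / 2\<close> with the vector field \<open>v = \<Sum>\<^sub>j K(\<cdot>, x\<^sub>j) p\<^sub>j\<close>, the drift conserves \<open>H\<^sub>0\<close>,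
  moves \<open>x\<close> at speed at most a multiple of \<open>\<bar>v\<bar>\<close>, and changes \<open>ln (1 + \<bar>p\<bar>\<^sup>2)\<close> at a rate of at most
  a multiple of \<open>\<bar>v\<bar>\<close>; the second-order contribution of the noise is bounded because \<open>\<Phi>\<close> is
  quadratically bounded in \<open>p\<close> and \<open>\<epsilon>\<close> is bounded. Hence the expectation of \<open>\<Phi>\<close> at time
  \<open>min T \<tau>\<^sub>R\<close> is bounded independently of \<open>R\<close>, and as \<open>\<Phi>\<close> is large at the exit from the level \<open>R\<close>,
  the probability of \<open>\<tau>\<^sub>R \<le> T\<close> tends to \<open>0\<close>.

  Neither Ito's formula nor a second derivative of \<open>\<Phi>\<close> in \<open>x\<close> is used: the increments of \<open>\<Phi>\<close> over
  a time grid are bounded path by path, with an error that tends boundedly to \<open>0\<close> with the mesh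
  because the stopped path is uniformly continuous. Only the covariance of Ito integrals is needed.\<close>

section \<open>Moments and covariance of Ito integrals\<close>

text \<open>H_0 alone would not do: the kernel is only positive semidefinite, so H_0 may stay small
  while p is large, and it does not confine x. The term |x|^2 confines x. For p, the drift has size
  |v| |p|, so |p|^2 may grow at the rate |v| |p|^2, which is not linear in the energy; the logarithm
  divides by |p|^2 and leaves |v|, which is at most 1 + H_0. The embedding of V in C^1 makes H_0 a
  quadratic form in p with bounded coefficients, but only C^1 in x. Noise acts on p alone, and this
  dictates the order of a step: first p moves at frozen x, where a second-order bound is available,
  then x moves along its C^1 path at frozen p. Conservation of H_0 is a cancellation of gradients
  taken at one point, while a step evaluates them at several nearby points. The resulting error is
  uniform only below a fixed level, so the mesh is sent to 0 before the level grows. The stochastic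
  integrals are given for each time separately and up to null sets, so only countably many grid
  times can be used on one path.\<close>

lemma lborel_prod_Basis:
  fixes f :: "'a::euclidean_space \<Rightarrow> real \<Rightarrow> real"
  assumes f: "\<And>b. b \<in> Basis \<Longrightarrow> integrable lborel (f b)"
  shows "has_bochner_integral lborel (\<lambda>z::'a. \<Prod>b\<in>Basis. f b (z \<bullet> b))
    (\<Prod>b\<in>Basis. \<integral>x. f b x \<partial>lborel)"
proof -
  interpret product_sigma_finite "\<lambda>b::'a. lborel :: real measure"
    by standard
  have [measurable]: "b \<in> Basis \<Longrightarrow> f b \<in> borel_measurable borel" for b
    using f[of b] by (auto dest: borel_measurable_integrable)
  have eq: "(\<Prod>b\<in>Basis. f b ((\<Sum>c\<in>Basis. g c *\<^sub>R c) \<bullet> b)) = (\<Prod>b\<in>Basis. f b (g b))" for g :: "'a \<Rightarrow> real"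
    by (intro prod.cong) auto
  have m1: "(\<lambda>z::'a. \<Prod>b\<in>Basis. f b (z \<bullet> b)) \<in> borel_measurable borel"
    by measurable
  have m2: "(\<lambda>g. \<Sum>b\<in>Basis. g b *\<^sub>R b) \<in> (\<Pi>\<^sub>M b\<in>(Basis::'a set). (lborel::real measure)) \<rightarrow>\<^sub>M borel"
    by measurable
  have "has_bochner_integral (\<Pi>\<^sub>M b\<in>(Basis::'a set). (lborel::real measure)) (\<lambda>g. \<Prod>b\<in>Basis. f b (g b))
      (\<Prod>b\<in>Basis. \<integral>x. f b x \<partial>lborel)"
    using product_integrable_prod[of Basis f] product_integral_prod[of Basis f] f
    by (auto simp: has_bochner_integral_iff)
  then show ?thesis
    by (subst lborel_eq) (auto simp: has_bochner_integral_iff integrable_distr_eq[OF m2 m1] integral_distr[OF m2 m1] eq)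
qed

lemma borel_measurable_blinfun_apply_const:
  "\<xi> \<in> borel_measurable N \<Longrightarrow> (\<lambda>w. blinfun_apply (\<xi> w) c) \<in> borel_measurable N"
  by (erule measurable_compose) (intro borel_measurable_continuous_onI continuous_intros)

lemma blinfun_apply_Basis_sum:
  "blinfun_apply f x = (\<Sum>c\<in>Basis. (x \<bullet> c) *\<^sub>R blinfun_apply f c)"
  by (subst (1) euclidean_representation[symmetric]) (simp add: blinfun.sum_right blinfun.scaleR_right)

text \<open>Expanding the argument in a basis reduces the claim to evaluation at fixed vectors,
  which is continuous in the operator.\<close>

lemma borel_measurable_blinfun_apply:
  fixes \<xi> :: "'w \<Rightarrow> 'a::euclidean_space \<Rightarrow>\<^sub>L 'b::euclidean_space"
  assumes "\<xi> \<in> borel_measurable N" "X \<in> borel_measurable N"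
  shows "(\<lambda>w. blinfun_apply (\<xi> w) (X w)) \<in> borel_measurable N"
  by (subst blinfun_apply_Basis_sum)
     (use assms in \<open>intro borel_measurable_sum borel_measurable_scaleR borel_measurable_inner
        borel_measurable_const borel_measurable_blinfun_apply_const\<close>)

text \<open>The Hilbert-Schmidt inner product. For it the Ito isometry is an equality; the operator
  norm in \<open>has_ito_integral\<close> controls it up to the factor
  \<open>DIM('a)\<close>.\<close>

definition hs_inner :: "('a::euclidean_space \<Rightarrow>\<^sub>L 'a) \<Rightarrow> ('a \<Rightarrow>\<^sub>L 'a) \<Rightarrow> real" where
  "hs_inner f g = (\<Sum>c\<in>Basis. f c \<bullet> g c)"

lemma hs_inner_sum_left: "hs_inner (\<Sum>a\<in>A. f a) g = (\<Sum>a\<in>A. hs_inner (f a) g)"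
  unfolding hs_inner_def by (subst sum.swap) (simp add: blinfun.sum_left inner_sum_left)

lemma hs_inner_commute: "hs_inner f g = hs_inner g f"
  unfolding hs_inner_def by (simp add: inner_commute)

lemma hs_inner_sum_right: "hs_inner g (\<Sum>a\<in>A. f a) = (\<Sum>a\<in>A. hs_inner g (f a))"
  using hs_inner_sum_left[of f A g] by (simp add: hs_inner_commute)

lemma hs_inner_scaleR: "hs_inner (r *\<^sub>R f) (q *\<^sub>R g) = r * q * hs_inner f g"
  unfolding hs_inner_def by (simp add: blinfun.scaleR_left sum_distrib_left mult_ac)

lemma hs_inner_self_nonneg: "0 \<le> hs_inner f f"
  unfolding hs_inner_def by (simp add: sum_nonneg)

lemma abs_hs_inner_le: "\<bar>hs_inner (f :: 'a::euclidean_space \<Rightarrow>\<^sub>L 'a) g\<bar> \<le> DIM('a) * (norm f * norm g)"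
proof -
  have "\<bar>f c \<bullet> g c\<bar> \<le> norm f * norm g" if "c \<in> Basis" for c
  proof -
    have "\<bar>f c \<bullet> g c\<bar> \<le> norm (f c) * norm (g c)" by (rule Cauchy_Schwarz_ineq2)
    also have "\<dots> \<le> norm f * norm g"
      using norm_blinfun[of f c] norm_blinfun[of g c] that by (intro mult_mono) auto
    finally show ?thesis .
  qed
  then have "\<bar>hs_inner f g\<bar> \<le> (\<Sum>c\<in>(Basis::'a set). norm f * norm g)"
    unfolding hs_inner_def by (intro order_trans[OF sum_abs] sum_mono) auto
  then show ?thesis by simp
qed

lemma hs_inner_measurable:
  fixes f g :: "'w \<Rightarrow> 'a::euclidean_space \<Rightarrow>\<^sub>L 'a"
  assumes "f \<in> borel_measurable N" "g \<in> borel_measurable N"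
  shows "(\<lambda>w. hs_inner (f w) (g w)) \<in> borel_measurable N"
  unfolding hs_inner_def using assms
  by (intro borel_measurable_sum borel_measurable_inner borel_measurable_blinfun_apply_const) auto

lemma Int_stable_vimage_borel: "Int_stable {f -` A \<inter> \<Omega> | A. A \<in> sets borel}"
proof (rule Int_stableI)
  fix a b assume "a \<in> {f -` A \<inter> \<Omega> | A. A \<in> sets borel}" "b \<in> {f -` A \<inter> \<Omega> | A. A \<in> sets borel}"
  then obtain A A' where A: "A \<in> sets borel" "A' \<in> sets borel" "a = f -` A \<inter> \<Omega>" "b = f -` A' \<inter> \<Omega>"
    by blast
  then show "a \<inter> b \<in> {f -` A \<inter> \<Omega> | A. A \<in> sets borel}"
    by (intro CollectI exI[of _ "A \<inter> A'"]) auto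
qed

section \<open>Moments of Brownian increments\<close>

locale brownian_setting =
  fixes M :: "'w measure" and F :: "real \<Rightarrow> 'w measure" and B :: "real \<Rightarrow> 'w \<Rightarrow> 'a::euclidean_space"
  assumes filt: "filtered_prob_space M F" and bm: "standard_brownian_motion M F B"
begin

sublocale prob_space M
  using filt by (simp add: filtered_prob_space_def)

lemma space_F [simp]: "space (F t) = space M"
  using filt by (auto simp: filtered_prob_space_def filtration_def)

lemma sets_F: "sets (F t) \<subseteq> sets M"
  using filt by (auto simp: filtered_prob_space_def subalgebra_def)

lemma sets_F_mono: "s \<le> t \<Longrightarrow> sets (F s) \<subseteq> sets (F t)"
  using filt by (simp add: filtered_prob_space_def filtration_def)

lemma measurable_F_mono: "f \<in> measurable (F s) N \<Longrightarrow> s \<le> t \<Longrightarrow> f \<in> measurable (F t) N"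
  using sets_F_mono[of s t] unfolding measurable_def by auto

lemma measurable_F_M: "f \<in> measurable (F s) N \<Longrightarrow> f \<in> measurable M N"
  using sets_F[of s] unfolding measurable_def by auto

lemma B_measurable: "0 \<le> t \<Longrightarrow> B t \<in> borel_measurable (F t)"
  using bm by (auto simp: standard_brownian_motion_def)

lemma increment_measurable:
  "0 \<le> s \<Longrightarrow> s \<le> t \<Longrightarrow> (\<lambda>w. B t w - B s w) \<in> borel_measurable (F t)"
  by (intro borel_measurable_diff B_measurable measurable_F_mono[OF B_measurable[of s]]) auto

lemma increment_moments:
  assumes st: "0 \<le> s" "s < t" and bb: "b \<in> Basis" "b' \<in> Basis"
  shows "has_bochner_integral M (\<lambda>w. (B t w - B s w) \<bullet> b) 0"
    and "has_bochner_integral M (\<lambda>w. ((B t w - B s w) \<bullet> b) * ((B t w - B s w) \<bullet> b')) (if b = b' then t - s else 0)"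
proof -
  let ?N = "normal_density 0 (sqrt (t - s))"
  have \<sigma>: "0 < sqrt (t - s)" using st by simp
  let ?D = "\<lambda>z::'a. \<Prod>c\<in>Basis. ?N (z \<bullet> c)"
  have dist: "distributed M lborel (\<lambda>w. B t w - B s w) ?D"
    using bm st by (auto simp: standard_brownian_motion_def)
  have D0: "0 \<le> ?D z" for z by (intro prod_nonneg) auto
  have transfer: "has_bochner_integral M (\<lambda>w. g (B t w - B s w)) v"
    if "has_bochner_integral lborel (\<lambda>z. ?D z * g z) v" "g \<in> borel_measurable borel" for g and v :: real
    using that distributed_integrable[OF dist, of g] distributed_integral[OF dist, of g] D0
    by (auto simp: has_bochner_integral_iff)
  have i0: "integrable lborel ?N" "(\<integral>x. ?N x \<partial>lborel) = 1"
    using \<sigma> by auto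
  have i1: "integrable lborel (\<lambda>x. ?N x * x)" "(\<integral>x. ?N x * x \<partial>lborel) = 0"
    using integrable_normal_moment_nz_1[OF \<sigma>, of 0] integral_normal_moment_nz_1[OF \<sigma>, of 0] by auto
  have i2: "integrable lborel (\<lambda>x. ?N x * x^2)" "(\<integral>x. ?N x * x^2 \<partial>lborel) = t - s"
    using integrable_normal_moment[OF \<sigma>, of 0 2] integral_normal_moment_even[OF \<sigma>, of 0 1] st
    by simp_all
  \<comment> \<open>The Gaussian density times a monomial factors over the coordinates; both moments
    are instances of this with a suitable exponent vector \<open>e\<close>.\<close>
  have mono: "has_bochner_integral lborel (\<lambda>z::'a. \<Prod>c\<in>Basis. ?N (z \<bullet> c) * (z \<bullet> c) ^ e c)
      (\<Prod>c\<in>Basis. \<integral>x. ?N x * x ^ e c \<partial>lborel)" for e :: "'a \<Rightarrow> nat"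
    by (rule lborel_prod_Basis) (use integrable_normal_moment[OF \<sigma>, of 0] in auto)
  have e1: "(\<Prod>c\<in>Basis. ?N (z \<bullet> c) * (z \<bullet> c) ^ (if c = b then 1 else 0)) = ?D z * (z \<bullet> b)" for z
  proof -
    have "(\<Prod>c\<in>Basis. (z \<bullet> c) ^ (if c = b then 1 else 0)) = (\<Prod>c\<in>Basis. if c = b then z \<bullet> c else 1)"
      by (intro prod.cong) auto
    also have "\<dots> = z \<bullet> b" using bb by simp
    finally show ?thesis by (simp add: prod.distrib)
  qed
  have v1: "(\<Prod>c\<in>Basis. \<integral>x. ?N x * x ^ (if c = b then 1 else 0) \<partial>lborel) = 0"
    using bb i1 by (intro prod_zero bexI[of _ b]) auto
  show "has_bochner_integral M (\<lambda>w. (B t w - B s w) \<bullet> b) 0"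
    using mono[of "\<lambda>c. if c = b then 1 else 0"] unfolding e1 v1
    by (rule transfer) simp
  let ?e = "\<lambda>c. (if c = b then 1 else 0) + (if c = b' then 1 else (0::nat))"
  have e2: "(\<Prod>c\<in>Basis. ?N (z \<bullet> c) * (z \<bullet> c) ^ ?e c) = ?D z * ((z \<bullet> b) * (z \<bullet> b'))" for z
  proof -
    have "(\<Prod>c\<in>Basis. (z \<bullet> c) ^ ?e c) =
        (\<Prod>c\<in>Basis. if c = b then z \<bullet> c else 1) * (\<Prod>c\<in>Basis. if c = b' then z \<bullet> c else 1)"
      unfolding prod.distrib[symmetric] by (intro prod.cong) auto
    also have "\<dots> = (z \<bullet> b) * (z \<bullet> b')" using bb by simp
    finally show ?thesis by (simp add: prod.distrib)
  qed
  have v2: "(\<Prod>c\<in>Basis. \<integral>x. ?N x * x ^ ?e c \<partial>lborel) = (if b = b' then t - s else 0)"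
  proof (cases "b = b'")
    case True
    then have "(\<Prod>c\<in>Basis. \<integral>x. ?N x * x ^ ?e c \<partial>lborel) = (\<Prod>c\<in>Basis. if c = b then t - s else 1)"
      using i2 i0 by (intro prod.cong) (auto simp: power2_eq_square)
    then show ?thesis using True bb by simp
  next
    case False
    then show ?thesis using bb i1 by simp (intro bexI[of _ b], auto)
  qed
  show "has_bochner_integral M (\<lambda>w. ((B t w - B s w) \<bullet> b) * ((B t w - B s w) \<bullet> b')) (if b = b' then t - s else 0)"
    using mono[of ?e] unfolding e2 v2
    by (rule transfer) simp
qed

text \<open>The independence of the increment from the past enters here: preimages under
  \<open>Y\<close> lie in \<open>F s\<close>, and independence passes from the generating preimages
  to the sigma-algebras. All orthogonality of stochastic integrals goes back to this product
  rule.\<close>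

lemma increment_mult:
  fixes Y :: "'w \<Rightarrow> real" and g :: "'a \<Rightarrow> real"
  assumes st: "0 \<le> s" "s < t" and Y: "Y \<in> borel_measurable (F s)" "integrable M Y"
    and g: "g \<in> borel_measurable borel" "has_bochner_integral M (\<lambda>w. g (B t w - B s w)) v"
  shows "has_bochner_integral M (\<lambda>w. Y w * g (B t w - B s w)) (expectation Y * v)"
proof -
  let ?X = "\<lambda>w. B t w - B s w"
  have X: "?X \<in> borel_measurable M"
    using increment_measurable[of s t] st by (auto intro: measurable_F_M)
  have gX: "(\<lambda>w. g (?X w)) \<in> borel_measurable M"
    using X g(1) by measurable
  have ind: "indep_set (sets (F s)) {?X -` A \<inter> space M | A. A \<in> sets borel}"
    using bm st by (auto simp: standard_brownian_motion_def)
  have "indep_set {Y -` A \<inter> space M |A. A \<in> sets borel} {(\<lambda>w. g (?X w)) -` A \<inter> space M |A. A \<in> sets borel}"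
    unfolding indep_sets2_eq
  proof (intro conjI ballI)
    show "{Y -` A \<inter> space M |A. A \<in> sets borel} \<subseteq> events"
      using Y(2) by auto
    show "{(\<lambda>w. g (?X w)) -` A \<inter> space M |A. A \<in> sets borel} \<subseteq> events"
      using gX by (auto simp: measurable_sets)
    fix a b assume a: "a \<in> {Y -` A \<inter> space M |A. A \<in> sets borel}"
      and b: "b \<in> {(\<lambda>w. g (?X w)) -` A \<inter> space M |A. A \<in> sets borel}"
    from a have "a \<in> sets (F s)"
      using measurable_sets[OF Y(1)] by auto
    moreover from b obtain A where A: "A \<in> sets borel" "b = (\<lambda>w. g (?X w)) -` A \<inter> space M" by auto
    then have "b = ?X -` (g -` A) \<inter> space M" "g -` A \<in> sets borel"
      using measurable_sets[OF g(1) A(1)] by auto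
    then have "b \<in> {?X -` A \<inter> space M | A. A \<in> sets borel}" by blast
    ultimately show "prob (a \<inter> b) = prob a * prob b"
      by (rule indep_setD[OF ind])
  qed
  then have "indep_set (sigma_sets (space M) {Y -` A \<inter> space M |A. A \<in> sets borel})
     (sigma_sets (space M) {(\<lambda>w. g (?X w)) -` A \<inter> space M |A. A \<in> sets borel})"
    by (intro indep_set_sigma_sets Int_stable_vimage_borel)
  then have "indep_var borel Y borel (\<lambda>w. g (?X w))"
    unfolding indep_var_eq using Y(2) gX by auto
  from indep_var_lebesgue_integral[OF this Y(2)] indep_var_integrable[OF this Y(2)] g(2)
  show ?thesis by (auto simp: has_bochner_integral_iff)
qed

end

section \<open>Covariance of two weighted increments\<close>

context brownian_setting
begin

definition adapted_bounded :: "real \<Rightarrow> ('w \<Rightarrow> 'a \<Rightarrow>\<^sub>L 'a) \<Rightarrow> bool" where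
  "adapted_bounded l \<xi> \<longleftrightarrow> \<xi> \<in> borel_measurable (F l) \<and> bounded (\<xi> ` space M)"

lemma adapted_bounded_mono: "adapted_bounded l \<xi> \<Longrightarrow> l \<le> l' \<Longrightarrow> adapted_bounded l' \<xi>"
  unfolding adapted_bounded_def by (metis measurable_F_mono)

abbreviation incr :: "real \<Rightarrow> real \<Rightarrow> 'w \<Rightarrow> 'a" where
  "incr l u w \<equiv> B u w - B l w"

lemma adapted_boundedE:
  assumes "adapted_bounded l \<xi>"
  obtains k where "0 \<le> k" "\<And>w. w \<in> space M \<Longrightarrow> norm (\<xi> w) \<le> k"
proof -
  obtain k where "\<And>w. w \<in> space M \<Longrightarrow> norm (\<xi> w) \<le> k"
    using assms unfolding adapted_bounded_def bounded_iff by auto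
  then have "norm (\<xi> w) \<le> max 0 k" if "w \<in> space M" for w
    using that by (meson max.coboundedI2)
  then show ?thesis by (intro that[of "max 0 k"]) auto
qed

lemma integrable_norm_incr: "0 \<le> l \<Longrightarrow> l \<le> u \<Longrightarrow> integrable M (\<lambda>w. norm (incr l u w))"
proof (cases "l = u")
  case False
  assume lu: "0 \<le> l" "l \<le> u"
  have "integrable M (\<lambda>w. incr l u w \<bullet> b)" if "b \<in> Basis" for b
    using increment_moments(1)[of l u b b] lu False that by (auto simp: has_bochner_integral_iff)
  then have "integrable M (\<lambda>w. \<Sum>b\<in>Basis. \<bar>incr l u w \<bullet> b\<bar>)"
    by (intro Bochner_Integration.integrable_sum integrable_abs) auto
  then show ?thesis
  proof (rule Bochner_Integration.integrable_bound)
    show "(\<lambda>w. norm (incr l u w)) \<in> borel_measurable M"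
      using measurable_F_M[OF increment_measurable[of l u]] lu by simp
    show "AE w in M. norm (norm (incr l u w)) \<le> norm (\<Sum>b\<in>Basis. \<bar>incr l u w \<bullet> b\<bar>)"
      using norm_le_l1 by (auto simp: sum_nonneg)
  qed
qed simp

lemma incr_apply_measurable:
  assumes "0 \<le> l" "l \<le> u" "adapted_bounded l \<xi>"
  shows "(\<lambda>w. \<xi> w (incr l u w)) \<in> borel_measurable (F u)"
proof (rule borel_measurable_blinfun_apply)
  show "\<xi> \<in> borel_measurable (F u)"
    using adapted_bounded_mono[OF assms(3,2)] by (simp add: adapted_bounded_def)
qed (rule increment_measurable[OF assms(1,2)])

lemma integrable_hs_inner:
  assumes "adapted_bounded l \<xi>" "adapted_bounded l' \<eta>"
  shows "integrable M (\<lambda>w. hs_inner (\<xi> w) (\<eta> w))"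
proof -
  obtain k where k: "0 \<le> k" "\<And>w. w \<in> space M \<Longrightarrow> norm (\<xi> w) \<le> k" using adapted_boundedE[OF assms(1)] by blast
  obtain k' where k': "0 \<le> k'" "\<And>w. w \<in> space M \<Longrightarrow> norm (\<eta> w) \<le> k'" using adapted_boundedE[OF assms(2)] by blast
  show ?thesis
  proof (rule integrable_const_bound[of _ "DIM('a) * (k * k')"])
    show "AE w in M. norm (hs_inner (\<xi> w) (\<eta> w)) \<le> DIM('a) * (k * k')"
    proof (rule AE_I2)
      fix w assume "w \<in> space M"
      then have "norm (\<xi> w) * norm (\<eta> w) \<le> k * k'" using k k' by (intro mult_mono) auto
      then have "DIM('a) * (norm (\<xi> w) * norm (\<eta> w)) \<le> DIM('a) * (k * k')" by (intro mult_left_mono) auto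
      then show "norm (hs_inner (\<xi> w) (\<eta> w)) \<le> DIM('a) * (k * k')"
        unfolding real_norm_def using abs_hs_inner_le[of "\<xi> w" "\<eta> w"] by linarith
    qed
    show "(\<lambda>w. hs_inner (\<xi> w) (\<eta> w)) \<in> borel_measurable M"
      using assms unfolding adapted_bounded_def by (intro hs_inner_measurable) (blast intro: measurable_F_M)+
  qed
qed

text \<open>Expanding both images in a basis leaves products of coordinates of the increment.
  Distinct coordinates are uncorrelated, so the double sum collapses to its diagonal, which is the
  Hilbert-Schmidt product.\<close>

lemma incr_covariance_same:
  assumes lu: "0 \<le> l" "l < u" and \<xi>: "adapted_bounded l \<xi>" and \<eta>: "adapted_bounded l \<eta>"
  shows "has_bochner_integral M (\<lambda>w. \<xi> w (incr l u w) \<bullet> \<eta> w (incr l u w))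
    ((u - l) * expectation (\<lambda>w. hs_inner (\<xi> w) (\<eta> w)))"
proof -
  obtain k where k: "0 \<le> k" "\<And>w. w \<in> space M \<Longrightarrow> norm (\<xi> w) \<le> k" using adapted_boundedE[OF \<xi>] by blast
  obtain k' where k': "0 \<le> k'" "\<And>w. w \<in> space M \<Longrightarrow> norm (\<eta> w) \<le> k'" using adapted_boundedE[OF \<eta>] by blast
  have Ym: "(\<lambda>w. \<xi> w c \<bullet> \<eta> w d) \<in> borel_measurable (F l)" for c d
    using \<xi> \<eta> by (intro borel_measurable_inner borel_measurable_blinfun_apply_const) (auto simp: adapted_bounded_def)
  have Yi: "integrable M (\<lambda>w. \<xi> w c \<bullet> \<eta> w d)" if "c \<in> Basis" "d \<in> Basis" for c d
  proof (rule integrable_const_bound[of _ "k * k'"])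
    show "AE w in M. norm (\<xi> w c \<bullet> \<eta> w d) \<le> k * k'"
    proof (rule AE_I2)
      fix w assume sp: "w \<in> space M"
      have "norm (\<xi> w c \<bullet> \<eta> w d) \<le> norm (\<xi> w c) * norm (\<eta> w d)" using Cauchy_Schwarz_ineq2 by simp
      also have "\<dots> \<le> k * k'"
        using norm_blinfun[of "\<xi> w" c] norm_blinfun[of "\<eta> w" d] that k(2)[OF sp] k'(2)[OF sp] k(1)
        by (intro mult_mono) auto
      finally show "norm (\<xi> w c \<bullet> \<eta> w d) \<le> k * k'" .
    qed
  qed (rule measurable_F_M[OF Ym])
  have eq: "\<xi> w x \<bullet> \<eta> w x = (\<Sum>c\<in>Basis. \<Sum>d\<in>Basis. (\<xi> w c \<bullet> \<eta> w d) * ((x \<bullet> c) * (x \<bullet> d)))" for w x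
    by (subst (1 2) blinfun_apply_Basis_sum, subst sum.swap)
       (simp add: inner_sum_left inner_sum_right mult_ac sum_distrib_left)
  have summand: "has_bochner_integral M (\<lambda>w. (\<xi> w c \<bullet> \<eta> w d) * ((incr l u w \<bullet> c) * (incr l u w \<bullet> d)))
    (expectation (\<lambda>w. \<xi> w c \<bullet> \<eta> w d) * (if c = d then u - l else 0))"
    if "c \<in> Basis" "d \<in> Basis" for c d
    by (rule increment_mult[OF lu Ym Yi[OF that], of "\<lambda>z. (z \<bullet> c) * (z \<bullet> d)"])
       (use increment_moments(2)[OF lu that] in auto)
  have "(\<Sum>c\<in>Basis. \<Sum>d\<in>Basis. expectation (\<lambda>w. \<xi> w c \<bullet> \<eta> w d) * (if c = d then u - l else 0)) =
      (u - l) * (\<Sum>c\<in>Basis. expectation (\<lambda>w. \<xi> w c \<bullet> \<eta> w c))"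
    unfolding sum_distrib_left
  proof (rule sum.cong[OF refl])
    fix c :: 'a assume "c \<in> Basis"
    then show "(\<Sum>d\<in>Basis. expectation (\<lambda>w. \<xi> w c \<bullet> \<eta> w d) * (if c = d then u - l else 0)) =
      (u - l) * expectation (\<lambda>w. \<xi> w c \<bullet> \<eta> w c)"
      by (subst sum.remove[of _ c]) (auto intro!: sum.neutral split: if_splits)
  qed
  also have "(\<Sum>c\<in>Basis. expectation (\<lambda>w. \<xi> w c \<bullet> \<eta> w c)) = expectation (\<lambda>w. hs_inner (\<xi> w) (\<eta> w))"
    unfolding hs_inner_def using Yi by (subst Bochner_Integration.integral_sum) auto
  finally have v: "(\<Sum>c\<in>Basis. \<Sum>d\<in>Basis. expectation (\<lambda>w. \<xi> w c \<bullet> \<eta> w d) * (if c = d then u - l else 0)) =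
    (u - l) * expectation (\<lambda>w. hs_inner (\<xi> w) (\<eta> w))" .
  show ?thesis
    unfolding eq v[symmetric] by (intro has_bochner_integral_sum summand)
qed

text \<open>The martingale property for one increment: each coordinate of the increment has mean 0
  and is independent of the factors known at time \<open>l\<close>. \<open>Z\<close> is merely
  integrable, so that an earlier weighted increment can be inserted for it.\<close>

lemma incr_orthogonal:
  assumes lu: "0 \<le> l" "l \<le> u" and \<eta>: "adapted_bounded l \<eta>"
    and Zm: "Z \<in> borel_measurable (F l)" and Zi: "integrable M (\<lambda>w. norm (Z w))"
  shows "has_bochner_integral M (\<lambda>w. Z w \<bullet> \<eta> w (incr l u w)) 0"
proof (cases "l = u")
  case True
  then show ?thesis by (simp add: blinfun.zero_right has_bochner_integral_zero)
next
  case False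
  then have lu': "0 \<le> l" "l < u" using lu by auto
  obtain k where k: "0 \<le> k" "\<And>w. w \<in> space M \<Longrightarrow> norm (\<eta> w) \<le> k" using adapted_boundedE[OF \<eta>] by blast
  have Ym: "(\<lambda>w. Z w \<bullet> \<eta> w d) \<in> borel_measurable (F l)" for d
  proof (intro borel_measurable_inner borel_measurable_blinfun_apply_const)
    show "\<eta> \<in> borel_measurable (F l)" using \<eta> by (simp add: adapted_bounded_def)
  qed (rule Zm)
  have Yi: "integrable M (\<lambda>w. Z w \<bullet> \<eta> w d)" if "d \<in> Basis" for d
  proof (rule Bochner_Integration.integrable_bound)
    show "integrable M (\<lambda>w. k * norm (Z w))" using Zi by simp
    show "AE w in M. norm (Z w \<bullet> \<eta> w d) \<le> norm (k * norm (Z w))"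
    proof (rule AE_I2)
      fix w assume sp: "w \<in> space M"
      have "norm (Z w \<bullet> \<eta> w d) \<le> norm (Z w) * norm (\<eta> w d)"
        using Cauchy_Schwarz_ineq2 by simp
      also have "\<dots> \<le> norm (Z w) * k"
        using norm_blinfun[of "\<eta> w" d] k(2)[OF sp] that by (intro mult_left_mono) auto
      finally show "norm (Z w \<bullet> \<eta> w d) \<le> norm (k * norm (Z w))"
        using k by (simp add: abs_mult mult_ac)
    qed
  qed (rule measurable_F_M[OF Ym])
  have eq: "Z w \<bullet> \<eta> w x = (\<Sum>d\<in>Basis. (Z w \<bullet> \<eta> w d) * (x \<bullet> d))" for w x
    by (subst blinfun_apply_Basis_sum) (simp add: inner_sum_right mult_ac)
  have "has_bochner_integral M (\<lambda>w. \<Sum>d\<in>Basis. (Z w \<bullet> \<eta> w d) * (incr l u w \<bullet> d))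
     (\<Sum>d\<in>Basis. expectation (\<lambda>w. Z w \<bullet> \<eta> w d) * 0)"
    by (intro has_bochner_integral_sum increment_mult[OF lu' Ym Yi, of _ "\<lambda>z. z \<bullet> _"] increment_moments(1)[OF lu'])
       auto
  then show ?thesis unfolding eq[symmetric] by simp
qed

lemma incr_covariance_disjoint:
  assumes lu: "0 \<le> l" "l \<le> u" "u \<le> l'" "l' \<le> u'" and \<xi>: "adapted_bounded l \<xi>" and \<eta>: "adapted_bounded l' \<eta>"
  shows "has_bochner_integral M (\<lambda>w. \<xi> w (incr l u w) \<bullet> \<eta> w (incr l' u' w)) 0"
proof (rule incr_orthogonal)
  show m: "(\<lambda>w. \<xi> w (incr l u w)) \<in> borel_measurable (F l')"
    by (rule measurable_F_mono[OF incr_apply_measurable[OF lu(1,2) \<xi>] lu(3)])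
  obtain k where k: "0 \<le> k" "\<And>w. w \<in> space M \<Longrightarrow> norm (\<xi> w) \<le> k" using adapted_boundedE[OF \<xi>] by blast
  show "integrable M (\<lambda>w. norm (\<xi> w (incr l u w)))"
  proof (rule Bochner_Integration.integrable_bound)
    show "integrable M (\<lambda>w. k * norm (incr l u w))"
      using integrable_norm_incr[OF lu(1,2)] by simp
    show "AE w in M. norm (norm (\<xi> w (incr l u w))) \<le> norm (k * norm (incr l u w))"
    proof (rule AE_I2)
      fix w assume sp: "w \<in> space M"
      show "norm (norm (\<xi> w (incr l u w))) \<le> norm (k * norm (incr l u w))"
        using norm_blinfun[of "\<xi> w" "incr l u w"] mult_right_mono[OF k(2)[OF sp], of "norm (incr l u w)"] k
        by (auto simp: abs_mult)
    qed
    show "(\<lambda>w. norm (\<xi> w (incr l u w))) \<in> borel_measurable M"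
      by (rule measurable_compose[OF measurable_F_M[OF m] borel_measurable_norm])
  qed
qed (use lu \<eta> in auto)

text \<open>Both increments are cut at \<open>l'\<close> and at the earlier of the two end points.
  Pieces over disjoint intervals are uncorrelated, so only the common piece counts, with the length
  of the overlap as factor.\<close>

lemma incr_covariance_ordered:
  assumes lu: "0 \<le> l" "l \<le> u" "l \<le> l'" "l' \<le> u'" and \<xi>: "adapted_bounded l \<xi>" and \<eta>: "adapted_bounded l' \<eta>"
  shows "has_bochner_integral M (\<lambda>w. \<xi> w (incr l u w) \<bullet> \<eta> w (incr l' u' w))
    (max 0 (min u u' - max l l') * expectation (\<lambda>w. hs_inner (\<xi> w) (\<eta> w)))"
proof -
  let ?E = "expectation (\<lambda>w. hs_inner (\<xi> w) (\<eta> w))"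
  have \<xi>': "adapted_bounded v \<xi>" if "l \<le> v" for v using adapted_bounded_mono[OF \<xi> that] .
  have \<eta>': "adapted_bounded v \<eta>" if "l' \<le> v" for v using adapted_bounded_mono[OF \<eta> that] .
  consider "u \<le> l'" | "l' < u" "l' = u'" | "l' < u" "l' < u'" using lu by linarith
  then show ?thesis
  proof cases
    case 1
    then show ?thesis using incr_covariance_disjoint[OF lu(1,2) 1 lu(4) \<xi> \<eta>] lu 1 by (simp add: max_absorb1 max_absorb2)
  next
    case 2
    then show ?thesis using lu by (simp add: blinfun.zero_right has_bochner_integral_zero)
  next
    case 3
    let ?m = "min u u'"
    have m: "l' < ?m" using 3 by simp
    let ?X = "\<lambda>w. \<xi> w (incr l l' w) \<bullet> \<eta> w (incr l' u' w)"
    let ?Y = "\<lambda>w. \<xi> w (incr l' ?m w) \<bullet> \<eta> w (incr l' ?m w)"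
    let ?Z = "\<lambda>w. \<xi> w (incr l' ?m w) \<bullet> \<eta> w (incr ?m u' w)"
    let ?W = "\<lambda>w. \<eta> w (incr l' ?m w) \<bullet> \<xi> w (incr ?m u w)"
    have X: "has_bochner_integral M ?X 0"
      using lu by (intro incr_covariance_disjoint \<xi> \<eta>) auto
    have Y: "has_bochner_integral M ?Y ((?m - l') * ?E)"
      using lu m by (intro incr_covariance_same \<xi>' \<eta>') auto
    have Z: "has_bochner_integral M ?Z 0"
      using lu m by (intro incr_covariance_disjoint \<xi>' \<eta>') auto
    have W: "has_bochner_integral M ?W 0"
      using lu m by (intro incr_covariance_disjoint \<xi>' \<eta>') auto
    \<comment> \<open>Since \<open>?m\<close> is one of \<open>u\<close> and \<open>u'\<close>, one
      of \<open>?Z\<close> and \<open>?W\<close> vanishes; the other holds the tail of the longer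
      increment.\<close>
    have eq: "?X w + ?Y w + ?Z w + ?W w = \<xi> w (incr l u w) \<bullet> \<eta> w (incr l' u' w)" for w
    proof (cases "u \<le> u'")
      case True
      then show ?thesis
        by (simp add: min_absorb1 blinfun.diff_right blinfun.zero_right inner_diff_left inner_diff_right)
    next
      case False
      then show ?thesis
        by (simp add: min_absorb2 blinfun.diff_right blinfun.zero_right inner_diff_left inner_diff_right inner_commute[of "\<eta> w _"])
    qed
    have "has_bochner_integral M (\<lambda>w. ?X w + ?Y w + ?Z w + ?W w) (0 + (?m - l') * ?E + 0 + 0)"
      by (intro has_bochner_integral_add X Y Z W)
    then show ?thesis using lu m unfolding eq by (simp add: max_def)
  qed
qed

lemma incr_covariance:
  assumes lu: "0 \<le> l" "l \<le> u" "0 \<le> l'" "l' \<le> u'" and \<xi>: "adapted_bounded l \<xi>" and \<eta>: "adapted_bounded l' \<eta>"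
  shows "has_bochner_integral M (\<lambda>w. \<xi> w (incr l u w) \<bullet> \<eta> w (incr l' u' w))
    (max 0 (min u u' - max l l') * expectation (\<lambda>w. hs_inner (\<xi> w) (\<eta> w)))"
proof (cases "l \<le> l'")
  case True
  then show ?thesis using assms by (intro incr_covariance_ordered) auto
next
  case False
  then have "has_bochner_integral M (\<lambda>w. \<eta> w (incr l' u' w) \<bullet> \<xi> w (incr l u w))
    (max 0 (min u' u - max l' l) * expectation (\<lambda>w. hs_inner (\<eta> w) (\<xi> w)))"
    using assms by (intro incr_covariance_ordered) auto
  then show ?thesis by (simp add: inner_commute hs_inner_commute min.commute max.commute)
qed

end

section \<open>Isometry and martingale property of simple integrals\<close>

lemma hs_inner_add_self:
  "hs_inner (f + g) (f + g) \<le> 2 * (hs_inner f f + hs_inner g (g :: 'a::euclidean_space \<Rightarrow>\<^sub>L 'a))"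
proof -
  have "(u + v) \<bullet> (u + v) \<le> 2 * (u \<bullet> u + v \<bullet> v)" for u v :: 'a
    using inner_ge_zero[of "u - v"] by (simp add: inner_diff_left inner_diff_right inner_add_left inner_add_right inner_commute)
  then show ?thesis
    unfolding hs_inner_def by (simp add: blinfun.add_left sum.distrib[symmetric] sum_distrib_left sum_mono)
qed

lemma hs_inner_add3_self:
  "hs_inner (f + g + h) (f + g + h) \<le> 4 * (hs_inner f f + hs_inner g g + hs_inner h (h :: 'a::euclidean_space \<Rightarrow>\<^sub>L 'a))"
  using hs_inner_add_self[of "f + g" h] hs_inner_add_self[of f g] hs_inner_self_nonneg[of h] by simp

lemma hs_inner_minus: "hs_inner (- f) (- f) = hs_inner f f"
  unfolding hs_inner_def by (simp add: blinfun.minus_left)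

lemma hs_inner_self_le: "hs_inner f f \<le> DIM('a) * (norm (f :: 'a::euclidean_space \<Rightarrow>\<^sub>L 'a))\<^sup>2"
  using abs_hs_inner_le[of f f] by (simp add: power2_eq_square)

lemma hs_inner_measurable_coords:
  assumes "\<And>c. (\<lambda>q. blinfun_apply (f q) c) \<in> borel_measurable N"
  shows "(\<lambda>q. hs_inner (f q) (f q :: 'a::euclidean_space \<Rightarrow>\<^sub>L 'a)) \<in> borel_measurable N"
  unfolding hs_inner_def using assms by (intro borel_measurable_sum borel_measurable_inner)

text \<open>Identifies the overlap factor in the covariance of two increments with an L^2 product in
  time, which is how the time integral enters the isometry.\<close>

lemma Ioc_overlap_integral:
  "has_bochner_integral lborel (\<lambda>r. indicator {l<..u} r * indicator {l'<..u'} r :: real) (max 0 (min u u' - max l l'))"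
proof -
  let ?a = "max l l'" and ?b = "min u u'"
  have "has_bochner_integral lborel (indicator {?a<..?b}) (measure lborel {?a<..?b})"
  proof (rule has_bochner_integral_real_indicator)
    have "emeasure lborel {a<..b} < \<infinity>" for a b :: real by (cases "a \<le> b") auto
    then show "emeasure lborel {?a<..?b} < \<infinity>" .
  qed simp
  moreover have "measure lborel {a<..b} = max 0 (b - a)" for a b :: real
    by (cases "a \<le> b") auto
  ultimately show ?thesis
    by (simp add: indicator_inter_arith[symmetric] Int_greaterThanAtMost)
qed

context brownian_setting
begin

text \<open>The index type is left free so that the intervals of two different partitions can be put
  side by side in a disjoint sum.\<close>

definition adapted_family where
  "adapted_family A l u \<xi> \<longleftrightarrow> finite A \<and> (\<forall>a\<in>A. 0 \<le> l a \<and> l a \<le> u a \<and> adapted_bounded (l a) (\<xi> a))"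

text \<open>By bilinearity the isometry reduces to the covariance of two increments, so the intervals may
  overlap arbitrarily and no common refinement of partitions is needed.\<close>

lemma ito_isometry:
  fixes \<xi> :: "'i \<Rightarrow> 'w \<Rightarrow> 'a \<Rightarrow>\<^sub>L 'a"
  assumes fam: "adapted_family A l u \<xi>"
  defines "S \<equiv> \<lambda>w. \<Sum>a\<in>A. \<xi> a w (incr (l a) (u a) w)"
    and "P \<equiv> \<lambda>r w. \<Sum>a\<in>A. indicator {l a<..u a} r *\<^sub>R \<xi> a w"
  shows "integrable M (\<lambda>w. (norm (S w))\<^sup>2)"
    and "(\<integral>\<^sup>+w. ennreal ((norm (S w))\<^sup>2) \<partial>M) = (\<integral>\<^sup>+w. (\<integral>\<^sup>+r. ennreal (hs_inner (P r w) (P r w)) \<partial>lborel) \<partial>M)"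
proof -
  have A: "finite A" "\<And>a. a \<in> A \<Longrightarrow> 0 \<le> l a" "\<And>a. a \<in> A \<Longrightarrow> l a \<le> u a" "\<And>a. a \<in> A \<Longrightarrow> adapted_bounded (l a) (\<xi> a)"
    using fam by (auto simp: adapted_family_def)
  define ov where "ov a b = max 0 (min (u a) (u b) - max (l a) (l b))" for a b
  have Seq: "(norm (S w))\<^sup>2 = (\<Sum>a\<in>A. \<Sum>b\<in>A. \<xi> a w (incr (l a) (u a) w) \<bullet> \<xi> b w (incr (l b) (u b) w))" for w
    unfolding S_def power2_norm_eq_inner by (simp add: inner_sum_left inner_sum_right, subst sum.swap, simp)
  have S: "has_bochner_integral M (\<lambda>w. (norm (S w))\<^sup>2)
      (\<Sum>a\<in>A. \<Sum>b\<in>A. ov a b * expectation (\<lambda>w. hs_inner (\<xi> a w) (\<xi> b w)))"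
    unfolding Seq ov_def by (intro has_bochner_integral_sum incr_covariance A)
  then show "integrable M (\<lambda>w. (norm (S w))\<^sup>2)" by (simp add: has_bochner_integral_iff)
  \<comment> \<open>The energy of \<open>P\<close> along a single outcome. Its expectation is the
    same double sum that computes the second moment of \<open>S\<close>.\<close>
  define Q where "Q w = (\<Sum>a\<in>A. \<Sum>b\<in>A. ov a b * hs_inner (\<xi> a w) (\<xi> b w))" for w
  have Peq: "hs_inner (P r w) (P r w) = (\<Sum>a\<in>A. \<Sum>b\<in>A. indicator {l a<..u a} r * indicator {l b<..u b} r * hs_inner (\<xi> a w) (\<xi> b w))" for r w
    unfolding P_def by (subst sum.swap) (simp add: hs_inner_sum_left hs_inner_sum_right hs_inner_scaleR)
  have P: "has_bochner_integral lborel (\<lambda>r. hs_inner (P r w) (P r w)) (Q w)" for w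
    unfolding Peq Q_def ov_def by (intro has_bochner_integral_sum has_bochner_integral_mult_left Ioc_overlap_integral)
  have PQ: "(\<integral>\<^sup>+r. ennreal (hs_inner (P r w) (P r w)) \<partial>lborel) = ennreal (Q w)" for w
    using P[of w] by (subst nn_integral_eq_integral) (auto simp: has_bochner_integral_iff hs_inner_self_nonneg)
  have Q0: "0 \<le> Q w" for w
  proof -
    have "Q w = (\<integral>r. hs_inner (P r w) (P r w) \<partial>lborel)"
      using P[of w] by (simp add: has_bochner_integral_iff)
    then show ?thesis by (simp add: hs_inner_self_nonneg)
  qed
  have Q: "has_bochner_integral M Q (\<Sum>a\<in>A. \<Sum>b\<in>A. ov a b * expectation (\<lambda>w. hs_inner (\<xi> a w) (\<xi> b w)))"
    unfolding Q_def by (intro has_bochner_integral_sum has_bochner_integral_mult_right has_bochner_integral_integrable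
      integrable_hs_inner[OF A(4) A(4)])
  show "(\<integral>\<^sup>+w. ennreal ((norm (S w))\<^sup>2) \<partial>M) = (\<integral>\<^sup>+w. (\<integral>\<^sup>+r. ennreal (hs_inner (P r w) (P r w)) \<partial>lborel) \<partial>M)"
    unfolding PQ using S Q Q0 by (simp add: nn_integral_eq_integral has_bochner_integral_iff)
qed

lemma simple_integrandD:
  assumes "simple_integrand M F T k r \<xi>"
  shows "i \<le> k \<Longrightarrow> 0 \<le> r i" "i \<le> k \<Longrightarrow> r i \<le> T" "i < k \<Longrightarrow> r i \<le> r (Suc i)" "i < k \<Longrightarrow> adapted_bounded (r i) (\<xi> i)"
proof -
  have r: "r 0 = 0" "r k = T" "\<And>i. i < k \<Longrightarrow> r i < r (Suc i)"
    using assms by (auto simp: simple_integrand_def)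
  show "0 \<le> r i" if "i \<le> k"
    using that
  proof (induction i)
    case (Suc i)
    then show ?case using r(3)[of i] by simp
  qed (simp add: r)
  show "r i \<le> T" if "i \<le> k"
    using that
  proof (induction rule: inc_induct)
    case (step i)
    then show ?case using r(3)[of i] by simp
  qed (simp add: r)
  show "i < k \<Longrightarrow> r i \<le> r (Suc i)" using r(3)[of i] by simp
  show "i < k \<Longrightarrow> adapted_bounded (r i) (\<xi> i)"
    using assms by (auto simp: simple_integrand_def adapted_bounded_def)
qed

lemma simple_process_outside:
  fixes \<xi> :: "nat \<Rightarrow> 'w \<Rightarrow> 'a \<Rightarrow>\<^sub>L 'a"
  assumes "simple_integrand M F T k r \<xi>" "t \<notin> {0<..T}"
  shows "simple_process k r \<xi> t w = 0"
  unfolding simple_process_def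
proof (rule sum.neutral, rule ballI)
  fix i assume "i \<in> {..<k}"
  then have "t \<notin> {r i<..r (Suc i)}"
    using simple_integrandD(1)[OF assms(1), of i] simple_integrandD(2)[OF assms(1), of "Suc i"] assms(2) by auto
  then show "indicator {r i<..r (Suc i)} t *\<^sub>R \<xi> i w = 0" by simp
qed

text \<open>The integral of the integrand cut off after time \<open>s\<close>. Dropping the
  intervals that start at or after \<open>s\<close> keeps the end points of all remaining ones in
  order, as \<open>adapted_family\<close> requires.\<close>

definition truncated_integral :: "real \<Rightarrow> nat \<Rightarrow> (nat \<Rightarrow> real) \<Rightarrow> (nat \<Rightarrow> 'w \<Rightarrow> 'a \<Rightarrow>\<^sub>L 'a) \<Rightarrow> 'w \<Rightarrow> 'a" where
  "truncated_integral s k r \<xi> w = (\<Sum>i\<in>{i. i < k \<and> r i < s}. \<xi> i w (incr (r i) (min (r (Suc i)) s) w))"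

lemma truncated_integral_full:
  assumes "simple_integrand M F T k r \<xi>"
  shows "truncated_integral T k r \<xi> = simple_ito_integral B k r \<xi>"
proof
  fix w
  have "{i. i < k \<and> r i < T} = {..<k}"
  proof safe
    fix i assume "i < k"
    then show "r i < T"
      using assms simple_integrandD(2)[OF assms, of "Suc i"] by (force simp: simple_integrand_def)
  qed
  then show "truncated_integral T k r \<xi> w = simple_ito_integral B k r \<xi> w"
    unfolding truncated_integral_def simple_ito_integral_def
    using simple_integrandD(2)[OF assms] by (intro sum.cong) (auto simp: min_absorb1)
qed

text \<open>The difference of the two integrals is one sum over the disjoint union of both index
  sets, with the sign of the second integrand reversed, so a single use of the isometry
  suffices.\<close>

lemma truncated_diff_isometry:
  fixes v :: real
  assumes T: "simple_integrand M F t k r \<xi>" and S: "simple_integrand M F s k' r' \<xi>'"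
  defines "D \<equiv> \<lambda>w. truncated_integral v k r \<xi> w - simple_ito_integral B k' r' \<xi>' w"
    and "P \<equiv> \<lambda>q w. indicator {..v} q *\<^sub>R simple_process k r \<xi> q w - simple_process k' r' \<xi>' q w"
  shows "integrable M (\<lambda>w. (norm (D w))\<^sup>2)"
    and "(\<integral>\<^sup>+w. ennreal ((norm (D w))\<^sup>2) \<partial>M) = (\<integral>\<^sup>+w. (\<integral>\<^sup>+q. ennreal (hs_inner (P q w) (P q w)) \<partial>lborel) \<partial>M)"
proof -
  let ?A = "{i. i < k \<and> r i < v} <+> {..<k'}"
  let ?l = "case_sum r r'" and ?u = "case_sum (\<lambda>i. min (r (Suc i)) v) (\<lambda>i. r' (Suc i))"
  let ?x = "case_sum \<xi> (\<lambda>i w. - \<xi>' i w)"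
  note TD = simple_integrandD[OF T] and SD = simple_integrandD[OF S]
  have neg: "adapted_bounded l (\<lambda>w. - \<eta> w)" if "adapted_bounded l \<eta>" for l \<eta>
  proof -
    have "(uminus :: ('a \<Rightarrow>\<^sub>L 'a) \<Rightarrow> _) \<in> borel_measurable borel"
      by (intro borel_measurable_continuous_onI continuous_intros)
    then have "(\<lambda>w. - \<eta> w) \<in> borel_measurable (F l)"
      using that measurable_compose[of \<eta> "F l" borel uminus borel] by (auto simp: adapted_bounded_def)
    moreover have "bounded ((\<lambda>w. - \<eta> w) ` space M)"
      using that by (auto simp: adapted_bounded_def bounded_iff)
    ultimately show ?thesis by (simp add: adapted_bounded_def)
  qed
  have fam: "adapted_family ?A ?l ?u ?x"
    unfolding adapted_family_def
  proof (intro conjI ballI)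
    fix a assume "a \<in> ?A"
    then show "0 \<le> ?l a" "?l a \<le> ?u a" "adapted_bounded (?l a) (?x a)"
      using TD(1,3,4) SD(1,3) neg[OF SD(4)] by (auto simp: less_imp_le)
  qed simp
  have D: "D w = (\<Sum>a\<in>?A. ?x a w (incr (?l a) (?u a) w))" for w
    unfolding D_def truncated_integral_def simple_ito_integral_def
    by (subst sum.Plus) (auto simp: blinfun.minus_left sum_negf)
  have P: "P q w = (\<Sum>a\<in>?A. indicator {?l a<..?u a} q *\<^sub>R ?x a w)" for q w
  proof -
    have "indicator {..v} q *\<^sub>R simple_process k r \<xi> q w = (\<Sum>i<k. indicator ({r i<..r (Suc i)} \<inter> {..v}) q *\<^sub>R \<xi> i w)"
      unfolding simple_process_def scaleR_sum_right by (intro sum.cong) (auto simp: indicator_def)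
    also have "\<dots> = (\<Sum>i\<in>{i. i < k \<and> r i < v}. indicator {r i<..min (r (Suc i)) v} q *\<^sub>R \<xi> i w)"
      by (intro sum.mono_neutral_cong_right) (auto simp: indicator_def)
    finally show ?thesis
      unfolding P_def by (subst sum.Plus) (auto simp: simple_process_def sum_negf)
  qed
  show "integrable M (\<lambda>w. (norm (D w))\<^sup>2)"
    "(\<integral>\<^sup>+w. ennreal ((norm (D w))\<^sup>2) \<partial>M) = (\<integral>\<^sup>+w. (\<integral>\<^sup>+q. ennreal (hs_inner (P q w) (P q w)) \<partial>lborel) \<partial>M)"
    unfolding D P using ito_isometry[OF fam] by auto
qed

lemma truncated_integral_measurable:
  assumes T: "simple_integrand M F t k r \<xi>"
  shows "truncated_integral v k r \<xi> \<in> borel_measurable M"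
  unfolding truncated_integral_def[abs_def]
proof (rule borel_measurable_sum)
  fix i assume i: "i \<in> {i. i < k \<and> r i < v}"
  then have "0 \<le> r i" "r i \<le> min (r (Suc i)) v" "adapted_bounded (r i) (\<xi> i)"
    using simple_integrandD[OF T, of i] by auto
  from measurable_F_M[OF incr_apply_measurable[OF this]]
  show "(\<lambda>w. \<xi> i w (incr (r i) (min (r (Suc i)) v) w)) \<in> borel_measurable M" .
qed

text \<open>What remains after truncation at \<open>s\<close> is a sum of increments over the parts
  of the intervals to the right of \<open>s\<close>. Each has a coefficient known at its left end,
  which is at least \<open>s\<close>, so everything known at time \<open>s\<close> is orthogonal to
  it.\<close>

lemma orthogonal_after_truncation:
  assumes T: "simple_integrand M F t k r \<xi>" and s: "0 \<le> s" "s \<le> t"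
    and Y: "Y \<in> borel_measurable (F s)" "integrable M (\<lambda>w. norm (Y w))"
  shows "has_bochner_integral M (\<lambda>w. Y w \<bullet> (simple_ito_integral B k r \<xi> w - truncated_integral s k r \<xi> w)) 0"
proof -
  note TD = simple_integrandD[OF T]
  let ?l = "\<lambda>i. max (r i) s" and ?u = "\<lambda>i. max (r (Suc i)) s"
  have trunc: "truncated_integral s k r \<xi> w = (\<Sum>i<k. \<xi> i w (incr (min (r i) s) (min (r (Suc i)) s) w))" for w
    unfolding truncated_integral_def
  proof (intro sum.mono_neutral_cong_left ballI)
    fix i assume "i \<in> {..<k} - {i. i < k \<and> r i < s}"
    then have "s \<le> r i" "s \<le> r (Suc i)" using TD(3)[of i] by auto
    then show "\<xi> i w (incr (min (r i) s) (min (r (Suc i)) s) w) = 0"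
      by (simp add: min_absorb2 blinfun.zero_right)
  qed (auto simp: min_absorb1)
  have eq: "simple_ito_integral B k r \<xi> w - truncated_integral s k r \<xi> w = (\<Sum>i<k. \<xi> i w (incr (?l i) (?u i) w))" for w
  proof -
    have alg: "(a + b - e) - (c + d - e) - (b - d) = a - c" for a b c d e :: 'a by simp
    \<comment> \<open>As \<open>max a s\<close> and \<open>min a s\<close> are \<open>a\<close> and
      \<open>s\<close> in some order, this separates an increment into its parts before and after
      \<open>s\<close> without a case distinction on the position of \<open>s\<close>.\<close>
    have split: "B a w = B (max a s) w + B (min a s) w - B s w" for a by (simp add: max_def min_def)
    have step: "\<xi> i w (incr (r i) (r (Suc i)) w) - \<xi> i w (incr (min (r i) s) (min (r (Suc i)) s) w)
      = \<xi> i w (incr (?l i) (?u i) w)" for i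
    proof -
      have "incr (r i) (r (Suc i)) w - incr (min (r i) s) (min (r (Suc i)) s) w = incr (?l i) (?u i) w"
        by (subst split[of "r i"], subst split[of "r (Suc i)"]) (rule alg)
      then show ?thesis by (metis blinfun.diff_right)
    qed
    show ?thesis
      unfolding simple_ito_integral_def trunc sum_subtractf[symmetric] step ..
  qed
  have "has_bochner_integral M (\<lambda>w. \<Sum>i<k. Y w \<bullet> \<xi> i w (incr (?l i) (?u i) w)) (\<Sum>i<k. 0)"
  proof (intro has_bochner_integral_sum incr_orthogonal)
    fix i assume i: "i \<in> {..<k}"
    show "0 \<le> ?l i" "?l i \<le> ?u i" using s TD(3)[of i] i by auto
    show "adapted_bounded (?l i) (\<xi> i)" using TD(4)[of i] i by (auto intro: adapted_bounded_mono[of "r i"])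
    show "Y \<in> borel_measurable (F (?l i))" by (rule measurable_F_mono[OF Y(1)]) simp
  qed (rule Y)
  then show ?thesis unfolding eq by (simp add: inner_sum_right)
qed

end

section \<open>From simple to general integrands\<close>

lemma norm_add3_square: "(norm (x + y + z))\<^sup>2 \<le> 4 * ((norm x)\<^sup>2 + (norm y)\<^sup>2 + (norm (z :: 'a::real_inner))\<^sup>2)"
proof -
  have p: "(norm (u + v))\<^sup>2 \<le> 2 * ((norm u)\<^sup>2 + (norm v)\<^sup>2)" for u v :: 'a
    using zero_le_power2[of "norm (u - v)"] unfolding power2_norm_eq_inner
    by (simp add: inner_diff_left inner_diff_right inner_add_left inner_add_right inner_commute)
  have "2 * ((norm (x + y))\<^sup>2 + (norm z)\<^sup>2) \<le> 2 * (2 * ((norm x)\<^sup>2 + (norm y)\<^sup>2) + 2 * (norm z)\<^sup>2)"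
    by (intro mult_left_mono add_mono p) simp_all
  then show ?thesis using p[of "x + y" z] by (simp add: distrib_left)
qed

lemma borel_measurable_norm_diff_square:
  fixes f g :: "'w \<Rightarrow> 'a::euclidean_space"
  assumes [measurable]: "f \<in> borel_measurable N" "g \<in> borel_measurable N"
  shows "(\<lambda>w. ennreal ((norm (f w - g w))\<^sup>2)) \<in> borel_measurable N"
  by measurable

text \<open>Pairing with a bounded variable is continuous in L^2. Integrability can only be claimed
  eventually, since the first terms may have an infinite second moment.\<close>

lemma (in prob_space) inner_expectation_null:
  fixes X :: "nat \<Rightarrow> 'a \<Rightarrow> 'b::euclidean_space"
  assumes X: "\<And>m. X m \<in> borel_measurable M"
    and lim: "(\<lambda>m. \<integral>\<^sup>+w. ennreal ((norm (X m w))\<^sup>2) \<partial>M) \<longlonglongrightarrow> 0"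
    and Y: "Y \<in> borel_measurable M" "\<forall>w\<in>space M. norm (Y w) \<le> y"
  shows "eventually (\<lambda>m. integrable M (\<lambda>w. Y w \<bullet> X m w)) sequentially"
    and "(\<lambda>m. expectation (\<lambda>w. Y w \<bullet> X m w)) \<longlonglongrightarrow> 0"
proof -
  define a where "a m = (\<integral>\<^sup>+w. ennreal ((norm (X m w))\<^sup>2) \<partial>M)" for m
  have a0: "a \<longlonglongrightarrow> 0" using lim unfolding a_def .
  have fin: "eventually (\<lambda>m. a m < \<infinity>) sequentially"
    using order_tendstoD(2)[OF a0, of \<infinity>] by simp
  have y0: "0 \<le> y" using Y(2) not_empty by (metis ex_in_conv norm_ge_zero order_trans)
  have main: "integrable M (\<lambda>w. Y w \<bullet> X m w) \<and> \<bar>expectation (\<lambda>w. Y w \<bullet> X m w)\<bar> \<le> y * sqrt (enn2real (a m))"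
    if "a m < \<infinity>" for m
  proof -
    have Xm[measurable]: "(\<lambda>w. norm (X m w)) \<in> borel_measurable M"
      by (rule measurable_compose[OF X borel_measurable_norm])
    have i2: "integrable M (\<lambda>w. (norm (X m w))\<^sup>2)"
      using that by (intro integrableI_nonneg) (auto simp: a_def)
    have i1: "integrable M (\<lambda>w. norm (X m w))"
      by (rule square_integrable_imp_integrable[OF Xm i2])
    have e2: "expectation (\<lambda>w. (norm (X m w))\<^sup>2) = enn2real (a m)"
      unfolding a_def by (rule integral_eq_nn_integral) auto
    \<comment> \<open>Non-negativity of the variance is the comparison of the L^1 with the L^2 norm
      on a probability space.\<close>
    have "0 \<le> variance (\<lambda>w. norm (X m w))" by (rule variance_positive)
    also have "\<dots> = enn2real (a m) - (expectation (\<lambda>w. norm (X m w)))\<^sup>2"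
      unfolding e2[symmetric] by (rule variance_eq[OF i1 i2])
    finally have e1: "expectation (\<lambda>w. norm (X m w)) \<le> sqrt (enn2real (a m))"
      by (intro real_le_rsqrt) simp
    have bnd: "\<bar>Y w \<bullet> X m w\<bar> \<le> y * norm (X m w)" if "w \<in> space M" for w
      using Cauchy_Schwarz_ineq2[of "Y w" "X m w"] mult_right_mono[OF bspec[OF Y(2) that], of "norm (X m w)"] by simp
    have i: "integrable M (\<lambda>w. Y w \<bullet> X m w)"
    proof (rule Bochner_Integration.integrable_bound)
      show "integrable M (\<lambda>w. y * norm (X m w))" using i1 by simp
      show "(\<lambda>w. Y w \<bullet> X m w) \<in> borel_measurable M" by (intro borel_measurable_inner Y X)
      show "AE w in M. norm (Y w \<bullet> X m w) \<le> norm (y * norm (X m w))"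
        using bnd y0 by (intro AE_I2) (simp add: abs_mult)
    qed
    have "\<bar>expectation (\<lambda>w. Y w \<bullet> X m w)\<bar> \<le> expectation (\<lambda>w. \<bar>Y w \<bullet> X m w\<bar>)" by (rule integral_abs_bound)
    also have "\<dots> \<le> expectation (\<lambda>w. y * norm (X m w))"
      using i i1 bnd by (intro integral_mono) auto
    also have "\<dots> \<le> y * sqrt (enn2real (a m))" using e1 y0 by (simp add: mult_left_mono)
    finally show ?thesis using i by simp
  qed
  show "eventually (\<lambda>m. integrable M (\<lambda>w. Y w \<bullet> X m w)) sequentially"
    using fin by eventually_elim (use main in simp)
  have "(\<lambda>m. enn2real (a m)) \<longlonglongrightarrow> 0"
    using a0 by (intro tendsto_enn2real[of _ 0, OF _ order_refl]) (simp only: ennreal_0)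
  then have "(\<lambda>m. y * sqrt (enn2real (a m))) \<longlonglongrightarrow> y * sqrt 0"
    by (intro tendsto_mult tendsto_const tendsto_real_sqrt)
  then have "(\<lambda>m. y * sqrt (enn2real (a m))) \<longlonglongrightarrow> 0" by simp
  then show "(\<lambda>m. expectation (\<lambda>w. Y w \<bullet> X m w)) \<longlonglongrightarrow> 0"
    by (rule Lim_null_comparison[rotated]) (use fin in \<open>eventually_elim, use main in simp\<close>)
qed

context brownian_setting
begin

text \<open>The squared L^2 norm over time and outcome. Time runs over the whole line, so the
  processes it is applied to carry their own cutoffs.\<close>

definition hs_energy :: "(real \<Rightarrow> 'w \<Rightarrow> 'a \<Rightarrow>\<^sub>L 'a) \<Rightarrow> ennreal" where
  "hs_energy f = (\<integral>\<^sup>+w. (\<integral>\<^sup>+q. ennreal (hs_inner (f q w) (f q w)) \<partial>lborel) \<partial>M)"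

text \<open>Measurability is asked of the evaluations at fixed vectors, which is what the
  Hilbert-Schmidt square needs. The outcome comes first, so that Fubini leaves time as the inner
  variable, as in \<open>hs_energy\<close>.\<close>

definition jointly_measurable :: "(real \<Rightarrow> 'w \<Rightarrow> 'a \<Rightarrow>\<^sub>L 'a) \<Rightarrow> bool" where
  "jointly_measurable f \<longleftrightarrow> (\<forall>c. (\<lambda>p. blinfun_apply (f (snd p) (fst p)) c) \<in> borel_measurable (M \<Otimes>\<^sub>M lborel))"

lemma jointly_measurable_hs:
  assumes "jointly_measurable f"
  shows "(\<lambda>(w, q). ennreal (hs_inner (f q w) (f q w))) \<in> borel_measurable (M \<Otimes>\<^sub>M lborel)"
proof -
  have "(\<lambda>p. hs_inner (f (snd p) (fst p)) (f (snd p) (fst p))) \<in> borel_measurable (M \<Otimes>\<^sub>M lborel)"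
    using assms by (intro hs_inner_measurable_coords) (simp add: jointly_measurable_def case_prod_beta)
  then show ?thesis by (simp add: case_prod_beta)
qed

lemma hs_energy_pair:
  "jointly_measurable f \<Longrightarrow> hs_energy f = (\<integral>\<^sup>+p. ennreal (hs_inner (f (snd p) (fst p)) (f (snd p) (fst p))) \<partial>(M \<Otimes>\<^sub>M lborel))"
  unfolding hs_energy_def
  by (subst lborel.nn_integral_fst[symmetric]) (use jointly_measurable_hs[of f] in \<open>auto simp: case_prod_beta\<close>)

lemma hs_energy_add3:
  assumes f: "jointly_measurable f" "jointly_measurable g" "jointly_measurable h" "jointly_measurable e"
    and eq: "\<And>q w. w \<in> space M \<Longrightarrow> e q w = f q w + g q w + h q w"
  shows "hs_energy e \<le> 4 * (hs_energy f + hs_energy g + hs_energy h)"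
proof -
  let ?n = "\<lambda>f p. ennreal (hs_inner (f (snd p) (fst p)) (f (snd p) (fst p)))"
  have m: "?n f \<in> borel_measurable (M \<Otimes>\<^sub>M lborel)" "?n g \<in> borel_measurable (M \<Otimes>\<^sub>M lborel)"
    "?n h \<in> borel_measurable (M \<Otimes>\<^sub>M lborel)"
    using f(1-3)[THEN jointly_measurable_hs] by (auto simp: case_prod_beta)
  have le: "?n e p \<le> 4 * (?n f p + ?n g p + ?n h p)" if "p \<in> space (M \<Otimes>\<^sub>M lborel)" for p
  proof -
    have "fst p \<in> space M" using that by (auto simp: space_pair_measure)
    then have "?n e p \<le> ennreal (4 * (hs_inner (f (snd p) (fst p)) (f (snd p) (fst p)) + hs_inner (g (snd p) (fst p)) (g (snd p) (fst p))
        + hs_inner (h (snd p) (fst p)) (h (snd p) (fst p))))"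
      by (subst (1 2) eq) (auto intro!: ennreal_leI hs_inner_add3_self[THEN order_trans])
    also have "\<dots> = 4 * (?n f p + ?n g p + ?n h p)"
      by (simp add: ennreal_mult' ennreal_plus hs_inner_self_nonneg add_nonneg_nonneg)
    finally show ?thesis .
  qed
  have "hs_energy e \<le> (\<integral>\<^sup>+p. 4 * (?n f p + ?n g p + ?n h p) \<partial>(M \<Otimes>\<^sub>M lborel))"
    unfolding hs_energy_pair[OF f(4)] by (rule nn_integral_mono[OF le])
  also have "\<dots> = 4 * (hs_energy f + hs_energy g + hs_energy h)"
    using m by (simp add: hs_energy_pair f nn_integral_cmult nn_integral_add)
  finally show ?thesis .
qed

lemma hs_energy_le:
  assumes f: "jointly_measurable f"
  shows "hs_energy f \<le> DIM('a) * (\<integral>\<^sup>+w. (\<integral>\<^sup>+q. ennreal ((norm (f q w))\<^sup>2) \<partial>lborel) \<partial>M)"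
proof -
  let ?d = "real DIM('a)"
  let ?n = "\<lambda>p. ennreal (hs_inner (f (snd p) (fst p)) (f (snd p) (fst p)))"
  have m: "?n \<in> borel_measurable (M \<Otimes>\<^sub>M lborel)"
    using jointly_measurable_hs[OF f] by (simp add: case_prod_beta)
  \<comment> \<open>The Hilbert-Schmidt square is the quantity known to be measurable, so the
    dimension is pulled out on this side; the passage to the operator norm is then mere
    monotonicity.\<close>
  have "hs_energy f = (\<integral>\<^sup>+p. ennreal ?d * (ennreal (1 / ?d) * ?n p) \<partial>(M \<Otimes>\<^sub>M lborel))"
    unfolding hs_energy_pair[OF f] mult.assoc[symmetric]
    by (subst ennreal_mult'[symmetric]) auto
  also have "\<dots> = ennreal ?d * (\<integral>\<^sup>+p. ennreal (1 / ?d) * ?n p \<partial>(M \<Otimes>\<^sub>M lborel))"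
    using m by (intro nn_integral_cmult) simp
  also have "(\<integral>\<^sup>+p. ennreal (1 / ?d) * ?n p \<partial>(M \<Otimes>\<^sub>M lborel)) =
      (\<integral>\<^sup>+w. (\<integral>\<^sup>+q. ennreal (1 / ?d) * ennreal (hs_inner (f q w) (f q w)) \<partial>lborel) \<partial>M)"
    using m by (subst lborel.nn_integral_fst[symmetric]) auto
  also have "\<dots> \<le> (\<integral>\<^sup>+w. (\<integral>\<^sup>+q. ennreal ((norm (f q w))\<^sup>2) \<partial>lborel) \<partial>M)"
  proof (intro nn_integral_mono)
    fix w q
    have "1 / ?d * hs_inner (f q w) (f q w) \<le> (norm (f q w))\<^sup>2"
      using hs_inner_self_le[of "f q w"] by (simp add: field_simps)
    then show "ennreal (1 / ?d) * ennreal (hs_inner (f q w) (f q w)) \<le> ennreal ((norm (f q w))\<^sup>2)"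
      by (subst ennreal_mult[symmetric]) (auto simp: hs_inner_self_nonneg intro: ennreal_leI)
  qed
  finally show ?thesis by (simp add: mult_left_mono ennreal_of_nat_eq_real_of_nat)
qed

lemma jointly_measurable_indicator:
  assumes "jointly_measurable f" "A \<in> sets borel"
  shows "jointly_measurable (\<lambda>q w. indicator A q *\<^sub>R f q w)"
  unfolding jointly_measurable_def
proof
  fix c
  have "(\<lambda>p. indicator A (snd p) *\<^sub>R blinfun_apply (f (snd p) (fst p)) c) \<in> borel_measurable (M \<Otimes>\<^sub>M lborel)"
  proof (rule borel_measurable_scaleR)
    show "(\<lambda>p. indicator A (snd p)) \<in> borel_measurable (M \<Otimes>\<^sub>M lborel)"
      using assms(2) by (intro measurable_compose[OF measurable_snd borel_measurable_indicator]) simp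
  qed (use assms(1) in \<open>simp add: jointly_measurable_def case_prod_beta\<close>)
  then show "(\<lambda>p. blinfun_apply (indicator A (snd p) *\<^sub>R f (snd p) (fst p)) c) \<in> borel_measurable (M \<Otimes>\<^sub>M lborel)"
    by (simp add: case_prod_beta blinfun.scaleR_left)
qed

lemma jointly_measurable_diff:
  "jointly_measurable f \<Longrightarrow> jointly_measurable g \<Longrightarrow> jointly_measurable (\<lambda>q w. f q w - g q w)"
  unfolding jointly_measurable_def by (auto simp: blinfun.diff_left intro!: borel_measurable_diff)

lemma jointly_measurable_simple_process:
  assumes "simple_integrand M F t k r \<xi>"
  shows "jointly_measurable (simple_process k r \<xi>)"
  unfolding jointly_measurable_def
proof
  fix c
  have "(\<lambda>p. \<Sum>i<k. indicator {r i<..r (Suc i)} (snd p) *\<^sub>R blinfun_apply (\<xi> i (fst p)) c) \<in> borel_measurable (M \<Otimes>\<^sub>M lborel)"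
  proof (intro borel_measurable_sum borel_measurable_scaleR)
    fix i assume "i \<in> {..<k}"
    then have "\<xi> i \<in> borel_measurable (F (r i))" using assms by (simp add: simple_integrand_def)
    then have "(\<lambda>w. \<xi> i w c) \<in> borel_measurable M"
      by (intro borel_measurable_blinfun_apply_const measurable_F_M)
    then show "(\<lambda>p. \<xi> i (fst p) c) \<in> borel_measurable (M \<Otimes>\<^sub>M lborel)"
      by (rule measurable_compose[OF measurable_fst])
    show "(\<lambda>p. indicator {r i<..r (Suc i)} (snd p)) \<in> borel_measurable (M \<Otimes>\<^sub>M lborel)"
      by (intro measurable_compose[OF measurable_snd borel_measurable_indicator]) simp
  qed
  then show "(\<lambda>p. blinfun_apply (simple_process k r \<xi> (snd p) (fst p)) c) \<in> borel_measurable (M \<Otimes>\<^sub>M lborel)"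
    by (simp add: case_prod_beta simple_process_def blinfun.sum_left blinfun.scaleR_left)
qed

lemma jointly_measurable_clamped:
  assumes "progressively_measurable F H" "0 \<le> t"
  shows "jointly_measurable (\<lambda>q. H (max 0 (min q t)))"
  unfolding jointly_measurable_def
proof
  fix c
  have Hm: "(\<lambda>(s, w). H s w) \<in> borel_measurable (restrict_space borel {0..t} \<Otimes>\<^sub>M F t)"
    using assms by (simp add: progressively_measurable_def)
  have "(\<lambda>(s, w). H s w c) \<in> borel_measurable (restrict_space borel {0..t} \<Otimes>\<^sub>M F t)"
    using borel_measurable_blinfun_apply_const[OF Hm, of c] by (simp add: case_prod_beta)
  moreover have "(\<lambda>p. (max 0 (min (snd p) t), fst p)) \<in> M \<Otimes>\<^sub>M lborel \<rightarrow>\<^sub>M restrict_space borel {0..t} \<Otimes>\<^sub>M F t"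
  proof (rule measurable_Pair)
    have "(\<lambda>q. max 0 (min q t)) \<in> lborel \<rightarrow>\<^sub>M restrict_space borel {0..t}"
      using assms by (intro measurable_restrict_space2) auto
    then show "(\<lambda>p. max 0 (min (snd p) t)) \<in> M \<Otimes>\<^sub>M lborel \<rightarrow>\<^sub>M restrict_space borel {0..t}"
      by (rule measurable_compose[OF measurable_snd])
    have "(\<lambda>w. w) \<in> M \<rightarrow>\<^sub>M F t"
      using sets_F[of t] by (auto simp: measurable_def intro: sets.Int_space_eq2)
    then show "(\<lambda>p. fst p) \<in> M \<Otimes>\<^sub>M lborel \<rightarrow>\<^sub>M F t"
      by (rule measurable_compose[OF measurable_fst])
  qed
  ultimately have "(\<lambda>p. (\<lambda>(s, w). H s w c) (max 0 (min (snd p) t), fst p)) \<in> borel_measurable (M \<Otimes>\<^sub>M lborel)"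
    by (rule measurable_compose[rotated])
  then show "(\<lambda>p. blinfun_apply (H (max 0 (min (snd p) t)) (fst p)) c) \<in> borel_measurable (M \<Otimes>\<^sub>M lborel)"
    by (simp add: case_prod_beta)
qed


text \<open>Clamping the time to \<open>[0, t]\<close> extends a progressively measurable process to a process that is
  jointly measurable on the whole line.\<close>

definition approx_error :: "real \<Rightarrow> (real \<Rightarrow> 'w \<Rightarrow> 'a \<Rightarrow>\<^sub>L 'a) \<Rightarrow> nat \<Rightarrow> (nat \<Rightarrow> real) \<Rightarrow>
    (nat \<Rightarrow> 'w \<Rightarrow> 'a \<Rightarrow>\<^sub>L 'a) \<Rightarrow> real \<Rightarrow> 'w \<Rightarrow> 'a \<Rightarrow>\<^sub>L 'a" where
  "approx_error t H k r \<xi> q w =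
    indicator {0..t} q *\<^sub>R (simple_process k r \<xi> q w - H (max 0 (min q t)) w)"

definition ito_approximation where
  "ito_approximation t H I k r \<xi> \<longleftrightarrow>
    (\<forall>m::nat. simple_integrand M F t (k m) (r m) (\<xi> m)) \<and>
    (\<forall>m. jointly_measurable (approx_error t H (k m) (r m) (\<xi> m))) \<and>
    (\<lambda>m. hs_energy (approx_error t H (k m) (r m) (\<xi> m))) \<longlonglongrightarrow> 0 \<and>
    (\<lambda>m. \<integral>\<^sup>+w. ennreal ((norm (simple_ito_integral B (k m) (r m) (\<xi> m) w - I w))\<^sup>2) \<partial>M) \<longlonglongrightarrow> 0"

text \<open>Trades operator-norm convergence of the integrands for convergence of their
  Hilbert-Schmidt energy, the form to which the isometry applies.\<close>

lemma has_ito_integral_approx: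
  assumes "has_ito_integral M F B t H I" "0 \<le> t"
  shows "\<exists>k r \<xi>. ito_approximation t H I k r \<xi>"
proof -
  obtain k r \<xi> where s: "\<And>m::nat. simple_integrand M F t (k m) (r m) (\<xi> m)"
    and H: "(\<lambda>m. \<integral>\<^sup>+w. (\<integral>\<^sup>+s\<in>{0..t}. ennreal ((norm (simple_process (k m) (r m) (\<xi> m) s w - H s w))\<^sup>2) \<partial>lborel) \<partial>M) \<longlonglongrightarrow> 0"
    and I: "(\<lambda>m. \<integral>\<^sup>+w. ennreal ((norm (simple_ito_integral B (k m) (r m) (\<xi> m) w - I w))\<^sup>2) \<partial>M) \<longlonglongrightarrow> 0"
    using assms(1) unfolding has_ito_integral_def by blast
  have pm: "progressively_measurable F H" using assms(1) by (simp add: has_ito_integral_def)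
  let ?f = "\<lambda>m. approx_error t H (k m) (r m) (\<xi> m)"
  have j: "jointly_measurable (?f m)" for m
    unfolding approx_error_def[abs_def]
    by (intro jointly_measurable_indicator jointly_measurable_diff jointly_measurable_simple_process[OF s]
      jointly_measurable_clamped[OF pm assms(2)]) simp
  have le: "hs_energy (?f m) \<le> of_nat DIM('a) * (\<integral>\<^sup>+w. (\<integral>\<^sup>+s\<in>{0..t}. ennreal ((norm (simple_process (k m) (r m) (\<xi> m) s w - H s w))\<^sup>2) \<partial>lborel) \<partial>M)" for m
  proof -
    have "(\<integral>\<^sup>+q. ennreal ((norm (?f m q w))\<^sup>2) \<partial>lborel) =
      (\<integral>\<^sup>+s\<in>{0..t}. ennreal ((norm (simple_process (k m) (r m) (\<xi> m) s w - H s w))\<^sup>2) \<partial>lborel)" for w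
      by (intro nn_integral_cong) (auto simp: indicator_def approx_error_def)
    then show ?thesis using hs_energy_le[OF j[of m]] by simp
  qed
  have lim: "(\<lambda>m. of_nat DIM('a) * (\<integral>\<^sup>+w. (\<integral>\<^sup>+s\<in>{0..t}. ennreal ((norm (simple_process (k m) (r m) (\<xi> m) s w - H s w))\<^sup>2) \<partial>lborel) \<partial>M)) \<longlonglongrightarrow> of_nat DIM('a) * 0"
    by (rule ennreal_tendsto_cmult[OF _ H]) (simp add: of_nat_less_top)
  have "(\<lambda>m. hs_energy (?f m)) \<longlonglongrightarrow> 0"
    by (rule tendsto_sandwich[OF _ _ tendsto_const lim[unfolded mult_zero_right]])
      (rule always_eventually, rule allI, rule zero_le le)+
  then show ?thesis unfolding ito_approximation_def using s j I by blast
qed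

text \<open>The integrals \<open>I\<close> and \<open>J\<close> come with unrelated approximating
  sequences, and the isometry for differences across partitions compares them. In the square bound
  two three-term inequalities, each with constant 4, produce the 16; what matters later is that the
  bound is linear in \<open>t - s\<close>. The second claim is the martingale property, obtained
  from that of simple integrals.\<close>

lemma
  fixes s t b :: real
  assumes I: "has_ito_integral M F B s H I" and J: "has_ito_integral M F B t H J"
    and st: "0 \<le> s" "s \<le> t" and H: "\<And>q w. norm (H q w) \<le> b"
  shows ito_increment_square: "(\<integral>\<^sup>+w. ennreal ((norm (J w - I w))\<^sup>2) \<partial>M) \<le> ennreal (16 * DIM('a) * b\<^sup>2 * (t - s))"
    and ito_increment_orthogonal: "\<And>Y y. Y \<in> borel_measurable (F s) \<Longrightarrow> (\<And>w. w \<in> space M \<Longrightarrow> norm (Y w) \<le> y) \<Longrightarrow>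
      has_bochner_integral M (\<lambda>w. Y w \<bullet> (J w - I w)) 0"
proof -
  have t: "0 \<le> t" using st by simp
  have b: "0 \<le> b" using H order_trans[OF norm_ge_zero] by blast
  have mI: "I \<in> borel_measurable M" and mJ: "J \<in> borel_measurable M"
    using I J by (simp_all add: has_ito_integral_def)
  obtain k r \<xi> where ap: "ito_approximation t H J k r \<xi>"
    using has_ito_integral_approx[OF J t] by blast
  obtain k' r' \<xi>' where ap': "ito_approximation s H I k' r' \<xi>'"
    using has_ito_integral_approx[OF I st(1)] by blast
  note T = ap[unfolded ito_approximation_def, THEN conjunct1, rule_format]
    and jT = ap[unfolded ito_approximation_def, THEN conjunct2, THEN conjunct1, rule_format]
    and eT = ap[unfolded ito_approximation_def, THEN conjunct2, THEN conjunct2, THEN conjunct1]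
    and lT = ap[unfolded ito_approximation_def, THEN conjunct2, THEN conjunct2, THEN conjunct2]
  note S = ap'[unfolded ito_approximation_def, THEN conjunct1, rule_format]
    and jS = ap'[unfolded ito_approximation_def, THEN conjunct2, THEN conjunct1, rule_format]
    and eS = ap'[unfolded ito_approximation_def, THEN conjunct2, THEN conjunct2, THEN conjunct1]
    and lS = ap'[unfolded ito_approximation_def, THEN conjunct2, THEN conjunct2, THEN conjunct2]
  let ?T = "\<lambda>m. simple_process (k m) (r m) (\<xi> m)" and ?S = "\<lambda>m. simple_process (k' m) (r' m) (\<xi>' m)"
  let ?IT = "\<lambda>m. simple_ito_integral B (k m) (r m) (\<xi> m)" and ?IS = "\<lambda>m. simple_ito_integral B (k' m) (r' m) (\<xi>' m)"
  let ?Tr = "\<lambda>m. truncated_integral s (k m) (r m) (\<xi> m)"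
  let ?fT = "\<lambda>m. approx_error t H (k m) (r m) (\<xi> m)" and ?fS = "\<lambda>m. approx_error s H (k' m) (r' m) (\<xi>' m)"
  \<comment> \<open>The part of the integrand between \<open>s\<close> and \<open>t\<close>. Its
    energy is all that survives in the limit of the square bound.\<close>
  let ?h = "\<lambda>q w. indicator {s<..t} q *\<^sub>R H (max 0 (min q t)) w"
  let ?z = "\<lambda>(q::real) (w::'w). 0 :: 'a \<Rightarrow>\<^sub>L 'a"
  have jz: "jointly_measurable ?z" by (simp add: jointly_measurable_def)
  have ez: "hs_energy ?z = 0" by (simp add: hs_energy_def hs_inner_def)
  have jh: "jointly_measurable ?h"
    using J t by (intro jointly_measurable_indicator jointly_measurable_clamped) (auto simp: has_ito_integral_def)
  have jS': "jointly_measurable (\<lambda>q w. - ?fS m q w)" for m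
    using jointly_measurable_diff[OF jz jS[of m]] by simp
  have eS': "hs_energy (\<lambda>q w. - ?fS m q w) = hs_energy (?fS m)" for m
    unfolding hs_energy_def hs_inner_minus ..
  have outT: "?T m q w = 0" if "q \<notin> {0<..t}" for m q w by (rule simple_process_outside[OF T that])
  have outS: "?S m q w = 0" if "q \<notin> {0<..s}" for m q w by (rule simple_process_outside[OF S that])
  have IT: "?IT m \<in> borel_measurable M" for m
    using truncated_integral_measurable[OF T, of t m] truncated_integral_full[OF T] by simp
  have IS: "?IS m \<in> borel_measurable M" for m
    using truncated_integral_measurable[OF S, of s m] truncated_integral_full[OF S] by simp
  have Tr: "?Tr m \<in> borel_measurable M" for m
    using truncated_integral_measurable[OF T] .
  have lT': "(\<lambda>m. \<integral>\<^sup>+w. ennreal ((norm (J w - ?IT m w))\<^sup>2) \<partial>M) \<longlonglongrightarrow> 0"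
    using lT by (simp add: norm_minus_commute)
  have eh: "hs_energy ?h \<le> ennreal (DIM('a) * b\<^sup>2 * (t - s))"
  proof -
    have "(\<integral>\<^sup>+q. ennreal ((norm (?h q w))\<^sup>2) \<partial>lborel) \<le> ennreal (b\<^sup>2 * (t - s))" for w
    proof -
      have "(\<integral>\<^sup>+q. ennreal ((norm (?h q w))\<^sup>2) \<partial>lborel) \<le> (\<integral>\<^sup>+q. ennreal (b\<^sup>2) * indicator {s<..t} q \<partial>lborel)"
        using H by (intro nn_integral_mono) (auto simp: indicator_def intro!: ennreal_leI power_mono)
      also have "\<dots> = ennreal (b\<^sup>2 * (t - s))"
        using st by (subst nn_integral_cmult_indicator) (auto simp: ennreal_mult)
      finally show ?thesis .
    qed
    then have "(\<integral>\<^sup>+w. (\<integral>\<^sup>+q. ennreal ((norm (?h q w))\<^sup>2) \<partial>lborel) \<partial>M) \<le> (\<integral>\<^sup>+w. ennreal (b\<^sup>2 * (t - s)) \<partial>M)"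
      by (intro nn_integral_mono)
    also have "\<dots> = ennreal (b\<^sup>2 * (t - s))" by (simp add: emeasure_space_1)
    finally have "of_nat DIM('a) * (\<integral>\<^sup>+w. (\<integral>\<^sup>+q. ennreal ((norm (?h q w))\<^sup>2) \<partial>lborel) \<partial>M) \<le> of_nat DIM('a) * ennreal (b\<^sup>2 * (t - s))"
      by (intro mult_left_mono) auto
    also have "\<dots> = ennreal (DIM('a) * b\<^sup>2 * (t - s))"
      using st by (simp add: ennreal_of_nat_eq_real_of_nat ennreal_mult[symmetric] mult.assoc)
    finally show ?thesis using hs_energy_le[OF jh] by simp
  qed
  show "(\<integral>\<^sup>+w. ennreal ((norm (J w - I w))\<^sup>2) \<partial>M) \<le> ennreal (16 * DIM('a) * b\<^sup>2 * (t - s))"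
  proof -
    let ?aJ = "\<lambda>m. \<integral>\<^sup>+w. ennreal ((norm (J w - ?IT m w))\<^sup>2) \<partial>M"
    let ?aI = "\<lambda>m. \<integral>\<^sup>+w. ennreal ((norm (?IS m w - I w))\<^sup>2) \<partial>M"
    let ?aD = "\<lambda>m. \<integral>\<^sup>+w. ennreal ((norm (?IT m w - ?IS m w))\<^sup>2) \<partial>M"
    have D: "?aD m \<le> 4 * (hs_energy (?fT m) + hs_energy (?fS m) + hs_energy ?h)" for m
    proof -
      let ?P = "\<lambda>q w. indicator {..t} q *\<^sub>R ?T m q w - ?S m q w"
      have "?aD m = hs_energy ?P"
        using truncated_diff_isometry(2)[OF T S, of t m m] truncated_integral_full[OF T] by (simp add: hs_energy_def)
      also have "\<dots> \<le> 4 * (hs_energy (?fT m) + hs_energy (\<lambda>q w. - ?fS m q w) + hs_energy ?h)"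
      proof (rule hs_energy_add3[OF jT jS' jh])
        show "jointly_measurable ?P"
          by (intro jointly_measurable_diff jointly_measurable_indicator jointly_measurable_simple_process[OF T]
            jointly_measurable_simple_process[OF S]) simp
        fix q w
        consider "q < 0" | "0 \<le> q" "q \<le> s" | "s < q" "q \<le> t" | "t < q" by linarith
        then show "?P q w = ?fT m q w + - ?fS m q w + ?h q w"
          using st by cases (auto simp: outT outS approx_error_def)
      qed
      finally show ?thesis by (simp add: eS')
    qed
    have main: "(\<integral>\<^sup>+w. ennreal ((norm (J w - I w))\<^sup>2) \<partial>M)
      \<le> 4 * (?aJ m + 4 * (hs_energy (?fT m) + hs_energy (?fS m) + hs_energy ?h) + ?aI m)" for m
    proof -
      have m1: "(\<lambda>w. ennreal ((norm (J w - ?IT m w))\<^sup>2)) \<in> borel_measurable M"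
        "(\<lambda>w. ennreal ((norm (?IT m w - ?IS m w))\<^sup>2)) \<in> borel_measurable M"
        "(\<lambda>w. ennreal ((norm (?IS m w - I w))\<^sup>2)) \<in> borel_measurable M"
        by (intro borel_measurable_norm_diff_square mJ IT IS mI)+
      have "(\<integral>\<^sup>+w. ennreal ((norm (J w - I w))\<^sup>2) \<partial>M) \<le>
        (\<integral>\<^sup>+w. 4 * (ennreal ((norm (J w - ?IT m w))\<^sup>2) + ennreal ((norm (?IT m w - ?IS m w))\<^sup>2) + ennreal ((norm (?IS m w - I w))\<^sup>2)) \<partial>M)"
      proof (rule nn_integral_mono)
        fix w
        have "ennreal ((norm (J w - I w))\<^sup>2) \<le> ennreal (4 * ((norm (J w - ?IT m w))\<^sup>2 + (norm (?IT m w - ?IS m w))\<^sup>2 + (norm (?IS m w - I w))\<^sup>2))"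
          using norm_add3_square[of "J w - ?IT m w" "?IT m w - ?IS m w" "?IS m w - I w"] by (intro ennreal_leI) simp
        also have "\<dots> = 4 * (ennreal ((norm (J w - ?IT m w))\<^sup>2) + ennreal ((norm (?IT m w - ?IS m w))\<^sup>2) + ennreal ((norm (?IS m w - I w))\<^sup>2))"
          by (simp add: ennreal_mult' ennreal_plus)
        finally show "ennreal ((norm (J w - I w))\<^sup>2) \<le> \<dots>" .
      qed
      also have "\<dots> = 4 * (?aJ m + ?aD m + ?aI m)"
        using m1 by (simp add: nn_integral_cmult nn_integral_add)
      also have "\<dots> \<le> 4 * (?aJ m + 4 * (hs_energy (?fT m) + hs_energy (?fS m) + hs_energy ?h) + ?aI m)"
        using D by (intro mult_left_mono add_mono) auto
      finally show ?thesis .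
    qed
    have "(\<lambda>m. 4 * (?aJ m + 4 * (hs_energy (?fT m) + hs_energy (?fS m) + hs_energy ?h) + ?aI m)) \<longlonglongrightarrow>
      4 * (0 + 4 * (0 + 0 + hs_energy ?h) + 0)"
      by (intro ennreal_tendsto_cmult tendsto_add lT' eT eS lS tendsto_const) auto
    from LIMSEQ_le_const[OF this] main
    have "(\<integral>\<^sup>+w. ennreal ((norm (J w - I w))\<^sup>2) \<partial>M) \<le> 4 * (4 * hs_energy ?h)" by simp
    also have "\<dots> \<le> 4 * (4 * ennreal (DIM('a) * b\<^sup>2 * (t - s)))"
      using eh by (intro mult_left_mono) auto
    also have "\<dots> = ennreal (16 * DIM('a) * b\<^sup>2 * (t - s))"
      using st by (simp add: ennreal_mult' mult.assoc[symmetric])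
    finally show ?thesis .
  qed
  fix Y :: "'w \<Rightarrow> 'a" and y assume Y: "Y \<in> borel_measurable (F s)" "\<And>w. w \<in> space M \<Longrightarrow> norm (Y w) \<le> y"
  have Ym: "Y \<in> borel_measurable M" by (rule measurable_F_M[OF Y(1)])
  have Yb: "\<forall>w\<in>space M. norm (Y w) \<le> y" using Y(2) by blast
  have Yi: "integrable M (\<lambda>w. norm (Y w))"
    using Y(2) Ym by (intro integrable_const_bound[of _ y]) auto
  \<comment> \<open>Truncating the approximations for \<open>t\<close> at \<open>s\<close> yields
    approximations of the same integrand on \<open>[0, s]\<close> as those for \<open>s\<close>, so
    both sequences of integrals merge in L^2.\<close>
  have lD: "(\<lambda>m. \<integral>\<^sup>+w. ennreal ((norm (?Tr m w - ?IS m w))\<^sup>2) \<partial>M) \<longlonglongrightarrow> 0"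
  proof (rule tendsto_sandwich[OF _ _ tendsto_const])
    show "(\<lambda>m. 4 * (hs_energy (?fT m) + hs_energy (?fS m) + 0)) \<longlonglongrightarrow> 0"
    proof -
      have "(\<lambda>m. 4 * (hs_energy (?fT m) + hs_energy (?fS m) + 0)) \<longlonglongrightarrow> 4 * (0 + 0 + 0)"
        by (intro ennreal_tendsto_cmult tendsto_add eT eS tendsto_const) auto
      then show ?thesis by simp
    qed
    show "\<forall>\<^sub>F m in sequentially. (\<integral>\<^sup>+w. ennreal ((norm (?Tr m w - ?IS m w))\<^sup>2) \<partial>M) \<le> 4 * (hs_energy (?fT m) + hs_energy (?fS m) + 0)"
    proof (rule always_eventually, rule allI)
      fix m
      let ?P = "\<lambda>q w. indicator {..s} q *\<^sub>R ?T m q w - ?S m q w"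
      let ?g = "\<lambda>q w. indicator {..s} q *\<^sub>R ?fT m q w"
      have "(\<integral>\<^sup>+w. ennreal ((norm (?Tr m w - ?IS m w))\<^sup>2) \<partial>M) = hs_energy ?P"
        using truncated_diff_isometry(2)[OF T S, of s m m] by (simp add: hs_energy_def)
      also have "\<dots> \<le> 4 * (hs_energy ?g + hs_energy (\<lambda>q w. - ?fS m q w) + hs_energy ?z)"
      proof (rule hs_energy_add3[OF _ jS' jz])
        show "jointly_measurable ?g" by (intro jointly_measurable_indicator jT) simp
        show "jointly_measurable ?P"
          by (intro jointly_measurable_diff jointly_measurable_indicator jointly_measurable_simple_process[OF T]
            jointly_measurable_simple_process[OF S]) simp
        fix q w
        consider "q < 0" | "0 \<le> q" "q \<le> s" | "s < q" by linarith
        then show "?P q w = ?g q w + - ?fS m q w + 0"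
          using st by cases (auto simp: outT outS approx_error_def)
      qed
      also have "\<dots> \<le> 4 * (hs_energy (?fT m) + hs_energy (?fS m) + 0)"
      proof (intro mult_left_mono add_mono)
        show "hs_energy ?g \<le> hs_energy (?fT m)"
          unfolding hs_energy_def
          by (intro nn_integral_mono) (auto simp: indicator_def hs_inner_self_nonneg hs_inner_def)
      qed (auto simp: eS' ez)
      finally show "(\<integral>\<^sup>+w. ennreal ((norm (?Tr m w - ?IS m w))\<^sup>2) \<partial>M) \<le> 4 * (hs_energy (?fT m) + hs_energy (?fS m) + 0)" .
    qed
  qed auto
  have mD: "(\<lambda>w. ?Tr m w - ?IS m w) \<in> borel_measurable M" for m by (rule borel_measurable_diff[OF Tr IS])
  have mTJ: "(\<lambda>w. J w - ?IT m w) \<in> borel_measurable M" for m by (rule borel_measurable_diff[OF mJ IT])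
  have mSI: "(\<lambda>w. ?IS m w - I w) \<in> borel_measurable M" for m by (rule borel_measurable_diff[OF IS mI])
  note nullD = inner_expectation_null[where X="\<lambda>m w. ?Tr m w - ?IS m w", OF mD lD Ym Yb]
  note nullJ = inner_expectation_null[where X="\<lambda>m w. J w - ?IT m w", OF mTJ lT' Ym Yb]
  note nullI = inner_expectation_null[where X="\<lambda>m w. ?IS m w - I w", OF mSI lS Ym Yb]
  let ?e = "\<lambda>m. expectation (\<lambda>w. Y w \<bullet> (J w - ?IT m w)) + expectation (\<lambda>w. Y w \<bullet> (?Tr m w - ?IS m w)) + expectation (\<lambda>w. Y w \<bullet> (?IS m w - I w))"
  have ev: "\<forall>\<^sub>F m in sequentially. has_bochner_integral M (\<lambda>w. Y w \<bullet> (J w - I w)) (?e m)"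
    using nullD(1) nullJ(1) nullI(1)
  proof eventually_elim
    case (elim m)
    \<comment> \<open>\<open>J - I\<close> is split into four differences. The second is exactly
      orthogonal to \<open>Y\<close>; the other three tend to 0 in L^2.\<close>
    have "has_bochner_integral M (\<lambda>w. Y w \<bullet> (J w - ?IT m w) + Y w \<bullet> (?IT m w - ?Tr m w)
        + Y w \<bullet> (?Tr m w - ?IS m w) + Y w \<bullet> (?IS m w - I w))
      (expectation (\<lambda>w. Y w \<bullet> (J w - ?IT m w)) + 0 + expectation (\<lambda>w. Y w \<bullet> (?Tr m w - ?IS m w)) + expectation (\<lambda>w. Y w \<bullet> (?IS m w - I w)))"
      by (intro has_bochner_integral_add has_bochner_integral_integrable elim orthogonal_after_truncation[OF T st Y(1) Yi])
    then show ?case by (simp add: inner_diff_right)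
  qed
  then obtain m where "has_bochner_integral M (\<lambda>w. Y w \<bullet> (J w - I w)) (?e m)"
    using eventually_happens' sequentially_bot by blast
  then have int: "integrable M (\<lambda>w. Y w \<bullet> (J w - I w))" by (simp add: has_bochner_integral_iff)
  have "?e \<longlonglongrightarrow> 0 + 0 + 0"
    by (intro tendsto_add nullD(2) nullJ(2) nullI(2))
  moreover have "\<forall>\<^sub>F m in sequentially. ?e m = expectation (\<lambda>w. Y w \<bullet> (J w - I w))"
    using ev by eventually_elim (simp add: has_bochner_integral_iff)
  then have "?e \<longlonglongrightarrow> expectation (\<lambda>w. Y w \<bullet> (J w - I w))"
    by (rule tendsto_eventually)
  ultimately have "expectation (\<lambda>w. Y w \<bullet> (J w - I w)) = 0"
    using LIMSEQ_unique by fastforce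
  then show "has_bochner_integral M (\<lambda>w. Y w \<bullet> (J w - I w)) 0"
    using int by (simp add: has_bochner_integral_iff)
qed

end

section \<open>A Lyapunov criterion for non-explosion\<close>

lemma floor_grid_tendsto:
  assumes "0 \<le> t"
  shows "(\<lambda>n. real (nat \<lfloor>real (Suc n) * t\<rfloor>) / real (Suc n)) \<longlonglongrightarrow> t"
    and "real (nat \<lfloor>real (Suc n) * t\<rfloor>) / real (Suc n) \<le> t"
proof -
  have eq: "real (nat \<lfloor>real (Suc n) * t\<rfloor>) = of_int \<lfloor>real (Suc n) * t\<rfloor>" for n
    using assms by simp
  have ub: "real (nat \<lfloor>real (Suc n) * t\<rfloor>) / real (Suc n) \<le> t" for n
    unfolding eq by (subst divide_le_eq) (use of_int_floor_le[of "real (Suc n) * t"] in \<open>auto simp: mult.commute\<close>)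
  have lb: "t - 1 / real (Suc n) \<le> real (nat \<lfloor>real (Suc n) * t\<rfloor>) / real (Suc n)" for n
  proof -
    have "t - 1 / real (Suc n) = (real (Suc n) * t - 1) / real (Suc n)" by (simp add: diff_divide_distrib)
    also have "\<dots> \<le> real (nat \<lfloor>real (Suc n) * t\<rfloor>) / real (Suc n)"
      unfolding eq by (rule divide_right_mono) linarith+
    finally show ?thesis .
  qed
  have "(\<lambda>n. t - 1 / real (Suc n)) \<longlonglongrightarrow> t - 0"
    by (intro tendsto_diff tendsto_const LIMSEQ_Suc[OF lim_1_over_n])
  then have "(\<lambda>n. t - 1 / real (Suc n)) \<longlonglongrightarrow> t" by simp
  then show "(\<lambda>n. real (nat \<lfloor>real (Suc n) * t\<rfloor>) / real (Suc n)) \<longlonglongrightarrow> t"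
    by (rule tendsto_sandwich[OF always_eventually always_eventually _ tendsto_const, rotated 2])
       (use lb ub in blast)+
  show "real (nat \<lfloor>real (Suc n) * t\<rfloor>) / real (Suc n) \<le> t" by (rule ub)
qed

text \<open>The random time is approximated from below by grid times with countably many values.
  Approximating from below keeps the grid times before \<open>\<zeta>\<close>, where the path is
  continuous.\<close>

lemma borel_measurable_process_at:
  fixes X :: "real \<Rightarrow> 'w \<Rightarrow> 'b::euclidean_space"
  assumes dom: "\<And>t. 0 \<le> t \<Longrightarrow> {w \<in> space M. ereal t < \<zeta> w} \<in> sets M"
    and X: "\<And>t. 0 \<le> t \<Longrightarrow> X t \<in> borel_measurable (restrict_space M {w \<in> space M. ereal t < \<zeta> w})"
    and cont: "\<And>w. w \<in> space M \<Longrightarrow> continuous_on {t. 0 \<le> t \<and> ereal t < \<zeta> w} (\<lambda>t. X t w)"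
    and \<theta>: "\<theta> \<in> borel_measurable M" "\<And>w. w \<in> space M \<Longrightarrow> 0 \<le> \<theta> w" "\<And>w. w \<in> space M \<Longrightarrow> ereal (\<theta> w) < \<zeta> w"
  shows "(\<lambda>w. X (\<theta> w) w) \<in> borel_measurable M"
proof -
  define g where "g n w = nat \<lfloor>real (Suc n) * \<theta> w\<rfloor>" for n w
  \<comment> \<open>The default 0 makes \<open>f n i\<close> measurable on the whole space; it is
    never attained at the grid times used below, which precede \<open>\<zeta>\<close>.\<close>
  define f where "f n i w = (if w \<in> {w \<in> space M. ereal (real i / real (Suc n)) < \<zeta> w} then X (real i / real (Suc n)) w else 0)" for n i w
  have f: "f n i \<in> borel_measurable M" for n i
    unfolding f_def[abs_def]
    by (subst measurable_restrict_space_iff[symmetric]) (use dom X in auto)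
  have g: "g n \<in> M \<rightarrow>\<^sub>M count_space UNIV" for n
    unfolding g_def[abs_def] using \<theta>(1) by measurable
  have fg: "(\<lambda>w. f n (g n w) w) \<in> borel_measurable M" for n
    by (rule measurable_compose_countable[OF f g])
  show ?thesis
  proof (rule borel_measurable_LIMSEQ_metric[OF fg])
    fix w assume sp: "w \<in> space M"
    let ?t = "\<lambda>n. real (g n w) / real (Suc n)"
    have le: "?t n \<le> \<theta> w" for n unfolding g_def by (rule floor_grid_tendsto(2)[OF \<theta>(2)[OF sp]])
    have dom: "0 \<le> ?t n \<and> ereal (?t n) < \<zeta> w" for n
      using le[of n] \<theta>(3)[OF sp] le_less_trans[of "ereal (?t n)" "ereal (\<theta> w)" "\<zeta> w"] by simp
    then have "f n (g n w) w = X (?t n) w" for n using sp by (simp add: f_def)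
    moreover have "(\<lambda>n. X (?t n) w) \<longlonglongrightarrow> X (\<theta> w) w"
    proof (rule continuous_on_tendsto_compose[OF cont[OF sp]])
      show "?t \<longlonglongrightarrow> \<theta> w" unfolding g_def by (rule floor_grid_tendsto(1)[OF \<theta>(2)[OF sp]])
    qed (use dom \<theta> sp in auto)
    ultimately show "(\<lambda>n. f n (g n w) w) \<longlonglongrightarrow> X (\<theta> w) w" by simp
  qed
qed

lemma discrete_gronwall:
  fixes v e :: "nat \<Rightarrow> real"
  assumes step: "\<And>k. k < n \<Longrightarrow> v (Suc k) \<le> (1 + b) * v k + d + e k"
    and b: "0 \<le> b" and d: "0 \<le> d" and e: "\<And>k. 0 \<le> e k" and k: "k \<le> n"
  shows "v k \<le> (1 + b) ^ k * (v 0 + real k * d + (\<Sum>j<k. e j))"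
  using k
proof (induction k)
  case (Suc k)
  let ?s = "v 0 + real k * d + (\<Sum>j<k. e j)"
  have "v (Suc k) \<le> (1 + b) * v k + d + e k" using Suc.prems by (intro step) simp
  also have "\<dots> \<le> (1 + b) * ((1 + b) ^ k * ?s) + d + e k"
    using Suc b by (intro add_right_mono mult_left_mono) auto
  also have "\<dots> \<le> (1 + b) ^ Suc k * ?s + (1 + b) ^ Suc k * (d + e k)"
  proof -
    have "1 * (d + e k) \<le> (1 + b) ^ Suc k * (d + e k)"
      using b d e[of k] by (intro mult_right_mono one_le_power) auto
    then show ?thesis by simp
  qed
  also have "\<dots> = (1 + b) ^ Suc k * (v 0 + real (Suc k) * d + (\<Sum>j<Suc k. e j))"
    by (simp add: algebra_simps)
  finally show ?case .
qed simp

text \<open>The dissipation inequality \<open>diss\<close> compares gradients at one and the same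
  point, whereas a time step meets \<open>U\<close>, \<open>c\<close>, \<open>a\<close> and
  \<open>G\<close> at different ones. Uniform continuity on a ball bounds the price by
  \<open>\<eta>\<close>, with a tolerance \<open>\<delta>\<close> that serves all paths staying in
  the ball.\<close>

lemma uniform_step_bound:
  fixes a c G U :: "'a::euclidean_space \<times> 'a \<Rightarrow> 'a" and \<Phi> :: "'a \<times> 'a \<Rightarrow> real"
  assumes cont: "continuous_on UNIV a" "continuous_on UNIV c" "continuous_on UNIV G" "continuous_on UNIV U"
    and diss: "\<And>p x. G (p, x) \<bullet> a (p, x) + U (p, x) \<bullet> c (p, x) \<le> c2 * (1 + \<Phi> (p, x))"
    and \<eta>: "0 < \<eta>"
  shows "\<exists>\<delta>>0. \<forall>P' P X q y. norm P' \<le> R \<longrightarrow> norm P \<le> R \<longrightarrow> norm X \<le> R \<longrightarrow> norm q \<le> R \<longrightarrow> norm y \<le> R \<longrightarrow>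
      dist P' P \<le> \<delta> \<longrightarrow> dist q P \<le> \<delta> \<longrightarrow> dist y X \<le> \<delta> \<longrightarrow>
      U (P', y) \<bullet> c (q, y) + G (P, X) \<bullet> a (q, y) \<le> c2 * (1 + \<Phi> (P, X)) + \<eta>"
proof -
  define \<Psi> where "\<Psi> z = (case z of (P', P, X, q, y) \<Rightarrow> U (P', y) \<bullet> c (q, y) + G (P, X) \<bullet> a (q, y))" for z :: "'a \<times> 'a \<times> 'a \<times> 'a \<times> 'a"
  define Q where "Q = cball (0::'a) R \<times> cball (0::'a) R \<times> cball (0::'a) R \<times> cball (0::'a) R \<times> cball (0::'a) R"
  have Q: "compact Q" unfolding Q_def by (intro compact_Times compact_cball)
  have cc: "continuous_on Q (\<lambda>z. f (g z))" if "continuous_on UNIV f" "continuous_on Q g"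
    for f :: "'a \<times> 'a \<Rightarrow> 'a" and g
    using continuous_on_compose2[OF that(1) that(2)] by simp
  have "continuous_on Q \<Psi>"
    unfolding \<Psi>_def case_prod_beta
    by (intro continuous_on_add continuous_on_inner cc cont continuous_intros)
  then have "uniformly_continuous_on Q \<Psi>" using Q by (rule compact_uniformly_continuous)
  then obtain \<delta> where \<delta>: "\<delta> > 0" "\<And>z z'. z \<in> Q \<Longrightarrow> z' \<in> Q \<Longrightarrow> dist z' z < \<delta> \<Longrightarrow> dist (\<Psi> z') (\<Psi> z) < \<eta>"
    unfolding uniformly_continuous_on_def using \<eta> by metis
  show ?thesis
  \<comment> \<open>The two points of \<open>Q\<close> compared below differ in three components
    only, so their distance is at most \<open>\<delta> / 2\<close>, strictly below
    \<open>\<delta>\<close>.\<close>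
  proof (intro exI[of _ "\<delta> / 6"] conjI allI impI)
    fix P' P X q y :: 'a
    assume n: "norm P' \<le> R" "norm P \<le> R" "norm X \<le> R" "norm q \<le> R" "norm y \<le> R"
      and d: "dist P' P \<le> \<delta> / 6" "dist q P \<le> \<delta> / 6" "dist y X \<le> \<delta> / 6"
    have tri: "dist (u, v) (u', v') \<le> dist u u' + dist v v'" for u u' :: "'b::metric_space" and v v' :: "'c::metric_space"
      unfolding dist_Pair_Pair by (rule sqrt_sum_squares_le_sum) auto
    have "dist (P', P, X, q, y) (P, P, X, P, X) \<le> dist P' P + (dist P P + (dist X X + (dist q P + dist y X)))"
      by (intro order_trans[OF tri] add_left_mono order_refl)
    also have "\<dots> < \<delta>" using d \<delta>(1) by simp
    finally have "dist (\<Psi> (P', P, X, q, y)) (\<Psi> (P, P, X, P, X)) < \<eta>"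
      using n by (intro \<delta>(2)) (auto simp: Q_def)
    then have "\<Psi> (P', P, X, q, y) \<le> \<Psi> (P, P, X, P, X) + \<eta>" by (simp add: dist_real_def)
    also have "\<Psi> (P, P, X, P, X) \<le> c2 * (1 + \<Phi> (P, X))"
      using diss[of P X] by (simp add: \<Psi>_def)
    finally show "U (P', y) \<bullet> c (q, y) + G (P, X) \<bullet> a (q, y) \<le> c2 * (1 + \<Phi> (P, X)) + \<eta>" by (simp add: \<Psi>_def)
  qed (use \<delta> in auto)
qed

text \<open>A pathwise substitute for Ito's formula. The momentum is moved first, at the old
  position \<open>y s\<close>, and costs at most the quadratic bound \<open>quad\<close>; then the
  position moves at the new momentum \<open>q u\<close>, where the chain rule applies. The momentum
  increment is drift plus noise \<open>\<Delta>\<close>, and the square of this sum is at most twice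
  the sum of squares, hence the factors 2.\<close>

lemma lyapunov_step:
  fixes a c G U :: "'a::euclidean_space \<times> 'a \<Rightarrow> 'a" and \<Phi> :: "'a \<times> 'a \<Rightarrow> real" and q y :: "real \<Rightarrow> 'a"
  assumes cont: "continuous_on UNIV a" "continuous_on UNIV c"
    and c1: "0 \<le> c1"
    and quad: "\<And>p p' x. \<Phi> (p', x) - \<Phi> (p, x) \<le> G (p, x) \<bullet> (p' - p) + c1 * (norm (p' - p))\<^sup>2"
    and deriv: "\<And>p x. ((\<lambda>x. \<Phi> (p, x)) has_derivative (\<lambda>\<delta>. U (p, x) \<bullet> \<delta>)) (at x)"
    and su: "s \<le> u" "u \<le> s + h" and path: "continuous_on {s..u} q" "continuous_on {s..u} y"
    and y: "\<And>r. r \<in> {s..u} \<Longrightarrow> (y has_vector_derivative c (q r, y r)) (at r within {s..u})"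
    and \<Delta>: "\<Delta> = q u - q s - integral {s..u} (\<lambda>r. a (q r, y r))"
    and A: "\<And>r. r \<in> {s..u} \<Longrightarrow> norm (a (q r, y r)) \<le> k"
    and \<kappa>: "0 \<le> \<kappa>" "\<And>r. r \<in> {s..u} \<Longrightarrow> U (q u, y r) \<bullet> c (q r, y r) + G (q s, y s) \<bullet> a (q r, y r) \<le> \<kappa>"
  shows "\<Phi> (q u, y u) - \<Phi> (q s, y s) \<le> G (q s, y s) \<bullet> \<Delta> + 2 * c1 * (norm \<Delta>)\<^sup>2 + h * \<kappa> + 2 * c1 * (k * h)\<^sup>2"
proof -
  have path2: "continuous_on {s..u} (\<lambda>r. a (q r, y r))"
    using continuous_on_compose2[OF cont(1) continuous_on_Pair[OF path]] by simp
  define A where "A r = integral {s..r} (\<lambda>r. a (q r, y r))" for r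
  \<comment> \<open>Both drift contributions are put into one function, so that the mean value
    theorem yields one intermediate time \<open>r\<close> for both; their cancellation would be lost
    with two different times.\<close>
  let ?g = "\<lambda>r. \<Phi> (q u, y r) + G (q s, y s) \<bullet> A r"
  let ?g' = "\<lambda>r \<delta>. U (q u, y r) \<bullet> (\<delta> *\<^sub>R c (q r, y r)) + G (q s, y s) \<bullet> (\<delta> *\<^sub>R a (q r, y r))"
  have g': "(?g has_derivative ?g' r) (at r within {s..u})" if r: "r \<in> {s..u}" for r
  proof (rule has_derivative_add)
    show "((\<lambda>r. \<Phi> (q u, y r)) has_derivative (\<lambda>\<delta>. U (q u, y r) \<bullet> (\<delta> *\<^sub>R c (q r, y r)))) (at r within {s..u})"
      using has_derivative_compose[OF y[OF r, unfolded has_vector_derivative_def] deriv[of "q u" "y r"]] .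
    have "(A has_vector_derivative a (q r, y r)) (at r within {s..u})"
      unfolding A_def[abs_def] by (rule integral_has_vector_derivative[OF path2 r])
    then show "((\<lambda>r. G (q s, y s) \<bullet> A r) has_derivative (\<lambda>\<delta>. G (q s, y s) \<bullet> (\<delta> *\<^sub>R a (q r, y r)))) (at r within {s..u})"
      unfolding has_vector_derivative_def by (rule has_derivative_inner_right)
  qed
  obtain r where r: "r \<in> {s..u}" "?g u - ?g s = ?g' r (u - s)"
    using mvt_very_simple[OF su(1), of ?g ?g'] g' by auto
  have "?g' r (u - s) = (u - s) * (U (q u, y r) \<bullet> c (q r, y r) + G (q s, y s) \<bullet> a (q r, y r))"
    by (simp add: distrib_left)
  also have "\<dots> \<le> (u - s) * \<kappa>" using su \<kappa>(2)[OF r(1)] by (intro mult_left_mono) auto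
  \<comment> \<open>Stopping may make the actual interval shorter than the nominal step
    \<open>h\<close>; this is where \<open>\<kappa>\<close> must be non-negative.\<close>
  also have "\<dots> \<le> h * \<kappa>" using su \<kappa>(1) by (intro mult_right_mono) auto
  finally have g: "\<Phi> (q u, y u) - \<Phi> (q u, y s) + G (q s, y s) \<bullet> A u \<le> h * \<kappa>"
    using r(2) by (simp add: A_def)
  have nA: "norm (A u) \<le> k * h"
  proof -
    have "norm (a (q s, y s)) \<le> k" using A[of s] su by simp
    then have "0 \<le> k" by (rule order_trans[OF norm_ge_zero])
    have "norm (A u) \<le> k * (u - s)"
      unfolding A_def by (rule integral_bound[OF su(1) path2]) (use A in auto)
    also have "\<dots> \<le> k * h" using su \<open>0 \<le> k\<close> by (intro mult_left_mono) auto
    finally show ?thesis .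
  qed
  have d: "q u - q s = A u + \<Delta>" by (simp add: \<Delta> A_def)
  have "(norm (A u + \<Delta>))\<^sup>2 \<le> 2 * (norm (A u))\<^sup>2 + 2 * (norm \<Delta>)\<^sup>2"
    using zero_le_power2[of "norm (A u - \<Delta>)"] unfolding power2_norm_eq_inner
    by (simp add: inner_diff_left inner_diff_right inner_add_left inner_add_right inner_commute)
  also have "\<dots> \<le> 2 * (k * h)\<^sup>2 + 2 * (norm \<Delta>)\<^sup>2" using nA by (simp add: power_mono)
  finally have "c1 * (norm (A u + \<Delta>))\<^sup>2 \<le> c1 * (2 * (k * h)\<^sup>2 + 2 * (norm \<Delta>)\<^sup>2)"
    using c1 by (rule mult_left_mono)
  then have "\<Phi> (q u, y s) - \<Phi> (q s, y s) \<le> G (q s, y s) \<bullet> A u + G (q s, y s) \<bullet> \<Delta> + c1 * (2 * (k * h)\<^sup>2 + 2 * (norm \<Delta>)\<^sup>2)"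
    using quad[where p="q s" and p'="q u" and x="y s"] unfolding d inner_add_right by linarith
  with g show ?thesis by (simp add: algebra_simps)
qed

section \<open>Exit times and measurability of the stopped solution\<close>

locale explosive_solution = brownian_setting M F B
  for M :: "'w measure" and F and B :: "real \<Rightarrow> 'w \<Rightarrow> 'a::euclidean_space" +
  fixes a c :: "'a \<times> 'a \<Rightarrow> 'a" and \<epsilon> :: "'a \<times> 'a \<Rightarrow> 'a \<Rightarrow>\<^sub>L 'a"
    and p0 x0 :: 'a and \<zeta> :: "'w \<Rightarrow> ereal" and p x :: "real \<Rightarrow> 'w \<Rightarrow> 'a"
  assumes sol: "sde_solution_until_explosion M F B a \<epsilon> c p0 x0 \<zeta> p x"
begin

abbreviation \<tau> :: "real \<Rightarrow> 'w \<Rightarrow> ereal" where "\<tau> R w \<equiv> exit_time \<zeta> p x R w"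

definition level :: "real \<Rightarrow> 'w \<Rightarrow> real" where "level t w = max (norm (x t w)) (norm (p t w))"

definition stopped :: "real \<Rightarrow> real \<Rightarrow> 'w \<Rightarrow> real" where
  "stopped R s w = real_of_ereal (min (ereal s) (\<tau> R w))"

text \<open>The event that level \<open>R\<close> has not been reached by time \<open>s\<close>. It
  is phrased through the path on \<open>[0, s]\<close> instead of the exit time, which is what makes
  it an event of \<open>F s\<close>.\<close>

definition alive :: "real \<Rightarrow> real \<Rightarrow> 'w set" where
  "alive R s = {w \<in> space M. ereal s < \<zeta> w \<and> (\<forall>t\<in>{0..s}. level t w < R)}"

lemma life_F: "0 \<le> t \<Longrightarrow> {w \<in> space M. ereal t < \<zeta> w} \<in> sets (F t)"
  and p_F: "0 \<le> t \<Longrightarrow> p t \<in> borel_measurable (restrict_space (F t) {w \<in> space M. ereal t < \<zeta> w})"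
  and x_F: "0 \<le> t \<Longrightarrow> x t \<in> borel_measurable (restrict_space (F t) {w \<in> space M. ereal t < \<zeta> w})"
  and p_cont: "w \<in> space M \<Longrightarrow> continuous_on {t. 0 \<le> t \<and> ereal t < \<zeta> w} (\<lambda>t. p t w)"
  and x_cont: "w \<in> space M \<Longrightarrow> continuous_on {t. 0 \<le> t \<and> ereal t < \<zeta> w} (\<lambda>t. x t w)"
  using sol unfolding sde_solution_until_explosion_def adapted_continuous_until_def by blast+

lemma exit_tendsto: "w \<in> space M \<Longrightarrow> ((\<lambda>R. \<tau> R w) \<longlongrightarrow> \<zeta> w) at_top"
  using sol unfolding sde_solution_until_explosion_def by blast

lemma level_cont: "w \<in> space M \<Longrightarrow> continuous_on {t. 0 \<le> t \<and> ereal t < \<zeta> w} (\<lambda>t. level t w)"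
  unfolding level_def by (intro continuous_on_max continuous_on_norm p_cont x_cont)

lemma exit_nonneg: "0 \<le> \<tau> R w"
  unfolding exit_time_def by (rule Inf_greatest) auto

lemma exit_le: "0 \<le> t \<Longrightarrow> ereal t < \<zeta> w \<Longrightarrow> R \<le> level t w \<Longrightarrow> \<tau> R w \<le> ereal t"
  unfolding exit_time_def level_def by (rule Inf_lower) auto

lemma le_exit:
  "(\<And>t. 0 \<le> t \<Longrightarrow> ereal t < \<zeta> w \<Longrightarrow> R \<le> level t w \<Longrightarrow> z \<le> ereal t) \<Longrightarrow> z \<le> \<tau> R w"
  unfolding exit_time_def level_def by (rule Inf_greatest) auto

text \<open>If level \<open>R\<close> were never reached, no higher level would be either; all those
  exit times would be infinite, and so would their limit \<open>\<zeta>\<close>.\<close>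

lemma exit_lt_life:
  assumes sp: "w \<in> space M" and fin: "\<zeta> w \<noteq> \<infinity>"
  shows "\<tau> R w < \<zeta> w"
proof (cases "\<exists>t. 0 \<le> t \<and> ereal t < \<zeta> w \<and> R \<le> level t w")
  case True
  then obtain t where t: "0 \<le> t" "ereal t < \<zeta> w" "R \<le> level t w" by blast
  show ?thesis by (rule le_less_trans[OF exit_le[OF t] t(2)])
next
  case False
  have "\<tau> R' w = \<infinity>" if "R \<le> R'" for R'
    using le_exit[of w R' \<infinity>] False that by (meson ereal_infty_less_eq(1) order_trans)
  then have "\<forall>\<^sub>F R' in at_top. \<tau> R' w = \<infinity>"
    unfolding eventually_at_top_linorder by blast
  then have "((\<lambda>R. \<tau> R w) \<longlongrightarrow> \<infinity>) at_top" by (rule tendsto_eventually)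
  then have "\<zeta> w = \<infinity>" using exit_tendsto[OF sp] tendsto_unique by (metis trivial_limit_at_top_linorder)
  with fin show ?thesis by simp
qed

lemma min_exit_lt_life:
  assumes "w \<in> space M"
  shows "min (ereal s) (\<tau> R w) < \<zeta> w"
proof (cases "\<zeta> w = \<infinity>")
  case True
  then show ?thesis using le_less_trans[OF min.cobounded1[of "ereal s" "\<tau> R w"], of \<infinity>] by simp
next
  case False
  then show ?thesis using exit_lt_life[OF assms False, of R] by (simp add: min_less_iff_disj)
qed

lemma ereal_stopped: "0 \<le> s \<Longrightarrow> ereal (stopped R s w) = min (ereal s) (\<tau> R w)"
  unfolding stopped_def using exit_nonneg[of R w] by (cases "\<tau> R w") (auto simp: min_def)

lemma stopped_nonneg: "0 \<le> s \<Longrightarrow> 0 \<le> stopped R s w"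
  unfolding stopped_def using exit_nonneg[of R w] by (cases "\<tau> R w") (auto simp: min_def)

lemma stopped_le: "0 \<le> s \<Longrightarrow> stopped R s w \<le> s"
  unfolding stopped_def using exit_nonneg[of R w] by (cases "\<tau> R w") (auto simp: min_def)

lemma stopped_lt_life: "w \<in> space M \<Longrightarrow> 0 \<le> s \<Longrightarrow> ereal (stopped R s w) < \<zeta> w"
  by (simp add: ereal_stopped min_exit_lt_life)

lemma stopped_mono: "0 \<le> s \<Longrightarrow> s \<le> u \<Longrightarrow> stopped R s w \<le> stopped R u w"
  unfolding stopped_def using exit_nonneg[of R w] by (cases "\<tau> R w") (auto simp: min_def)

lemma stopped_Lipschitz: "0 \<le> s \<Longrightarrow> s \<le> u \<Longrightarrow> u \<le> s + h \<Longrightarrow> stopped R u w \<le> stopped R s w + h"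
  unfolding stopped_def by (cases "\<tau> R w") (auto simp: min_def)

lemma stopped_0: "stopped R 0 w = 0"
  using stopped_nonneg[of 0 R w] stopped_le[of 0 R w] by simp

text \<open>Strictly before the stopped time the level is below \<open>R\<close> by definition of
  the infimum, and continuity carries the bound to the end point. The initial condition covers a
  stopped time equal to 0, where there is nothing before.\<close>

lemma level_stopped_le:
  assumes sp: "w \<in> space M" and s: "0 \<le> s" and init: "level 0 w < R" and r: "0 \<le> r" "r \<le> stopped R s w"
  shows "level r w \<le> R"
proof -
  have before: "level t w < R" if t: "0 \<le> t" "t < stopped R s w" for t
  proof (rule ccontr)
    assume "\<not> level t w < R"
    moreover have "ereal t < \<zeta> w"
      using stopped_lt_life[OF sp s, of R] t by (meson ereal_less_eq(3) le_less_trans less_imp_le)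
    ultimately have "\<tau> R w \<le> ereal t" using exit_le t by simp
    then have "ereal (stopped R s w) \<le> ereal t" by (simp add: ereal_stopped[OF s] min.coboundedI2)
    then show False using t by simp
  qed
  show ?thesis
  proof (cases "r < stopped R s w")
    case True
    then show ?thesis using before r by (simp add: less_imp_le)
  next
    case False
    then have req: "r = stopped R s w" using r by simp
    show ?thesis
    proof (cases "r = 0")
      case True
      then show ?thesis using init by simp
    next
      case False
      then have r0: "0 < r" using r by simp
      show ?thesis
      proof (rule continuous_le_on_closure[where f="\<lambda>t. level t w" and x=r and a=R])
        show "continuous_on (closure {0..<r}) (\<lambda>t. level t w)"
        proof (rule continuous_on_subset[OF level_cont[OF sp]])
          show "closure {0..<r} \<subseteq> {t. 0 \<le> t \<and> ereal t < \<zeta> w}"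
            using r0 stopped_lt_life[OF sp s, of R] unfolding req[symmetric]
            by (auto intro: le_less_trans[of _ "ereal r"])
        qed
        show "r \<in> closure {0..<r}" using r0 by simp
        show "level t w \<le> R" if "t \<in> {0..<r}" for t
          using before[of t] that req by simp
      qed
    qed
  qed
qed

text \<open>The infimum is attained: were the level still below \<open>R\<close> at the exit time,
  it would stay below on a neighbourhood and the exit would come later.\<close>

lemma level_at_exit:
  assumes sp: "w \<in> space M" and T: "0 \<le> T" "\<tau> R w \<le> ereal T"
  shows "R \<le> level (stopped R T w) w"
proof (rule ccontr)
  let ?t = "stopped R T w"
  assume "\<not> R \<le> level ?t w"
  then have lt: "level ?t w < R" by simp
  have t: "0 \<le> ?t" "ereal ?t < \<zeta> w" "ereal ?t = \<tau> R w"
    by (rule stopped_nonneg[OF T(1)], rule stopped_lt_life[OF sp T(1)], simp add: ereal_stopped[OF T(1)] min_absorb2[OF T(2)])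
  have "?t \<in> {t. 0 \<le> t \<and> ereal t < \<zeta> w}" using t by simp
  with level_cont[OF sp] lt obtain d where d: "d > 0"
    "\<And>u. 0 \<le> u \<Longrightarrow> ereal u < \<zeta> w \<Longrightarrow> dist u ?t < d \<Longrightarrow> dist (level u w) (level ?t w) < R - level ?t w"
    unfolding continuous_on_iff by (metis (no_types, lifting) diff_gt_0_iff_gt mem_Collect_eq)
  have "ereal (?t + d) \<le> \<tau> R w"
  proof (rule le_exit)
    fix u assume u: "0 \<le> u" "ereal u < \<zeta> w" "R \<le> level u w"
    have "ereal ?t \<le> ereal u" using exit_le[OF u] t(3) by simp
    then have "?t \<le> u" by simp
    moreover have "\<not> dist u ?t < d" using d(2)[OF u(1,2)] u(3) by (auto simp: dist_real_def)
    ultimately show "ereal (?t + d) \<le> ereal u" by (simp add: dist_real_def)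
  qed
  then have "ereal (?t + d) \<le> ereal ?t" unfolding t(3) .
  then show False using d(1) by simp
qed

lemma alive_stopped: "0 \<le> s \<Longrightarrow> w \<in> alive R s \<Longrightarrow> stopped R s w = s"
proof -
  assume s: "0 \<le> s" and sp: "w \<in> alive R s"
  have "ereal s \<le> \<tau> R w"
  proof (rule le_exit)
    fix t assume "0 \<le> t" "R \<le> level t w"
    then have "\<not> t \<le> s" using sp by (force simp: alive_def)
    then show "ereal s \<le> ereal t" by simp
  qed
  then show ?thesis by (simp add: stopped_def min_absorb1)
qed

lemma not_alive_exit:
  assumes "0 \<le> s" "w \<in> space M" "w \<notin> alive R s"
  shows "\<tau> R w \<le> ereal s"
proof (cases "ereal s < \<zeta> w")
  case True
  then obtain t where t: "0 \<le> t" "t \<le> s" "R \<le> level t w"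
    using assms unfolding alive_def by force
  have "ereal t < \<zeta> w" using True t(2) by (meson ereal_less_eq(3) le_less_trans)
  then have "\<tau> R w \<le> ereal t" using exit_le t by simp
  then show ?thesis using t(2) by (meson ereal_less_eq(3) order_trans)
next
  case False
  then have "\<zeta> w \<le> ereal s" by simp
  then show ?thesis using exit_lt_life[OF assms(2), of R] by (cases "\<zeta> w = \<infinity>") auto
qed

text \<open>Off \<open>alive R s\<close> the stopped path is frozen from \<open>s\<close> on, so a
  time step starting there changes nothing.\<close>

lemma not_alive_stopped:
  assumes "0 \<le> s" "s \<le> u" "w \<in> space M" "w \<notin> alive R s"
  shows "stopped R u w = stopped R s w"
proof -
  have "\<tau> R w \<le> ereal s" using not_alive_exit assms by blast
  moreover then have "\<tau> R w \<le> ereal u" using assms(2) by (meson ereal_less_eq(3) order_trans)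
  ultimately show ?thesis by (simp add: stopped_def min_absorb2)
qed

lemma level_le_F:
  assumes "0 \<le> t"
  shows "{w \<in> space M. ereal t < \<zeta> w \<and> level t w \<le> r} \<in> sets (F t)"
proof -
  let ?L = "{w \<in> space M. ereal t < \<zeta> w}"
  have L: "?L \<in> sets (F t)" by (rule life_F[OF assms])
  have "(\<lambda>w. level t w) \<in> borel_measurable (restrict_space (F t) ?L)"
    unfolding level_def
    by (intro borel_measurable_max measurable_compose[OF p_F borel_measurable_norm] measurable_compose[OF x_F borel_measurable_norm] assms)
  \<comment> \<open>The default \<open>r + 1\<close> keeps outcomes that have already exploded out
    of the preimage of \<open>{..r}\<close>.\<close>
  then have "(\<lambda>w. if w \<in> ?L then level t w else r + 1) \<in> borel_measurable (F t)"
    by (subst (asm) measurable_restrict_space_iff[where c="r + 1"]) (use L sets.Int_space_eq2[OF L] in simp_all)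
  then have "(\<lambda>w. if w \<in> ?L then level t w else r + 1) -` {..r} \<inter> space (F t) \<in> sets (F t)"
    by (rule measurable_sets) simp
  also have "(\<lambda>w. if w \<in> ?L then level t w else r + 1) -` {..r} \<inter> space (F t) = {w \<in> space M. ereal t < \<zeta> w \<and> level t w \<le> r}"
    by (auto split: if_splits)
  finally show ?thesis .
qed

text \<open>The condition on all times in \<open>[0, s]\<close> is reduced to countably many grid
  times. By compactness the level stays below \<open>R\<close> by some margin
  \<open>1 / (m + 1)\<close>; without a margin, the strict bound on the grid would weaken to a
  non-strict one in the limit.\<close>

lemma alive_F:
  assumes s: "0 \<le> s"
  shows "alive R s \<in> sets (F s)"
proof -
  define D where "D = {(i, n :: nat). real i / real (Suc n) \<le> s}"
  let ?E = "\<lambda>m (i, n). {w \<in> space M. ereal s < \<zeta> w} \<inter> {w \<in> space M. ereal (real i / real (Suc n)) < \<zeta> w \<and> level (real i / real (Suc n)) w \<le> R - 1 / real (Suc m)}"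
  have "(0, 0) \<in> D" using s by (simp add: D_def)
  then have D: "D \<noteq> {}" by blast
  have "alive R s = (\<Union>m. \<Inter>z\<in>D. ?E m z)"
  proof (intro subset_antisym subsetI)
    fix w assume sp: "w \<in> alive R s"
    then have wM: "w \<in> space M" and ws: "ereal s < \<zeta> w" by (auto simp: alive_def)
    have sub: "{0..s} \<subseteq> {t. 0 \<le> t \<and> ereal t < \<zeta> w}"
      using ws by (auto intro: le_less_trans[of _ "ereal s"])
    obtain t where t: "t \<in> {0..s}" "\<And>u. u \<in> {0..s} \<Longrightarrow> level u w \<le> level t w"
      using continuous_attains_sup[OF compact_Icc _ continuous_on_subset[OF level_cont[OF wM] sub]] s by force
    have "level t w < R" using sp t(1) by (auto simp: alive_def)
    then obtain m where m: "1 / real (Suc m) < R - level t w"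
      using nat_approx_posE[of "R - level t w"] by auto
    have "w \<in> ?E m z" if "z \<in> D" for z
    proof -
      obtain i n where z: "z = (i, n)" by fastforce
      let ?u = "real i / real (Suc n)"
      have u: "?u \<in> {0..s}" using that z by (simp add: D_def)
      have "?u \<in> {t. 0 \<le> t \<and> ereal t < \<zeta> w}" using u sub by (rule subsetD[rotated])
      then have "ereal ?u < \<zeta> w" by blast
      moreover have "level ?u w \<le> R - 1 / real (Suc m)" using t(2)[OF u] m by linarith
      ultimately show ?thesis using wM ws z by simp
    qed
    then show "w \<in> (\<Union>m. \<Inter>z\<in>D. ?E m z)" by blast
  next
    fix w assume "w \<in> (\<Union>m. \<Inter>z\<in>D. ?E m z)"
    then obtain m where m: "\<And>z. z \<in> D \<Longrightarrow> w \<in> ?E m z" by blast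
    have wM: "w \<in> space M" and ws: "ereal s < \<zeta> w" using m[OF \<open>(0, 0) \<in> D\<close>] by auto
    have "level t w < R" if t: "t \<in> {0..s}" for t
    proof -
      let ?t = "\<lambda>n. real (nat \<lfloor>real (Suc n) * t\<rfloor>) / real (Suc n)"
      have t0: "0 \<le> t" using t by simp
      have tn: "?t n \<le> s" for n using floor_grid_tendsto(2)[OF t0, of n] t by simp
      have "(\<lambda>n. level (?t n) w) \<longlonglongrightarrow> level t w"
      proof (rule continuous_on_tendsto_compose[OF level_cont[OF wM] floor_grid_tendsto(1)[OF t0]])
        show "t \<in> {t. 0 \<le> t \<and> ereal t < \<zeta> w}" using t ws by (auto intro: le_less_trans[of _ "ereal s"])
        show "\<forall>\<^sub>F n in sequentially. ?t n \<in> {t. 0 \<le> t \<and> ereal t < \<zeta> w}"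
          using tn ws by (intro always_eventually) (auto intro: le_less_trans[of _ "ereal s"])
      qed
      moreover have "level (?t n) w \<le> R - 1 / real (Suc m)" for n
        using m[of "(nat \<lfloor>real (Suc n) * t\<rfloor>, n)"] tn[of n] by (simp add: D_def)
      ultimately have "level t w \<le> R - 1 / real (Suc m)" by (intro LIMSEQ_le_const2) auto
      also have "\<dots> < R" by simp
      finally show ?thesis .
    qed
    then show "w \<in> alive R s" using wM ws by (simp add: alive_def)
  qed
  also have "\<dots> \<in> sets (F s)"
  proof -
    have "(\<Inter>z\<in>D. ?E m z) \<in> sets (F s)" for m
    proof (rule sets.countable_INT'[OF _ D])
      show "countable D" by (rule countable_subset[OF subset_UNIV]) simp
      show "(\<lambda>z. ?E m z) ` D \<subseteq> sets (F s)"
      proof safe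
        fix i n assume "(i, n) \<in> D"
        then have "real i / real (Suc n) \<le> s" by (simp add: D_def)
        then have "{w \<in> space M. ereal (real i / real (Suc n)) < \<zeta> w \<and> level (real i / real (Suc n)) w \<le> R - 1 / real (Suc m)} \<in> sets (F s)"
          by (rule subsetD[OF sets_F_mono level_le_F]) simp
        then show "{w \<in> space M. ereal s < \<zeta> w} \<inter> {w \<in> space M. ereal (real i / real (Suc n)) < \<zeta> w \<and> level (real i / real (Suc n)) w \<le> R - 1 / real (Suc m)} \<in> sets (F s)"
          using life_F[OF s] by (rule sets.Int[rotated])
      qed
    qed
    then show ?thesis by (intro sets.countable_UN) blast
  qed
  finally show ?thesis .
qed

lemma stopped_measurable:
  assumes s: "0 \<le> s"
  shows "stopped R s \<in> borel_measurable M"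
proof (rule borel_measurableI_less)
  fix y :: real
  have alive: "alive R q \<in> sets M" if "0 \<le> q" for q using alive_F[OF that] sets_F by blast
  consider "y \<le> 0" | "s < y" | "0 < y" "y \<le> s" by linarith
  then show "{w \<in> space M. stopped R s w < y} \<in> sets M"
  proof cases
    case 1
    then have "{w \<in> space M. stopped R s w < y} = {}" using stopped_nonneg[OF s, of R] by (auto simp: not_less intro: order_trans)
    then show ?thesis by (simp only: sets.empty_sets)
  next
    case 2
    then have "{w \<in> space M. stopped R s w < y} = space M" using stopped_le[OF s, of R] by (auto intro: le_less_trans)
    then show ?thesis by simp
  next
    case 3
    \<comment> \<open>Being stopped before \<open>y\<close> is witnessed by a rational time before
      \<open>y\<close> at which the path is no longer alive.\<close>
    have "{w \<in> space M. stopped R s w < y} = (\<Union>q\<in>\<rat> \<inter> {0..<y}. space M - alive R q)"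
    proof (intro subset_antisym subsetI)
      fix w assume "w \<in> {w \<in> space M. stopped R s w < y}"
      then have sp: "w \<in> space M" "stopped R s w < y" by auto
      obtain q where q: "q \<in> \<rat>" "stopped R s w < q" "q < y" using Rats_dense_in_real[OF sp(2)] by blast
      have q0: "0 \<le> q" "q \<le> s" using q stopped_nonneg[OF s, of R w] 3 by auto
      have "w \<notin> alive R q" using alive_stopped[OF q0(1), of w R] stopped_mono[OF q0, of R w] q(2) by auto
      then show "w \<in> (\<Union>q\<in>\<rat> \<inter> {0..<y}. space M - alive R q)" using sp q q0 by auto
    next
      fix w assume "w \<in> (\<Union>q\<in>\<rat> \<inter> {0..<y}. space M - alive R q)"
      then obtain q where q: "0 \<le> q" "q < y" "w \<in> space M" "w \<notin> alive R q" by auto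
      then have "stopped R s w = stopped R q w" using 3 by (intro not_alive_stopped) auto
      also have "\<dots> \<le> q" by (rule stopped_le[OF q(1)])
      finally show "w \<in> {w \<in> space M. stopped R s w < y}" using q by auto
    qed
    also have "\<dots> \<in> sets M"
      using alive by (intro sets.countable_UN' countable_Int1 countable_rat) auto
    finally show ?thesis .
  qed
qed

lemma stopped_process_measurable:
  assumes s: "0 \<le> s"
  shows "(\<lambda>w. p (stopped R s w) w) \<in> borel_measurable M" "(\<lambda>w. x (stopped R s w) w) \<in> borel_measurable M"
proof -
  have L: "{w \<in> space M. ereal t < \<zeta> w} \<in> sets M" if "0 \<le> t" for t
    using life_F[OF that] sets_F by blast
  have restr: "f \<in> borel_measurable (restrict_space M S)" if "f \<in> borel_measurable (restrict_space (F t) S)" for f :: "'w \<Rightarrow> 'a" and S t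
  proof -
    have "sets (restrict_space (F t) S) \<subseteq> sets (restrict_space M S)"
      unfolding sets_restrict_space using sets_F[of t] by blast
    then show ?thesis using that unfolding measurable_def by (auto simp: space_restrict_space)
  qed
  show "(\<lambda>w. p (stopped R s w) w) \<in> borel_measurable M"
    by (rule borel_measurable_process_at[OF L restr[OF p_F] p_cont stopped_measurable[OF s] stopped_nonneg[OF s] stopped_lt_life[OF _ s]])
  show "(\<lambda>w. x (stopped R s w) w) \<in> borel_measurable M"
    by (rule borel_measurable_process_at[OF L restr[OF x_F] x_cont stopped_measurable[OF s] stopped_nonneg[OF s] stopped_lt_life[OF _ s]])
qed

text \<open>On \<open>alive R s\<close> stopping at level \<open>R\<close> has not yet happened, so
  the present values replace the stopped ones. This gives measurability in \<open>F s\<close>, which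
  orthogonality to later noise needs.\<close>

lemma alive_indicator_measurable:
  fixes g :: "'a \<times> 'a \<Rightarrow> 'a"
  assumes s: "0 \<le> s" and g: "continuous_on UNIV g"
  shows "(\<lambda>w. if w \<in> alive R s then g (p s w, x s w) else 0) \<in> borel_measurable (F s)"
proof -
  let ?L = "{w \<in> space M. ereal s < \<zeta> w}"
  have sub: "alive R s \<subseteq> ?L" by (auto simp: alive_def)
  have L: "?L \<in> sets (F s)" by (rule life_F[OF s])
  have "(\<lambda>w. (p s w, x s w)) \<in> borel_measurable (restrict_space (F s) ?L)"
    by (intro borel_measurable_Pair p_F x_F s)
  then have "(\<lambda>w. g (p s w, x s w)) \<in> borel_measurable (restrict_space (F s) ?L)"
    by (rule measurable_compose) (rule borel_measurable_continuous_onI[OF g])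
  then have gL: "(\<lambda>w. if w \<in> ?L then g (p s w, x s w) else 0) \<in> borel_measurable (F s)"
    by (subst (asm) measurable_restrict_space_iff[where c=0]) (use L sets.Int_space_eq2[OF L] in auto)
  have "(\<lambda>w. if w \<in> alive R s then (if w \<in> ?L then g (p s w, x s w) else 0) else 0) \<in> borel_measurable (F s)"
    by (rule measurable_If_set[OF gL]) (use alive_F[OF s, of R] sets.Int_space_eq2[OF alive_F[OF s, of R]] in simp_all)
  moreover have "(\<lambda>w. if w \<in> alive R s then (if w \<in> ?L then g (p s w, x s w) else 0) else 0) =
    (\<lambda>w. if w \<in> alive R s then g (p s w, x s w) else 0)"
    using sub by (auto simp: fun_eq_iff)
  ultimately show ?thesis by simp
qed

end

text \<open>\<open>G\<close> and \<open>U\<close> stand for the gradients of \<open>\<Phi>\<close>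
  in p and x. In p the role of a bounded second derivative is played by the one-sided inequality
  \<open>quad\<close>; applied in both directions, it makes the continuous \<open>G\<close> the
  gradient. In x a first derivative suffices because x carries no noise.\<close>

locale lyapunov_solution = explosive_solution M F B a c \<epsilon> p0 x0 \<zeta> p x
  for M :: "'w measure" and F and B :: "real \<Rightarrow> 'w \<Rightarrow> 'a::euclidean_space"
    and a c \<epsilon> p0 x0 \<zeta> p x +
  fixes G U :: "'a \<times> 'a \<Rightarrow> 'a" and \<Phi> :: "'a \<times> 'a \<Rightarrow> real" and c1 c2 :: real
  assumes \<epsilon>_bounded: "bounded (range \<epsilon>)"
    and cont: "continuous_on UNIV a" "continuous_on UNIV c" "continuous_on UNIV G" "continuous_on UNIV U" "continuous_on UNIV \<Phi>"
    and \<Phi>_nonneg: "\<And>z. 0 \<le> \<Phi> z" and c1: "0 \<le> c1" and c2: "0 \<le> c2"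
    and quad: "\<And>p p' x. \<Phi> (p', x) - \<Phi> (p, x) \<le> G (p, x) \<bullet> (p' - p) + c1 * (norm (p' - p))\<^sup>2"
    and deriv: "\<And>p x. ((\<lambda>x. \<Phi> (p, x)) has_derivative (\<lambda>\<delta>. U (p, x) \<bullet> \<delta>)) (at x)"
    and diss: "\<And>p x. G (p, x) \<bullet> a (p, x) + U (p, x) \<bullet> c (p, x) \<le> c2 * (1 + \<Phi> (p, x))"
    and coercive: "\<And>m. \<exists>r. \<forall>p x. r \<le> max (norm x) (norm p) \<longrightarrow> m \<le> \<Phi> (p, x)"
begin

section \<open>Pathwise estimates for one time step\<close>

definition V :: "real \<Rightarrow> real \<Rightarrow> 'w \<Rightarrow> real" where
  "V R s w = \<Phi> (p (stopped R s w) w, x (stopped R s w) w)"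

text \<open>Zero once level \<open>R\<close> has been reached: this keeps the weight bounded and
  adapted, and it loses nothing because the noise increment vanishes there as well.\<close>

definition Y :: "real \<Rightarrow> real \<Rightarrow> 'w \<Rightarrow> 'a" where
  "Y R s w = (if w \<in> alive R s then G (p s w, x s w) else 0)"

text \<open>The amount by which a step violates the inequality that Ito's formula suggests, with the
  noise terms kept in full. Taking the positive part makes the expectations admissible as error
  terms in \<open>discrete_gronwall\<close>.\<close>

definition step_excess :: "real \<Rightarrow> (real \<Rightarrow> 'w \<Rightarrow> 'a) \<Rightarrow> real \<Rightarrow> real \<Rightarrow> 'w \<Rightarrow> real" where
  "step_excess R J s u w = max 0 (V R u w - V R s w - Y R s w \<bullet> (J u w - J s w)
     - 2 * c1 * (norm (J u w - J s w))\<^sup>2 - c2 * (u - s) * (1 + V R s w))"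

text \<open>The equation for p is asked at times of \<open>D\<close> only: \<open>J s\<close> is a
  separate version for each \<open>s\<close>, and one null set can serve countably many
  times.\<close>

definition regular_path :: "real \<Rightarrow> (real \<Rightarrow> 'w \<Rightarrow> 'a) \<Rightarrow> real set \<Rightarrow> 'w \<Rightarrow> bool" where
  "regular_path R J D w \<longleftrightarrow> w \<in> space M \<and> p 0 w = p0 \<and> x 0 w = x0 \<and>
    (\<forall>t. 0 \<le> t \<and> ereal t < \<zeta> w \<longrightarrow> x t w = x0 + integral {0..t} (\<lambda>s. c (p s w, x s w))) \<and>
    (\<forall>s\<in>D. p (stopped R s w) w = p0 + integral {0..stopped R s w} (\<lambda>r. a (p r w, x r w)) + J s w)"

lemma ball_bound:
  obtains k where "0 \<le> k" "\<forall>p x. norm p \<le> R \<longrightarrow> norm x \<le> R \<longrightarrow> norm (a (p, x)) \<le> k \<and> norm (c (p, x)) \<le> k \<and>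
    norm (G (p, x)) \<le> k \<and> norm (U (p, x)) \<le> k \<and> \<Phi> (p, x) \<le> k"
proof -
  let ?Q = "cball (0::'a) R \<times> cball (0::'a) R"
  have Q: "compact ?Q" by (intro compact_Times compact_cball)
  have ex: "\<exists>k. \<forall>z\<in>?Q. norm (f z) \<le> k" if "continuous_on UNIV f" for f :: "'a \<times> 'a \<Rightarrow> 'b::real_normed_vector"
  proof -
    have "bounded (f ` ?Q)"
      by (intro compact_imp_bounded compact_continuous_image continuous_on_subset[OF that] Q) simp
    then show ?thesis by (auto simp: bounded_iff)
  qed
  obtain ka kc kG kU kP where k: "\<forall>z\<in>?Q. norm (a z) \<le> ka" "\<forall>z\<in>?Q. norm (c z) \<le> kc"
    "\<forall>z\<in>?Q. norm (G z) \<le> kG" "\<forall>z\<in>?Q. norm (U z) \<le> kU" "\<forall>z\<in>?Q. norm (\<Phi> z) \<le> kP"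
    using ex[OF cont(1)] ex[OF cont(2)] ex[OF cont(3)] ex[OF cont(4)] ex[OF cont(5)] by blast
  show ?thesis
  proof (rule that[of "\<bar>ka\<bar> + \<bar>kc\<bar> + \<bar>kG\<bar> + \<bar>kU\<bar> + \<bar>kP\<bar>"]; (intro allI impI)?)
    fix p x :: 'a assume "norm p \<le> R" "norm x \<le> R"
    then have "(p, x) \<in> ?Q" by simp
    then show "norm (a (p, x)) \<le> \<bar>ka\<bar> + \<bar>kc\<bar> + \<bar>kG\<bar> + \<bar>kU\<bar> + \<bar>kP\<bar> \<and> norm (c (p, x)) \<le> \<bar>ka\<bar> + \<bar>kc\<bar> + \<bar>kG\<bar> + \<bar>kU\<bar> + \<bar>kP\<bar> \<and>
      norm (G (p, x)) \<le> \<bar>ka\<bar> + \<bar>kc\<bar> + \<bar>kG\<bar> + \<bar>kU\<bar> + \<bar>kP\<bar> \<and> norm (U (p, x)) \<le> \<bar>ka\<bar> + \<bar>kc\<bar> + \<bar>kG\<bar> + \<bar>kU\<bar> + \<bar>kP\<bar> \<and>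
      \<Phi> (p, x) \<le> \<bar>ka\<bar> + \<bar>kc\<bar> + \<bar>kG\<bar> + \<bar>kU\<bar> + \<bar>kP\<bar>"
      using k[THEN bspec, of "(p, x)"] by auto
  qed simp
qed

lemma stopped_bounds:
  assumes "w \<in> space M" "0 \<le> s" "level 0 w < R" "0 \<le> r" "r \<le> stopped R s w"
  shows "norm (p r w) \<le> R" "norm (x r w) \<le> R"
  using level_stopped_le[OF assms] by (simp_all add: level_def)

text \<open>For a path alive at \<open>s\<close>, this is \<open>lyapunov_step\<close> on the
  interval from \<open>s\<close> to the stopped end time; otherwise the stopped path is frozen and
  the left side is 0.\<close>

lemma regular_step:
  assumes reg: "regular_path R J D w" and init: "level 0 w < R"
    and D: "s \<in> D" "u \<in> D" and su: "0 \<le> s" "s \<le> u"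
    and k: "0 \<le> k" "\<And>p x. norm p \<le> R \<Longrightarrow> norm x \<le> R \<Longrightarrow> norm (a (p, x)) \<le> k"
    and \<kappa>: "0 \<le> \<kappa>" "\<And>r. stopped R s w \<le> r \<Longrightarrow> r \<le> stopped R u w \<Longrightarrow>
      U (p (stopped R u w) w, x r w) \<bullet> c (p r w, x r w) + G (p (stopped R s w) w, x (stopped R s w) w) \<bullet> a (p r w, x r w) \<le> \<kappa>"
  shows "V R u w - V R s w \<le> Y R s w \<bullet> (J u w - J s w) + 2 * c1 * (norm (J u w - J s w))\<^sup>2
    + (u - s) * \<kappa> + 2 * c1 * (k * (u - s))\<^sup>2"
proof -
  have sp: "w \<in> space M" using reg by (simp add: regular_path_def)
  have u0: "0 \<le> u" using su by simp
  let ?s = "stopped R s w" and ?u = "stopped R u w"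
  have PJ: "p (stopped R v w) w = p0 + integral {0..stopped R v w} (\<lambda>r. a (p r w, x r w)) + J v w" if "v \<in> D" for v
    using reg that by (simp add: regular_path_def)
  show ?thesis
  proof (cases "w \<in> alive R s")
    case False
    then have eq: "?u = ?s" using not_alive_stopped su sp by blast
    \<comment> \<open>The integrated equation at \<open>s\<close> and at \<open>u\<close> involves
      the same stopped time, so its noise terms agree too.\<close>
    have "J u w = J s w" using PJ[OF D(1)] PJ[OF D(2)] unfolding eq by simp
    then show ?thesis using eq \<kappa>(1) c1 su by (simp add: V_def)
  next
    case True
    then have ss: "?s = s" by (rule alive_stopped[OF su(1)])
    have s0: "0 \<le> ?s" and le: "?s \<le> ?u" and uh: "?u \<le> ?s + (u - s)"
      using stopped_nonneg[OF su(1)] stopped_mono[OF su] stopped_Lipschitz[OF su, of "u - s"] by auto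
    have life: "{0..?u} \<subseteq> {t. 0 \<le> t \<and> ereal t < \<zeta> w}"
      using stopped_lt_life[OF sp u0, of R] by (auto intro: le_less_trans[of _ "ereal ?u"])
    have pc: "continuous_on {0..?u} (\<lambda>r. p r w)" and xc: "continuous_on {0..?u} (\<lambda>r. x r w)"
      by (rule continuous_on_subset[OF p_cont[OF sp] life], rule continuous_on_subset[OF x_cont[OF sp] life])
    have fc: "continuous_on {0..?u} (\<lambda>r. f (p r w, x r w))" if "continuous_on UNIV f" for f :: "'a \<times> 'a \<Rightarrow> 'a"
      using continuous_on_compose2[OF that continuous_on_Pair[OF pc xc]] by simp
    have sub: "{?s..?u} \<subseteq> {0..?u}" using s0 by auto
    have bnd: "norm (p r w) \<le> R" "norm (x r w) \<le> R" if "r \<in> {?s..?u}" for r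
      using stopped_bounds[OF sp u0 init, of r] that s0 by auto
    have "integral {0..?u} (\<lambda>r. a (p r w, x r w)) = integral {0..?s} (\<lambda>r. a (p r w, x r w)) + integral {?s..?u} (\<lambda>r. a (p r w, x r w))"
      using Henstock_Kurzweil_Integration.integral_combine[OF s0 le integrable_continuous_real[OF fc[OF cont(1)]]] by simp
    then have \<Delta>: "J u w - J s w = p ?u w - p ?s w - integral {?s..?u} (\<lambda>r. a (p r w, x r w))"
      using PJ[OF D(1)] PJ[OF D(2)] by simp
    have xd: "((\<lambda>r. x r w) has_vector_derivative c (p r w, x r w)) (at r within {?s..?u})" if r: "r \<in> {?s..?u}" for r
    proof -
      have r0: "r \<in> {0..?u}" using r sub by blast
      have "((\<lambda>r. x0 + integral {0..r} (\<lambda>s. c (p s w, x s w))) has_vector_derivative 0 + c (p r w, x r w)) (at r within {0..?u})"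
        by (intro has_vector_derivative_add has_vector_derivative_const integral_has_vector_derivative[OF fc[OF cont(2)] r0])
      then have "((\<lambda>r. x0 + integral {0..r} (\<lambda>s. c (p s w, x s w))) has_vector_derivative c (p r w, x r w)) (at r within {0..?u})"
        by simp
      then have "((\<lambda>r. x r w) has_vector_derivative c (p r w, x r w)) (at r within {0..?u})"
      proof (rule has_vector_derivative_transform[OF r0, rotated])
        fix v assume "v \<in> {0..?u}"
        then have "0 \<le> v \<and> ereal v < \<zeta> w" using life by blast
        then show "x v w = x0 + integral {0..v} (\<lambda>s. c (p s w, x s w))"
          using reg unfolding regular_path_def by blast
      qed
      then show ?thesis using sub by (rule has_vector_derivative_within_subset)
    qed
    have "\<Phi> (p ?u w, x ?u w) - \<Phi> (p ?s w, x ?s w) \<le> G (p ?s w, x ?s w) \<bullet> (J u w - J s w) + 2 * c1 * (norm (J u w - J s w))\<^sup>2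
        + (u - s) * \<kappa> + 2 * c1 * (k * (u - s))\<^sup>2"
    proof (rule lyapunov_step[where q="\<lambda>r. p r w" and y="\<lambda>r. x r w", OF cont(1,2) c1 quad deriv le uh _ _ xd \<Delta> _ \<kappa>(1)])
      show "continuous_on {?s..?u} (\<lambda>r. p r w)" "continuous_on {?s..?u} (\<lambda>r. x r w)"
        by (rule continuous_on_subset[OF pc sub], rule continuous_on_subset[OF xc sub])
      show "norm (a (p r w, x r w)) \<le> k" if "r \<in> {?s..?u}" for r by (rule k(2)[OF bnd[OF that]])
    qed (use \<kappa>(2) in auto)
    then show ?thesis using True ss by (simp add: V_def Y_def)
  qed
qed

text \<open>Cauchy-Schwarz bounds each of the two drift products by \<open>k^2\<close>. The bound
  does not depend on the path and provides the dominating constant for the limit of vanishing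
  mesh.\<close>

lemma step_excess_bound:
  assumes reg: "regular_path R J D w" and init: "level 0 w < R"
    and D: "s \<in> D" "u \<in> D" and su: "0 \<le> s" "s \<le> u"
    and k: "0 \<le> k" "\<And>p x. norm p \<le> R \<Longrightarrow> norm x \<le> R \<Longrightarrow> norm (a (p, x)) \<le> k \<and> norm (c (p, x)) \<le> k \<and>
    norm (G (p, x)) \<le> k \<and> norm (U (p, x)) \<le> k \<and> \<Phi> (p, x) \<le> k"
  shows "step_excess R J s u w \<le> (u - s) * (2 * k\<^sup>2) + 2 * c1 * (k * (u - s))\<^sup>2"
proof -
  have sp: "w \<in> space M" using reg by (simp add: regular_path_def)
  have u0: "0 \<le> u" using su by simp
  have ip: "v \<bullet> v' \<le> k\<^sup>2" if "norm v \<le> k" "norm v' \<le> k" for v v' :: 'a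
  proof -
    have "v \<bullet> v' \<le> norm v * norm v'" by (rule norm_cauchy_schwarz)
    also have "\<dots> \<le> k * k" using that k(1) by (intro mult_mono) auto
    finally show ?thesis by (simp add: power2_eq_square)
  qed
  have "V R u w - V R s w \<le> Y R s w \<bullet> (J u w - J s w) + 2 * c1 * (norm (J u w - J s w))\<^sup>2
    + (u - s) * (2 * k\<^sup>2) + 2 * c1 * (k * (u - s))\<^sup>2"
  proof (rule regular_step[OF reg init D su k(1)])
    fix r assume r: "stopped R s w \<le> r" "r \<le> stopped R u w"
    have s0: "0 \<le> stopped R s w" "0 \<le> stopped R u w" by (rule stopped_nonneg[OF su(1)], rule stopped_nonneg[OF u0])
    note b = stopped_bounds[OF sp u0 init]
    have b1: "norm (p (stopped R u w) w) \<le> R" using b(1)[of "stopped R u w"] s0 by simp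
    have b2: "norm (p r w) \<le> R" "norm (x r w) \<le> R" using b[of r] s0 r by auto
    have b3: "norm (p (stopped R s w) w) \<le> R" "norm (x (stopped R s w) w) \<le> R"
      using b[of "stopped R s w"] s0 stopped_mono[OF su] by auto
    have "U (p (stopped R u w) w, x r w) \<bullet> c (p r w, x r w) \<le> k\<^sup>2"
      using k(2)[OF b1 b2(2)] k(2)[OF b2] by (intro ip) auto
    moreover have "G (p (stopped R s w) w, x (stopped R s w) w) \<bullet> a (p r w, x r w) \<le> k\<^sup>2"
      using k(2)[OF b3] k(2)[OF b2] by (intro ip) auto
    ultimately show "U (p (stopped R u w) w, x r w) \<bullet> c (p r w, x r w) + G (p (stopped R s w) w, x (stopped R s w) w) \<bullet> a (p r w, x r w) \<le> 2 * k\<^sup>2"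
      by simp
  qed (use k(2) in auto)
  moreover have "0 \<le> c2 * (u - s) * (1 + V R s w)"
    using c2 su \<Phi>_nonneg by (simp add: V_def add_nonneg_nonneg)
  moreover have "0 \<le> (u - s) * (2 * k\<^sup>2) + 2 * c1 * (k * (u - s))\<^sup>2" using su c1 by simp
  ultimately show ?thesis unfolding step_excess_def by (intro max.boundedI) linarith+
qed

text \<open>Pointwise counterpart of \<open>step_excess_bound\<close>: a fixed stopped path is
  uniformly continuous, so for short steps the dissipation inequality holds up to
  \<open>\<eta>\<close>, and its main part is exactly what \<open>step_excess\<close> subtracts. How
  short a step must be depends on the path.\<close>

lemma step_excess_small:
  assumes reg: "regular_path R J D w" and init: "level 0 w < R" and T: "0 \<le> T" and \<eta>: "0 < \<eta>"
    and k: "0 \<le> k" "\<And>p x. norm p \<le> R \<Longrightarrow> norm x \<le> R \<Longrightarrow> norm (a (p, x)) \<le> k"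
  shows "\<exists>d>0. \<forall>s\<in>D. \<forall>u\<in>D. 0 \<le> s \<and> s \<le> u \<and> u \<le> T \<and> u - s < d \<longrightarrow>
    step_excess R J s u w \<le> (u - s) * \<eta> + 2 * c1 * (k * (u - s))\<^sup>2"
proof -
  have sp: "w \<in> space M" using reg by (simp add: regular_path_def)
  obtain \<delta> where \<delta>: "\<delta> > 0" "\<And>P' P X q y. norm P' \<le> R \<Longrightarrow> norm P \<le> R \<Longrightarrow> norm X \<le> R \<Longrightarrow> norm q \<le> R \<Longrightarrow> norm y \<le> R \<Longrightarrow>
      dist P' P \<le> \<delta> \<Longrightarrow> dist q P \<le> \<delta> \<Longrightarrow> dist y X \<le> \<delta> \<Longrightarrow>
      U (P', y) \<bullet> c (q, y) + G (P, X) \<bullet> a (q, y) \<le> c2 * (1 + \<Phi> (P, X)) + \<eta>"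
    using uniform_step_bound[OF cont(1-4) diss \<eta>, of R] by blast
  let ?T = "stopped R T w"
  have life: "{0..?T} \<subseteq> {t. 0 \<le> t \<and> ereal t < \<zeta> w}"
    using stopped_lt_life[OF sp T, of R] by (auto intro: le_less_trans[of _ "ereal ?T"])
  have "uniformly_continuous_on {0..?T} (\<lambda>r. p r w)" "uniformly_continuous_on {0..?T} (\<lambda>r. x r w)"
    by (rule compact_uniformly_continuous[OF continuous_on_subset[OF p_cont[OF sp] life] compact_Icc],
        rule compact_uniformly_continuous[OF continuous_on_subset[OF x_cont[OF sp] life] compact_Icc])
  then obtain d1 d2 where d: "d1 > 0" "\<And>r r'. r \<in> {0..?T} \<Longrightarrow> r' \<in> {0..?T} \<Longrightarrow> dist r' r < d1 \<Longrightarrow> dist (p r' w) (p r w) < \<delta>"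
    "d2 > 0" "\<And>r r'. r \<in> {0..?T} \<Longrightarrow> r' \<in> {0..?T} \<Longrightarrow> dist r' r < d2 \<Longrightarrow> dist (x r' w) (x r w) < \<delta>"
    unfolding uniformly_continuous_on_def using \<delta>(1) by metis
  show ?thesis
  proof (intro exI[of _ "min d1 d2"] conjI ballI impI)
    fix s u assume D: "s \<in> D" "u \<in> D" and su': "0 \<le> s \<and> s \<le> u \<and> u \<le> T \<and> u - s < min d1 d2"
    then have su: "0 \<le> s" "s \<le> u" "0 \<le> u" "u \<le> T" "u - s < d1" "u - s < d2" by auto
    have "V R u w - V R s w \<le> Y R s w \<bullet> (J u w - J s w) + 2 * c1 * (norm (J u w - J s w))\<^sup>2
      + (u - s) * (c2 * (1 + V R s w) + \<eta>) + 2 * c1 * (k * (u - s))\<^sup>2"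
    proof (rule regular_step[OF reg init D su(1,2) k])
      show "0 \<le> c2 * (1 + V R s w) + \<eta>" using c2 \<Phi>_nonneg \<eta> by (simp add: V_def add_nonneg_nonneg)
      fix r assume r: "stopped R s w \<le> r" "r \<le> stopped R u w"
      let ?s = "stopped R s w" and ?u = "stopped R u w"
      have o: "0 \<le> ?s" "?s \<le> ?u" "?u \<le> ?T" "?u \<le> ?s + (u - s)"
        using stopped_nonneg[OF su(1)] stopped_mono[OF su(1,2)] stopped_mono[OF su(3,4)] stopped_Lipschitz[OF su(1,2), of "u - s"] by auto
      note b = stopped_bounds[OF sp su(3) init]
      show "U (p ?u w, x r w) \<bullet> c (p r w, x r w) + G (p ?s w, x ?s w) \<bullet> a (p r w, x r w) \<le> c2 * (1 + V R s w) + \<eta>"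
        unfolding V_def
      proof (rule \<delta>(2))
        show "norm (p ?u w) \<le> R" "norm (p ?s w) \<le> R" "norm (x ?s w) \<le> R" "norm (p r w) \<le> R" "norm (x r w) \<le> R"
          using b(1)[of ?u] b(1)[of ?s] b(2)[of ?s] b(1)[of r] b(2)[of r] o r by auto
        show "dist (p ?u w) (p ?s w) \<le> \<delta>" "dist (p r w) (p ?s w) \<le> \<delta>"
          using d(2)[of ?s ?u] d(2)[of ?s r] o r su(5) by (auto simp: dist_real_def)
        show "dist (x r w) (x ?s w) \<le> \<delta>"
          using d(4)[of ?s r] o r su(6) by (auto simp: dist_real_def)
      qed
    qed auto
    moreover have "(u - s) * (c2 * (1 + V R s w) + \<eta>) = c2 * (u - s) * (1 + V R s w) + (u - s) * \<eta>"
      by (simp add: algebra_simps)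
    moreover have "0 \<le> (u - s) * \<eta> + 2 * c1 * (k * (u - s))\<^sup>2" using su c1 \<eta> by simp
    ultimately show "step_excess R J s u w \<le> (u - s) * \<eta> + 2 * c1 * (k * (u - s))\<^sup>2"
      unfolding step_excess_def by (intro max.boundedI) linarith+
  qed (use d in auto)
qed

lemma V_measurable: "0 \<le> s \<Longrightarrow> V R s \<in> borel_measurable M"
  unfolding V_def[abs_def]
  by (rule measurable_compose[OF borel_measurable_Pair[OF stopped_process_measurable] borel_measurable_continuous_onI[OF cont(5)]])

lemma Y_measurable: "0 \<le> s \<Longrightarrow> Y R s \<in> borel_measurable (F s)"
  unfolding Y_def[abs_def] by (rule alive_indicator_measurable[OF _ cont(3)])

end

section \<open>Bound in expectation and non-explosion\<close>

context lyapunov_solution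
begin

text \<open>One version of the stopped integral is selected for each time; no relation between
  versions at different times, such as continuity, is imposed.\<close>

definition noise :: "real \<Rightarrow> (real \<Rightarrow> 'w \<Rightarrow> 'a) \<Rightarrow> bool" where
  "noise R J \<longleftrightarrow> (\<forall>t\<ge>0. has_ito_integral M F B t (\<lambda>s w. if ereal s \<le> \<tau> R w then \<epsilon> (p s w, x s w) else 0) (J t) \<and>
    (AE w in M. p (stopped R t w) w = p0 + integral {0..stopped R t w} (\<lambda>s. a (p s w, x s w)) + J t w))"

lemma noise_exists: "\<exists>J. noise R J"
proof -
  have "\<forall>t\<in>{0..}. \<exists>I. has_ito_integral M F B t (\<lambda>s w. if ereal s \<le> \<tau> R w then \<epsilon> (p s w, x s w) else 0) I \<and>
    (AE w in M. p (stopped R t w) w = p0 + integral {0..stopped R t w} (\<lambda>s. a (p s w, x s w)) + I w)"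
    using sol unfolding sde_solution_until_explosion_def Let_def stopped_def atLeast_iff Ball_def by blast
  from bchoice[OF this] show ?thesis unfolding noise_def Ball_def atLeast_iff .
qed

lemma AE_regular_path:
  assumes J: "noise R J" and D: "countable D" "D \<subseteq> {0..}"
  shows "AE w in M. regular_path R J D w"
proof -
  have "AE w in M. p 0 w = p0 \<and> x 0 w = x0"
    "AE w in M. \<forall>t. 0 \<le> t \<and> ereal t < \<zeta> w \<longrightarrow> x t w = x0 + integral {0..t} (\<lambda>s. c (p s w, x s w))"
    using sol unfolding sde_solution_until_explosion_def by blast+
  moreover have "AE w in M. \<forall>s\<in>D. p (stopped R s w) w = p0 + integral {0..stopped R s w} (\<lambda>r. a (p r w, x r w)) + J s w"
    using J D unfolding noise_def by (subst AE_ball_countable) auto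
  moreover have "AE w in M. w \<in> space M" by (rule AE_space)
  ultimately show ?thesis
    unfolding regular_path_def by eventually_elim blast
qed

lemma noise_measurable: "noise R J \<Longrightarrow> 0 \<le> s \<Longrightarrow> J s \<in> borel_measurable M"
  by (simp add: noise_def has_ito_integral_def)

lemma step_excess_measurable:
  assumes J: "noise R J" and su: "0 \<le> s" "s \<le> u"
  shows "step_excess R J s u \<in> borel_measurable M"
proof -
  have u: "0 \<le> u" using su by simp
  note [measurable] = V_measurable[OF su(1)] V_measurable[OF u] noise_measurable[OF J su(1)] noise_measurable[OF J u]
    measurable_F_M[OF Y_measurable[OF su(1)]]
  show ?thesis unfolding step_excess_def[abs_def] by measurable
qed

text \<open>Taking expectations removes the term with \<open>Y\<close> by orthogonality and turns
  the squared noise increment into a multiple of \<open>u - s\<close>; the constant 32 is the 16 of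
  \<open>ito_increment_square\<close> times the 2 in \<open>step_excess\<close>.\<close>

lemma V_step:
  assumes J: "noise R J" and init: "norm p0 < R" "norm x0 < R" and su: "0 \<le> s" "s \<le> u"
    and b: "\<And>q w. norm (if ereal q \<le> \<tau> R w then \<epsilon> (p q w, x q w) else 0) \<le> b"
  shows "integrable M (V R s)" "integrable M (step_excess R J s u)"
    "expectation (V R u) \<le> (1 + c2 * (u - s)) * expectation (V R s) + (c2 + 32 * c1 * DIM('a) * b\<^sup>2) * (u - s) + expectation (step_excess R J s u)"
proof -
  have u: "0 \<le> u" using su by simp
  obtain k where k': "0 \<le> k" "\<forall>p x. norm p \<le> R \<longrightarrow> norm x \<le> R \<longrightarrow> norm (a (p, x)) \<le> k \<and> norm (c (p, x)) \<le> k \<and>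
    norm (G (p, x)) \<le> k \<and> norm (U (p, x)) \<le> k \<and> \<Phi> (p, x) \<le> k"
    by (rule ball_bound[of R])
  note k = k'(1) k'(2)[rule_format]
  have reg: "AE w in M. regular_path R J {s, u} w"
    using J su by (intro AE_regular_path) auto
  have lev: "level 0 w < R" if "regular_path R J D w" for D w
    using that init by (simp add: regular_path_def level_def)
  have Vi: "integrable M (V R v)" if v: "0 \<le> v" for v
  proof (rule integrable_const_bound[OF _ V_measurable[OF v]])
    show "AE w in M. norm (V R v w) \<le> k"
      using reg
    proof eventually_elim
      case (elim w)
      have sp: "w \<in> space M" using elim by (simp add: regular_path_def)
      show ?case
        using k(2)[OF stopped_bounds[OF sp v lev[OF elim] stopped_nonneg[OF v] order_refl]] \<Phi>_nonneg by (simp add: V_def)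
    qed
  qed
  show "integrable M (V R s)" by (rule Vi[OF su(1)])
  show E: "integrable M (step_excess R J s u)"
  proof (rule integrable_const_bound[OF _ step_excess_measurable[OF J su]])
    show "AE w in M. norm (step_excess R J s u w) \<le> (u - s) * (2 * k\<^sup>2) + 2 * c1 * (k * (u - s))\<^sup>2"
      using reg
    proof eventually_elim
      case (elim w)
      have "0 \<le> step_excess R J s u w" by (simp add: step_excess_def)
      then show ?case using step_excess_bound[OF elim lev[OF elim] _ _ su k] by simp
    qed
  qed
  let ?d = "\<lambda>w. J u w - J s w"
  let ?H = "\<lambda>q w. if ereal q \<le> \<tau> R w then \<epsilon> (p q w, x q w) else 0"
  have Js: "has_ito_integral M F B s ?H (J s)" and Ju: "has_ito_integral M F B u ?H (J u)"
    using J su u by (auto simp: noise_def)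
  have Yk: "norm (Y R s w) \<le> k" if "w \<in> space M" for w
  proof (cases "w \<in> alive R s")
    case True
    then have "level s w < R" using su by (auto simp: alive_def)
    then have "norm (p s w) \<le> R" "norm (x s w) \<le> R" by (auto simp: level_def)
    then show ?thesis using k(2) True by (simp add: Y_def)
  qed (use k in \<open>simp add: Y_def\<close>)
  have orth: "has_bochner_integral M (\<lambda>w. Y R s w \<bullet> ?d w) 0"
    by (rule ito_increment_orthogonal[OF Js Ju su b Y_measurable[OF su(1)] Yk])
  have sq: "(\<integral>\<^sup>+w. ennreal ((norm (?d w))\<^sup>2) \<partial>M) \<le> ennreal (16 * DIM('a) * b\<^sup>2 * (u - s))"
    by (rule ito_increment_square[OF Js Ju su b])
  note [measurable] = noise_measurable[OF J su(1)] noise_measurable[OF J u]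
  have dm: "(\<lambda>w. (norm (?d w))\<^sup>2) \<in> borel_measurable M" by measurable
  have sqi: "integrable M (\<lambda>w. (norm (?d w))\<^sup>2)"
    using dm sq by (intro integrableI_nonneg) (auto intro: le_less_trans)
  have "ennreal (expectation (\<lambda>w. (norm (?d w))\<^sup>2)) \<le> ennreal (16 * DIM('a) * b\<^sup>2 * (u - s))"
    using sq nn_integral_eq_integral[OF sqi] by simp
  then have sqe: "expectation (\<lambda>w. (norm (?d w))\<^sup>2) \<le> 16 * DIM('a) * b\<^sup>2 * (u - s)"
    using su by (subst (asm) ennreal_le_iff) auto
  have "expectation (V R u) \<le> expectation (\<lambda>w. V R s w + Y R s w \<bullet> ?d w + 2 * c1 * (norm (?d w))\<^sup>2 + c2 * (u - s) * (1 + V R s w) + step_excess R J s u w)"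
  proof (rule integral_mono)
    show "integrable M (\<lambda>w. V R s w + Y R s w \<bullet> ?d w + 2 * c1 * (norm (?d w))\<^sup>2 + c2 * (u - s) * (1 + V R s w) + step_excess R J s u w)"
      using orth sqi Vi[OF su(1)] E
      by (intro Bochner_Integration.integrable_add integrable_mult_right integrable_const) (auto simp: has_bochner_integral_iff)
    show "V R u w \<le> V R s w + Y R s w \<bullet> ?d w + 2 * c1 * (norm (?d w))\<^sup>2 + c2 * (u - s) * (1 + V R s w) + step_excess R J s u w" for w
      using max.cobounded2[of "V R u w - V R s w - Y R s w \<bullet> ?d w - 2 * c1 * (norm (?d w))\<^sup>2 - c2 * (u - s) * (1 + V R s w)" 0]
      unfolding step_excess_def by linarith
  qed (rule Vi[OF u])
  also have "\<dots> = expectation (V R s) + 0 + 2 * c1 * expectation (\<lambda>w. (norm (?d w))\<^sup>2) + c2 * (u - s) * (1 + expectation (V R s)) + expectation (step_excess R J s u)"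
    using orth sqi Vi[OF su(1)] E by (simp add: has_bochner_integral_iff prob_space)
  also have "\<dots> \<le> expectation (V R s) + 0 + 2 * c1 * (16 * DIM('a) * b\<^sup>2 * (u - s)) + c2 * (u - s) * (1 + expectation (V R s)) + expectation (step_excess R J s u)"
    using sqe c1 by (intro add_right_mono add_left_mono mult_left_mono) auto
  also have "\<dots> = (1 + c2 * (u - s)) * expectation (V R s) + (c2 + 32 * c1 * DIM('a) * b\<^sup>2) * (u - s) + expectation (step_excess R J s u)"
    by (simp add: algebra_simps)
  finally show "expectation (V R u) \<le> (1 + c2 * (u - s)) * expectation (V R s) + (c2 + 32 * c1 * DIM('a) * b\<^sup>2) * (u - s) + expectation (step_excess R J s u)" .
qed

text \<open>The only constant depending on the level is \<open>k\<close>, which bounds the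
  coefficients on the ball of radius \<open>R\<close>. It enters through the excess alone, and this
  vanishes as the mesh tends to 0 at fixed \<open>R\<close>. Hence, for a given \<open>b\<close>,
  the result is free of \<open>R\<close>.\<close>

lemma V_expectation_bound:
  assumes init: "norm p0 < R" "norm x0 < R" and T: "0 < T"
    and b: "\<And>q w. norm (if ereal q \<le> \<tau> R w then \<epsilon> (p q w, x q w) else 0) \<le> b"
  shows "expectation (V R T) \<le> exp (c2 * T) * (\<Phi> (p0, x0) + (c2 + 32 * c1 * DIM('a) * b\<^sup>2) * T)"
proof -
  obtain J where J: "noise R J" using noise_exists by blast
  obtain k where k': "0 \<le> k" "\<forall>p x. norm p \<le> R \<longrightarrow> norm x \<le> R \<longrightarrow> norm (a (p, x)) \<le> k \<and> norm (c (p, x)) \<le> k \<and>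
    norm (G (p, x)) \<le> k \<and> norm (U (p, x)) \<le> k \<and> \<Phi> (p, x) \<le> k"
    by (rule ball_bound[of R])
  note k = k'(1) k'(2)[rule_format]
  let ?C = "c2 + 32 * c1 * DIM('a) * b\<^sup>2"
  have C0: "0 \<le> ?C" using c1 c2 by simp
  define h where "h N = T / real (Suc N)" for N
  define t where "t N j = real j * h N" for N j
  have h0: "0 < h N" for N using T by (simp add: h_def)
  have hT: "real (Suc N) * h N = T" for N by (simp add: h_def)
  have tT: "t N (Suc N) = T" for N unfolding t_def by (rule hT)
  have t0: "t N 0 = 0" for N by (simp add: t_def)
  have tpos: "0 \<le> t N j" for N j using h0[of N] by (simp add: t_def)
  have tdiff: "t N (Suc j) - t N j = h N" for N j by (simp add: t_def algebra_simps)
  have tmono: "t N j \<le> t N (Suc j)" for N j using tdiff[of N j] h0[of N] by linarith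
  have tle: "t N (Suc j) \<le> T" if "j < Suc N" for N j
  proof -
    have "real (Suc j) * h N \<le> real (Suc N) * h N" using that h0[of N] by (intro mult_right_mono) auto
    then show ?thesis unfolding hT t_def .
  qed
  \<comment> \<open>The grid points of all meshes together are still countable, so one null set
    serves every mesh.\<close>
  define D where "D = (\<lambda>(N, j). t N j) ` (UNIV :: (nat \<times> nat) set)"
  have tD: "t N j \<in> D" for N j unfolding D_def by (rule image_eqI[of _ _ "(N, j)"]) auto
  have reg: "AE w in M. regular_path R J D w"
    using tpos by (intro AE_regular_path[OF J]) (auto simp: D_def)
  have lev: "level 0 w < R" if "regular_path R J D w" for w
    using that init by (simp add: regular_path_def level_def)
  let ?e = "\<lambda>N j. step_excess R J (t N j) (t N (Suc j))"
  define S where "S N w = (\<Sum>j<Suc N. ?e N j w)" for N w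
  note step = V_step[OF J init tpos tmono b]
  have S0: "0 \<le> S N w" for N w unfolding S_def by (intro sum_nonneg) (simp add: step_excess_def)
  have Sm: "S N \<in> borel_measurable M" for N
    unfolding S_def[abs_def] by (intro borel_measurable_sum step_excess_measurable[OF J tpos tmono])
  have ES: "(\<Sum>j<Suc N. expectation (?e N j)) = expectation (S N)" for N
    unfolding S_def[abs_def] by (rule Bochner_Integration.integral_sum[symmetric]) (rule step(2))
  have bound: "expectation (V R T) \<le> exp (c2 * T) * (\<Phi> (p0, x0) + ?C * T + expectation (S N))" for N
  proof -
    have "expectation (V R (t N (Suc N))) \<le> (1 + c2 * h N) ^ Suc N *
        (expectation (V R (t N 0)) + real (Suc N) * (?C * h N) + (\<Sum>j<Suc N. expectation (?e N j)))"
    proof (rule discrete_gronwall[where n="Suc N" and v="\<lambda>j. expectation (V R (t N j))" and e="\<lambda>j. expectation (?e N j)"])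
      show "expectation (V R (t N (Suc j))) \<le> (1 + c2 * h N) * expectation (V R (t N j)) + ?C * h N + expectation (?e N j)" for j
        using step(3)[of N j] unfolding tdiff .
      show "0 \<le> expectation (?e N j)" for j by (intro Bochner_Integration.integral_nonneg) (simp add: step_excess_def)
    qed (use c2 C0 h0[of N] in auto)
    also have "expectation (V R (t N 0)) = \<Phi> (p0, x0)"
    proof -
      have "AE w in M. V R 0 w = \<Phi> (p0, x0)"
        using reg by eventually_elim (simp add: V_def stopped_0 regular_path_def)
      then have "expectation (V R 0) = expectation (\<lambda>w. \<Phi> (p0, x0))"
        by (intro integral_cong_AE V_measurable) auto
      then show ?thesis by (simp add: t0 prob_space)
    qed
    also have "real (Suc N) * (?C * h N) = ?C * T" by (subst mult.left_commute) (simp only: hT)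
    also have "(1 + c2 * h N) ^ Suc N * (\<Phi> (p0, x0) + ?C * T + (\<Sum>j<Suc N. expectation (?e N j)))
      \<le> exp (c2 * T) * (\<Phi> (p0, x0) + ?C * T + (\<Sum>j<Suc N. expectation (?e N j)))"
    proof (rule mult_right_mono)
      have "(1 + c2 * h N) ^ Suc N \<le> exp (c2 * h N) ^ Suc N"
        using c2 h0[of N] by (intro power_mono exp_ge_add_one_self) (simp add: add_nonneg_nonneg)
      also have "\<dots> = exp (real (Suc N) * (c2 * h N))" by (rule exp_of_nat_mult[symmetric])
      also have "real (Suc N) * (c2 * h N) = c2 * T" by (subst mult.left_commute) (simp only: hT)
      finally show "(1 + c2 * h N) ^ Suc N \<le> exp (c2 * T)" .
      show "0 \<le> \<Phi> (p0, x0) + ?C * T + (\<Sum>j<Suc N. expectation (?e N j))"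
        unfolding ES using \<Phi>_nonneg C0 T S0 by (intro add_nonneg_nonneg Bochner_Integration.integral_nonneg) auto
    qed
    finally show ?thesis unfolding tT ES .
  qed
  have sum_h: "(\<Sum>j<Suc N. h N * z + 2 * c1 * (k * h N)\<^sup>2) = T * z + 2 * c1 * k\<^sup>2 * T * h N" for N and z :: real
  proof -
    have "(\<Sum>j<Suc N. h N * z + 2 * c1 * (k * h N)\<^sup>2) = (real (Suc N) * h N) * z + 2 * c1 * k\<^sup>2 * (real (Suc N) * h N) * h N"
      by (simp add: algebra_simps power2_eq_square)
    then show ?thesis unfolding hT .
  qed
  have h_lim: "h \<longlonglongrightarrow> 0"
    unfolding h_def by (rule LIMSEQ_Suc[OF lim_const_over_n])
  have hle: "h N \<le> T" for N using T by (simp add: h_def field_simps)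
  \<comment> \<open>Dominated convergence: \<open>step_excess_small\<close> gives the limit along
    each regular path, \<open>step_excess_bound\<close> the domination.\<close>
  have "(\<lambda>N. expectation (S N)) \<longlonglongrightarrow> expectation (\<lambda>w. 0)"
  proof (rule integral_dominated_convergence[where w="\<lambda>w. T * (2 * k\<^sup>2) + 2 * c1 * k\<^sup>2 * T * T"])
    show "AE w in M. (\<lambda>N. S N w) \<longlonglongrightarrow> 0"
      using reg
    proof eventually_elim
      case (elim w)
      show ?case
      proof (rule LIMSEQ_I)
        fix r :: real assume r: "0 < r"
        \<comment> \<open>Summed over steps of total length \<open>T\<close>, this rate contributes
          \<open>r / 2\<close>; the other half is left for the quadratic term in the mesh.\<close>
        let ?\<eta> = "r / (2 * T)"
        have \<eta>: "0 < ?\<eta>" using r T by simp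
        have ka: "norm (a (p, x)) \<le> k" if "norm p \<le> R" "norm x \<le> R" for p x using k(2)[OF that] by simp
        obtain d where d: "0 < d" "\<And>s u. s \<in> D \<Longrightarrow> u \<in> D \<Longrightarrow> 0 \<le> s \<and> s \<le> u \<and> u \<le> T \<and> u - s < d \<Longrightarrow>
          step_excess R J s u w \<le> (u - s) * ?\<eta> + 2 * c1 * (k * (u - s))\<^sup>2"
          using step_excess_small[OF elim lev[OF elim] less_imp_le[OF T] \<eta> k(1) ka] by blast
        have "(\<lambda>N. 2 * c1 * k\<^sup>2 * T * h N) \<longlonglongrightarrow> 2 * c1 * k\<^sup>2 * T * 0"
          by (intro tendsto_mult tendsto_const h_lim)
        then have "\<forall>\<^sub>F N in sequentially. 2 * c1 * k\<^sup>2 * T * h N < r / 2"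
          using r by (intro order_tendstoD) auto
        moreover have "\<forall>\<^sub>F N in sequentially. h N < d" using h_lim d(1) by (rule order_tendstoD(2))
        ultimately have "\<forall>\<^sub>F N in sequentially. norm (S N w - 0) < r"
        proof eventually_elim
          case (elim N)
          have "S N w \<le> (\<Sum>j<Suc N. h N * ?\<eta> + 2 * c1 * (k * h N)\<^sup>2)"
            unfolding S_def
          proof (rule sum_mono)
            fix j assume "j \<in> {..<Suc N}"
            then have "t N (Suc j) \<le> T" using tle by simp
            then show "?e N j w \<le> h N * ?\<eta> + 2 * c1 * (k * h N)\<^sup>2"
              using d(2)[OF tD tD, of N j N "Suc j"] tpos[of N j] tmono[of N j] tdiff[of N j] elim(2) by simp
          qed
          also have "\<dots> = r / 2 + 2 * c1 * k\<^sup>2 * T * h N" unfolding sum_h using T by simp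
          also have "\<dots> < r" using elim(1) by simp
          finally show ?case using S0[of N w] by simp
        qed
        then show "\<exists>no. \<forall>n\<ge>no. norm (S n w - 0) < r" by (simp add: eventually_sequentially)
      qed
    qed
    show "AE w in M. norm (S N w) \<le> T * (2 * k\<^sup>2) + 2 * c1 * k\<^sup>2 * T * T" for N
      using reg
    proof eventually_elim
      case (elim w)
      have "S N w \<le> (\<Sum>j<Suc N. h N * (2 * k\<^sup>2) + 2 * c1 * (k * h N)\<^sup>2)"
        unfolding S_def
      proof (rule sum_mono)
        show "?e N j w \<le> h N * (2 * k\<^sup>2) + 2 * c1 * (k * h N)\<^sup>2" for j
          using step_excess_bound[OF elim lev[OF elim] tD tD tpos tmono k, of N j] unfolding tdiff .
      qed
      also have "\<dots> = T * (2 * k\<^sup>2) + 2 * c1 * k\<^sup>2 * T * h N" by (rule sum_h)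
      also have "\<dots> \<le> T * (2 * k\<^sup>2) + 2 * c1 * k\<^sup>2 * T * T"
        using hle[of N] c1 T by (intro add_left_mono mult_left_mono) auto
      finally show ?case using S0[of N w] by simp
    qed
  qed (use Sm in auto)
  then have "(\<lambda>N. exp (c2 * T) * (\<Phi> (p0, x0) + ?C * T + expectation (S N))) \<longlonglongrightarrow> exp (c2 * T) * (\<Phi> (p0, x0) + ?C * T + 0)"
    by (intro tendsto_mult tendsto_add tendsto_const) simp
  then have "expectation (V R T) \<le> exp (c2 * T) * (\<Phi> (p0, x0) + ?C * T + 0)"
    by (rule LIMSEQ_le_const) (use bound in blast)
  then show ?thesis by simp
qed

text \<open>A Markov inequality: a path exploding by time \<open>T\<close> has left every level by
  then, so \<open>V R T\<close> is at least \<open>m\<close> on that event once \<open>R\<close> is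
  large. The bound on the expectation is free of \<open>R\<close>, and \<open>m\<close> is
  arbitrary.\<close>

lemma AE_survives:
  assumes T: "0 < T"
  shows "AE w in M. ereal T < \<zeta> w"
proof -
  obtain b0 where b0: "\<And>z. norm (\<epsilon> z) \<le> b0" using \<epsilon>_bounded by (auto simp: bounded_iff)
  have "0 \<le> b0" using b0[of undefined] norm_ge_zero order_trans by blast
  then have b: "norm (if ereal q \<le> \<tau> R w then \<epsilon> (p q w, x q w) else 0) \<le> b0" for R q w using b0 by simp
  let ?K = "exp (c2 * T) * (\<Phi> (p0, x0) + (c2 + 32 * c1 * DIM('a) * b0\<^sup>2) * T)"
  let ?N = "{w \<in> space M. \<not> ereal T < \<zeta> w}"
  have "?N = space M - {w \<in> space M. ereal T < \<zeta> w}" by auto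
  moreover have "{w \<in> space M. ereal T < \<zeta> w} \<in> sets M" using life_F[of T] sets_F T by auto
  ultimately have N: "?N \<in> sets M" by auto
  have le: "m * prob ?N \<le> ?K" if m: "0 < m" for m
  proof -
    obtain r where r: "\<And>p x. r \<le> max (norm x) (norm p) \<Longrightarrow> m \<le> \<Phi> (p, x)" using coercive by blast
    \<comment> \<open>The level must exceed both initial norms strictly, for the expectation bound,
      and the threshold \<open>r\<close> at which coercivity yields \<open>m\<close>.\<close>
    define R where "R = max r (max (norm p0 + 1) (norm x0 + 1))"
    have R: "norm p0 < R" "norm x0 < R" "r \<le> R" by (auto simp: R_def)
    obtain J where J: "noise R J" using noise_exists by blast
    have Vi: "integrable M (V R T)" by (rule V_step(1)[OF J R(1,2) _ order_refl b]) (use T in simp)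
    have mV: "m * indicator ?N w \<le> V R T w" if sp: "w \<in> space M" for w
    proof (cases "w \<in> ?N")
      case True
      then have "\<zeta> w \<le> ereal T" by (simp add: not_less)
      then have "\<tau> R w \<le> ereal T"
        using exit_lt_life[OF sp, of R] by (cases "\<zeta> w = \<infinity>") auto
      then have "R \<le> level (stopped R T w) w" using level_at_exit[OF sp] T by simp
      then have "m \<le> V R T w" unfolding V_def using R(3) by (intro r) (simp add: level_def)
      then show ?thesis using True by simp
    qed (simp add: V_def \<Phi>_nonneg)
    have "m * prob ?N = expectation (\<lambda>w. m * indicator ?N w)" using N by simp
    also have "\<dots> \<le> expectation (V R T)"
    proof (rule integral_mono[OF _ Vi mV])
      show "integrable M (\<lambda>w. m * indicator ?N w)"
        using N by (intro integrable_mult_right integrable_real_indicator) (simp_all add: less_top[symmetric])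
    qed
    also have "\<dots> \<le> ?K" by (rule V_expectation_bound[OF R(1,2) T b])
    finally show ?thesis .
  qed
  have "prob ?N = 0"
  proof (rule ccontr)
    assume "prob ?N \<noteq> 0"
    then have pos: "0 < prob ?N" by (simp add: zero_less_measure_iff)
    have K: "0 \<le> ?K" using le[of 1] pos by simp
    \<comment> \<open>With this choice of \<open>m\<close> the bound reads
      \<open>?K + 1 \<le> ?K\<close>.\<close>
    have "(?K + 1) / prob ?N * prob ?N \<le> ?K" using K pos by (intro le divide_pos_pos) auto
    then show False using pos by simp
  qed
  then have "emeasure M ?N = 0" by (simp add: emeasure_eq_measure)
  then show ?thesis using N by (intro AE_I[of _ _ ?N]) auto
qed

theorem AE_nonexplosion: "AE w in M. \<zeta> w = \<infinity>"
proof -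
  have "AE w in M. \<forall>n::nat. ereal (real (Suc n)) < \<zeta> w"
    by (subst AE_all_countable) (use AE_survives in simp)
  then show ?thesis
  proof eventually_elim
    case (elim w)
    show ?case
    proof (rule ccontr)
      assume "\<zeta> w \<noteq> \<infinity>"
      then obtain r where r: "\<zeta> w = ereal r" using elim[rule_format, of 0] by (cases "\<zeta> w") auto
      obtain n where "r < real n" using reals_Archimedean2 by blast
      then show False using elim[rule_format, of n] r by simp
    qed
  qed
qed

end

section \<open>The Hamiltonian of a reproducing kernel Hilbert space\<close>

lemma bounded_range_tendsto_0_at_infinity:
  fixes f :: "'a::euclidean_space \<Rightarrow> 'b::real_normed_vector"
  assumes c: "continuous_on UNIV f" and l: "(f \<longlongrightarrow> 0) at_infinity"
  shows "bounded (range f)"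
proof -
  have "\<forall>\<^sub>F z in at_infinity. norm (f z) < 1"
    using tendstoD[OF l, of 1] by simp
  then obtain r where r: "\<And>z. r \<le> norm z \<Longrightarrow> norm (f z) < 1" by (auto simp: eventually_at_infinity)
  have "bounded (f ` cball 0 r)"
    by (intro compact_imp_bounded compact_continuous_image continuous_on_subset[OF c]) auto
  then obtain b where b: "\<forall>z\<in>cball 0 r. norm (f z) \<le> b"
    unfolding bounded_iff by blast
  have "norm (f z) \<le> max b 1" for z
    using b[rule_format, of z] r[of z] by (cases "norm z \<le> r") (auto simp: less_imp_le le_max_iff_disj)
  then show ?thesis unfolding bounded_iff by blast
qed

text \<open>A real supremum dominates its members only if the set is bounded above; continuity
  together with decay at infinity provides this for the field and for its derivative.\<close>

lemma C1_0_field_norm_1_inf: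
  fixes v :: "'a::euclidean_space \<Rightarrow> 'a"
  assumes d: "\<And>z. (v has_derivative blinfun_apply (v' z)) (at z)" and c: "continuous_on UNIV v'"
    and l: "(v \<longlongrightarrow> 0) at_infinity" "(v' \<longlongrightarrow> 0) at_infinity"
  shows "norm (v z) \<le> norm_1_inf v" "norm (v' z) \<le> norm_1_inf v"
proof -
  have "continuous_on UNIV v"
    using d has_derivative_continuous by (metis continuous_at_imp_continuous_on)
  then have "bounded (range v)" using l(1) by (rule bounded_range_tendsto_0_at_infinity)
  then have b: "bdd_above (range (\<lambda>z. norm (v z)))" by (auto simp: bounded_iff bdd_above_def)
  have "bounded (range v')" using c l(2) by (rule bounded_range_tendsto_0_at_infinity)
  then have b': "bdd_above (range (\<lambda>z. norm (v' z)))" by (auto simp: bounded_iff bdd_above_def)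
  have eq: "onorm (frechet_derivative v (at z)) = norm (v' z)" for z
    using frechet_derivative_at[OF d[of z]] by (simp add: norm_blinfun.rep_eq)
  have s: "norm (v z) \<le> (SUP z. norm (v z))" for z by (rule cSUP_upper[OF _ b]) simp
  have s': "norm (v' z) \<le> (SUP z. norm (v' z))" for z by (rule cSUP_upper[OF _ b']) simp
  have "0 \<le> (SUP z. norm (v z))" "0 \<le> (SUP z. norm (v' z))"
    using order_trans[OF norm_ge_zero s] order_trans[OF norm_ge_zero s'] by auto
  then show "norm (v z) \<le> norm_1_inf v" "norm (v' z) \<le> norm_1_inf v"
    using s[of z] s'[of z] unfolding norm_1_inf_def eq by linarith+
qed

text \<open>Lets H_0 be differentiated from size estimates of remainders, without differentiating
  the kernel.\<close>

lemma has_derivative_quadratic_remainder: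
  fixes f :: "'a::euclidean_space \<Rightarrow> real"
  assumes A: "bounded_linear A" and r: "\<And>y. \<bar>f y - f x - A (y - x)\<bar> \<le> k * (norm (y - x))\<^sup>2"
  shows "(f has_derivative A) (at x)"
  unfolding has_derivative_iff_norm
proof (intro conjI A)
  have "((\<lambda>y. k * norm (y - x)) \<longlongrightarrow> k * norm (x - x)) (at x)" by (intro tendsto_intros)
  then have lim: "((\<lambda>y. k * norm (y - x)) \<longlongrightarrow> 0) (at x)" by simp
  show "((\<lambda>y. norm (f y - f x - A (y - x)) / norm (y - x)) \<longlongrightarrow> 0) (at x)"
  proof (rule tendsto_sandwich[OF _ _ tendsto_const lim])
    show "\<forall>\<^sub>F y in at x. 0 \<le> norm (f y - f x - A (y - x)) / norm (y - x)" by simp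
    show "\<forall>\<^sub>F y in at x. norm (f y - f x - A (y - x)) / norm (y - x) \<le> k * norm (y - x)"
    proof (rule eventuallyI)
      fix y
      show "norm (f y - f x - A (y - x)) / norm (y - x) \<le> k * norm (y - x)"
        using r[of y] by (cases "y = x") (simp_all add: divide_le_eq power2_eq_square mult.assoc)
    qed
  qed
qed

lemma gradient_eqI:
  assumes "(f has_derivative (\<lambda>h. D \<bullet> h)) (at x)"
  shows "gradient f x = D"
  unfolding gradient_def
proof (rule the_equality)
  have conv: "(GDERIV f x :> E) = (f has_derivative (\<lambda>h. E \<bullet> h)) (at x)" for E
    unfolding gderiv_def
    by (rule arg_cong[where f="\<lambda>A. (f has_derivative A) (at x)"], rule ext, rule inner_commute)
  show "GDERIV f x :> D" unfolding conv by (rule assms)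
  fix D' assume "GDERIV f x :> D'"
  then have eq: "(\<lambda>h. D' \<bullet> h) = (\<lambda>h. D \<bullet> h)"
    unfolding conv by (rule has_derivative_unique[OF _ assms])
  have "\<forall>h. D' \<bullet> h = D \<bullet> h" using fun_cong[OF eq] by blast
  then show "D' = D" by (simp only: vector_eq_rdot)
qed

lemma norm_vec_le_sum: "norm (q :: 'b::real_normed_vector ^ 'n) \<le> (\<Sum>i\<in>UNIV. norm (q $ i))"
  unfolding norm_vec_def by (rule L2_set_le_sum) simp

lemma sum_norm_nth_le: "(\<Sum>i\<in>UNIV. norm ((q :: 'b::real_normed_vector ^ 'n) $ i)) \<le> CARD('n) * norm q"
  using sum_bounded_above[of UNIV "\<lambda>i. norm (q $ i)" "norm q"] Finite_Cartesian_Product.norm_nth_le[of q] by simp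

section \<open>Evaluation functionals, the momentum field and the gradients of H_0\<close>

locale C1_0_rkhs =
  fixes fld :: "'v::{real_inner, complete_space} \<Rightarrow> real^'d \<Rightarrow> real^'d"
    and K :: "real^'d \<Rightarrow> real^'d \<Rightarrow> real^'d^'d" and C :: real
  assumes hilbert: "hilbert_space_in_C1_0 fld"
    and norm_bound: "\<And>v. norm_1_inf (fld v) \<le> C * norm v"
    and kernel: "reproducing_kernel fld K"
begin

lemma linear_eval: "linear (\<lambda>v. fld v z)" and field: "C1_0_field (fld v)"
  using hilbert by (auto simp: hilbert_space_in_C1_0_def)

lemmas fld_diff = linear_diff[OF linear_eval]
  and fld_sum = linear_sum[OF linear_eval]

definition dfld :: "'v \<Rightarrow> real^'d \<Rightarrow> (real^'d) \<Rightarrow>\<^sub>L (real^'d)" where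
  "dfld v = (SOME v'. (\<forall>z. (fld v has_derivative blinfun_apply (v' z)) (at z)) \<and> continuous_on UNIV v' \<and>
     (fld v \<longlongrightarrow> 0) at_infinity \<and> (v' \<longlongrightarrow> 0) at_infinity)"

text \<open>The absolute value of \<open>C\<close> gives a non-negative constant whatever the sign
  of \<open>C\<close>, as the later multiplications of inequalities require.\<close>

lemma dfld: "(fld v has_derivative blinfun_apply (dfld v z)) (at z)" "continuous_on UNIV (dfld v)"
  and field_le: "norm (fld v z) \<le> \<bar>C\<bar> * norm v" and dfld_le: "norm (dfld v z) \<le> \<bar>C\<bar> * norm v"
proof -
  have ex: "(\<forall>z. (fld v has_derivative blinfun_apply (dfld v z)) (at z)) \<and> continuous_on UNIV (dfld v) \<and>
     (fld v \<longlongrightarrow> 0) at_infinity \<and> (dfld v \<longlongrightarrow> 0) at_infinity"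
    using someI_ex[OF field[of v, unfolded C1_0_field_def]] unfolding dfld_def .
  then show "(fld v has_derivative blinfun_apply (dfld v z)) (at z)" "continuous_on UNIV (dfld v)" by blast+
  have "norm_1_inf (fld v) \<le> \<bar>C\<bar> * norm v"
    using norm_bound[of v] mult_right_mono[OF abs_ge_self[of C], of "norm v"] by simp
  moreover have "norm (fld v z) \<le> norm_1_inf (fld v)" "norm (dfld v z) \<le> norm_1_inf (fld v)"
    using C1_0_field_norm_1_inf[of "fld v" "dfld v" z] ex by blast+
  ultimately show "norm (fld v z) \<le> \<bar>C\<bar> * norm v" "norm (dfld v z) \<le> \<bar>C\<bar> * norm v" by linarith+
qed

lemma field_Lipschitz: "norm (fld v y - fld v z) \<le> \<bar>C\<bar> * norm v * norm (y - z)"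
  by (rule differentiable_bound[of UNIV _ "\<lambda>z. blinfun_apply (dfld v z)"])
     (use dfld(1) dfld_le in \<open>auto simp: norm_blinfun.rep_eq[symmetric]\<close>)

text \<open>\<open>dfld\<close> is obtained by choice, but derivatives are unique, so it inherits
  linearity. This turns \<open>dfld_le\<close> into Lipschitz dependence on the field.\<close>

lemma dfld_diff: "dfld (v - u) z = dfld v z - dfld u z"
proof (rule blinfun_eqI)
  fix h
  have "fld (v - u) = (\<lambda>z. fld v z - fld u z)" by (rule ext) (rule fld_diff)
  then have "(fld (v - u) has_derivative (\<lambda>h. dfld v z h - dfld u z h)) (at z)"
    using has_derivative_diff[OF dfld(1)[of v z] dfld(1)[of u z]] by simp
  then have "blinfun_apply (dfld (v - u) z) = (\<lambda>h. dfld v z h - dfld u z h)"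
    using dfld(1) has_derivative_unique by blast
  then show "dfld (v - u) z h = (dfld v z - dfld u z) h" by (simp add: blinfun.diff_left)
qed

text \<open>Joint continuity of evaluation: Lipschitz in the field uniformly in the point, and
  continuous in the point for each fixed field. It serves for \<open>fld\<close> and
  \<open>dfld\<close> alike, hence the common constant.\<close>

lemma continuous_on_eval:
  fixes E :: "'v \<Rightarrow> real^'d \<Rightarrow> 'b::real_normed_vector" and g :: "'c::metric_space \<Rightarrow> 'v" and w :: "'c \<Rightarrow> real^'d"
  assumes E: "\<And>v u z. norm (E v z - E u z) \<le> \<bar>C\<bar> * norm (v - u)" "\<And>v. continuous_on UNIV (E v)"
    and g: "continuous_on UNIV g" and w: "continuous_on UNIV w"
  shows "continuous_on UNIV (\<lambda>s. E (g s) (w s))"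
proof (rule continuous_at_imp_continuous_on, rule ballI)
  fix s0
  have g0: "(g \<longlongrightarrow> g s0) (at s0)" and w0: "(w \<longlongrightarrow> w s0) (at s0)"
    using g w by (auto simp: continuous_on_def)
  have E0: "((\<lambda>s. E (g s0) (w s)) \<longlongrightarrow> E (g s0) (w s0)) (at s0)"
    using continuous_on_tendsto_compose[OF E(2) w0] by simp
  have "((\<lambda>s. \<bar>C\<bar> * norm (g s - g s0)) \<longlongrightarrow> \<bar>C\<bar> * norm (g s0 - g s0)) (at s0)"
    by (intro tendsto_intros g0)
  then have "((\<lambda>s. \<bar>C\<bar> * norm (g s - g s0)) \<longlongrightarrow> 0) (at s0)" by simp
  then have "((\<lambda>s. E (g s) (w s) - E (g s0) (w s)) \<longlongrightarrow> 0) (at s0)"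
    by (rule Lim_null_comparison[rotated]) (use E(1) in simp)
  from tendsto_add[OF this E0] have "((\<lambda>s. E (g s) (w s)) \<longlongrightarrow> E (g s0) (w s0)) (at s0)" by simp
  then show "isCont (\<lambda>s. E (g s) (w s)) s0" by (simp add: isCont_def)
qed

definition kernel_section :: "real^'d \<Rightarrow> real^'d \<Rightarrow> 'v" where
  "kernel_section z \<alpha> = (SOME k. fld k = (\<lambda>y. K y z *v \<alpha>) \<and> (\<forall>v. inner v k = inner (fld v z) \<alpha>))"

lemma fld_kernel_section: "fld (kernel_section z \<alpha>) y = K y z *v \<alpha>" and inner_kernel_section: "v \<bullet> kernel_section z \<alpha> = fld v z \<bullet> \<alpha>"
proof -
  have "fld (kernel_section z \<alpha>) = (\<lambda>y. K y z *v \<alpha>) \<and> (\<forall>v. inner v (kernel_section z \<alpha>) = inner (fld v z) \<alpha>)"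
    using someI_ex[OF kernel[unfolded reproducing_kernel_def, rule_format, of z \<alpha>]] unfolding kernel_section_def .
  then show "fld (kernel_section z \<alpha>) y = K y z *v \<alpha>" "v \<bullet> kernel_section z \<alpha> = fld v z \<bullet> \<alpha>" by auto
qed

text \<open>The Riesz representer of the functional sending v to the sum of
  \<open>v(x_j) . p_j\<close>. Its norm estimates are all obtained by testing this functional on
  arbitrary v.\<close>

definition momentum_field :: "(real^'d^'n) \<Rightarrow> (real^'d^'n) \<Rightarrow> 'v" where
  "momentum_field p x = (\<Sum>j\<in>UNIV. kernel_section (x $ j) (p $ j))"

lemma inner_momentum_field: "v \<bullet> momentum_field p x = (\<Sum>j\<in>UNIV. fld v (x $ j) \<bullet> p $ j)"
  unfolding momentum_field_def by (simp add: inner_sum_right inner_kernel_section)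

lemma hamiltonian_eq: "hamiltonian K p x = (norm (momentum_field p x))\<^sup>2 / 2"
proof -
  have "(norm (momentum_field p x))\<^sup>2 = (\<Sum>i\<in>UNIV. (\<Sum>j\<in>UNIV. K (x $ i) (x $ j) *v p $ j) \<bullet> p $ i)"
    unfolding power2_norm_eq_inner
    by (subst inner_momentum_field) (simp add: momentum_field_def fld_sum fld_kernel_section)
  then show ?thesis unfolding hamiltonian_def by (simp add: inner_sum_right inner_commute)
qed

lemma momentum_field_diff: "momentum_field (p - q) x = momentum_field p x - momentum_field q x"
proof -
  have "v \<bullet> momentum_field (p - q) x = v \<bullet> (momentum_field p x - momentum_field q x)" for v
    by (simp add: inner_momentum_field inner_diff_right sum_subtractf)
  then show ?thesis by (metis vector_eq_ldot)
qed

lemma norm_le_inner_bound: "(\<And>v. v \<bullet> w \<le> b * norm v) \<Longrightarrow> 0 \<le> b \<Longrightarrow> norm (w :: 'v) \<le> b"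
proof -
  assume a: "\<And>v. v \<bullet> w \<le> b * norm v" "0 \<le> b"
  have "norm w * norm w \<le> b * norm w" using a(1)[of w] by (simp add: dot_square_norm power2_eq_square)
  then show ?thesis using a(2) by (cases "norm w = 0") (auto simp: mult_le_cancel_right)
qed

text \<open>\<open>\<bar>C\<bar>\<close> comes from the embedding into C^1, the cardinality from
  summing over the points. The type argument carries the number of points.\<close>

abbreviation \<kappa> :: "'n itself \<Rightarrow> real" where "\<kappa> t \<equiv> \<bar>C\<bar> * CARD('n)"

lemma sum_inner_le:
  fixes p :: "(real^'d^'n)"
  assumes "\<And>j. norm (f j) \<le> b" "0 \<le> b"
  shows "(\<Sum>j\<in>UNIV. f j \<bullet> p $ j) \<le> b * (CARD('n) * norm p)"
proof -
  have "(\<Sum>j\<in>UNIV. f j \<bullet> p $ j) \<le> (\<Sum>j\<in>UNIV. b * norm (p $ j))"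
  proof (rule sum_mono)
    fix j
    have "f j \<bullet> p $ j \<le> norm (f j) * norm (p $ j)" by (rule norm_cauchy_schwarz)
    also have "\<dots> \<le> b * norm (p $ j)" by (intro mult_right_mono assms norm_ge_zero)
    finally show "f j \<bullet> p $ j \<le> b * norm (p $ j)" .
  qed
  also have "\<dots> = b * (\<Sum>j\<in>UNIV. norm (p $ j))" by (rule sum_distrib_left[symmetric])
  also have "\<dots> \<le> b * (CARD('n) * norm p)" by (intro mult_left_mono sum_norm_nth_le assms)
  finally show ?thesis .
qed

lemma norm_momentum_field_le:
  fixes p x :: "(real^'d^'n)"
  shows "norm (momentum_field p x) \<le> \<kappa> TYPE('n) * norm p"
proof (rule norm_le_inner_bound)
  fix v
  have "(\<Sum>j\<in>UNIV. fld v (x $ j) \<bullet> p $ j) \<le> (\<bar>C\<bar> * norm v) * (CARD('n) * norm p)"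
    by (rule sum_inner_le) (auto simp: field_le)
  then show "v \<bullet> momentum_field p x \<le> (\<kappa> TYPE('n) * norm p) * norm v"
    by (simp add: inner_momentum_field mult_ac)
qed simp

text \<open>By duality: the difference of two evaluation functionals is controlled by the derivative
  of the test field, which the C^1 embedding bounds. Its square is the quadratically small term in
  the x-derivative of H_0.\<close>

lemma momentum_field_Lipschitz:
  fixes p x y :: "(real^'d^'n)"
  shows "norm (momentum_field p x - momentum_field p y) \<le> \<kappa> TYPE('n) * norm p * norm (x - y)"
proof (rule norm_le_inner_bound)
  fix v
  have "norm (fld v (x $ j) - fld v (y $ j)) \<le> \<bar>C\<bar> * norm v * norm (x - y)" for j
  proof -
    have "norm (x $ j - y $ j) \<le> norm (x - y)"
      using Finite_Cartesian_Product.norm_nth_le[of "x - y" j] by simp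
    then show ?thesis by (intro order_trans[OF field_Lipschitz] mult_left_mono) auto
  qed
  then have "(\<Sum>j\<in>UNIV. (fld v (x $ j) - fld v (y $ j)) \<bullet> p $ j) \<le> (\<bar>C\<bar> * norm v * norm (x - y)) * (CARD('n) * norm p)"
    by (rule sum_inner_le) simp
  then show "v \<bullet> (momentum_field p x - momentum_field p y) \<le> (\<kappa> TYPE('n) * norm p * norm (x - y)) * norm v"
    by (simp add: inner_diff_right inner_momentum_field inner_diff_left sum_subtractf mult_ac)
qed simp

lemma continuous_on_momentum_field:
  "continuous_on UNIV (\<lambda>z. momentum_field (fst z) (snd z :: (real^'d^'n)))"
proof (rule continuous_at_imp_continuous_on, rule ballI)
  fix z0 :: "(real^'d^'n) \<times> (real^'d^'n)"
  let ?m = "\<lambda>z. momentum_field (fst z) (snd z :: (real^'d^'n))"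
  let ?b = "\<lambda>z :: (real^'d^'n) \<times> (real^'d^'n). \<kappa> TYPE('n) * norm (fst z - fst z0) + \<kappa> TYPE('n) * norm (fst z0) * norm (snd z - snd z0)"
  have "(?b \<longlongrightarrow> \<kappa> TYPE('n) * norm (fst z0 - fst z0) + \<kappa> TYPE('n) * norm (fst z0) * norm (snd z0 - snd z0)) (at z0)"
    by (intro tendsto_intros)
  then have b: "(?b \<longlongrightarrow> 0) (at z0)" by simp
  have "norm (?m z - ?m z0) \<le> ?b z" for z
  proof -
    have "?m z - ?m z0 = momentum_field (fst z - fst z0) (snd z) + (momentum_field (fst z0) (snd z) - momentum_field (fst z0) (snd z0))"
      by (simp add: momentum_field_diff)
    also have "norm \<dots> \<le> ?b z"
      by (intro order_trans[OF norm_triangle_ineq] add_mono norm_momentum_field_le momentum_field_Lipschitz)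
    finally show ?thesis .
  qed
  then have "((\<lambda>z. ?m z - ?m z0) \<longlongrightarrow> 0) (at z0)"
    by (intro Lim_null_comparison[OF always_eventually b]) blast
  then show "isCont ?m z0" unfolding isCont_def by (subst Lim_null)
qed

definition grad_p :: "(real^'d^'n) \<times> (real^'d^'n) \<Rightarrow> (real^'d^'n)" where
  "grad_p z = (\<chi> i. fld (momentum_field (fst z) (snd z)) (snd z $ i))"

text \<open>The i-th entry is the transposed derivative of the momentum field at \<open>x_i\<close>
  applied to \<open>p_i\<close>, written in coordinates.\<close>

definition grad_x :: "(real^'d^'n) \<times> (real^'d^'n) \<Rightarrow> (real^'d^'n)" where
  "grad_x z = (\<chi> i. \<Sum>b\<in>Basis. (dfld (momentum_field (fst z) (snd z)) (snd z $ i) b \<bullet> fst z $ i) *\<^sub>R b)"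

lemma inner_grad_p: "grad_p (p, x) \<bullet> q = momentum_field p x \<bullet> momentum_field q x"
  unfolding inner_momentum_field by (simp add: grad_p_def inner_vec_def)

lemma inner_grad_x: "grad_x (p, x) \<bullet> \<delta> = (\<Sum>i\<in>UNIV. dfld (momentum_field p x) (x $ i) (\<delta> $ i) \<bullet> p $ i)"
proof -
  have "(\<Sum>b\<in>Basis. (A b \<bullet> q) *\<^sub>R b) \<bullet> d = A d \<bullet> q" for A :: "(real^'d) \<Rightarrow>\<^sub>L (real^'d)" and q d
    unfolding blinfun_apply_Basis_sum[of A d] inner_sum_left inner_scaleR_left
    by (simp add: inner_commute mult.commute)
  then show ?thesis by (simp add: grad_x_def inner_vec_def)
qed

lemma continuous_on_grad_p: "continuous_on UNIV (grad_p :: (real^'d^'n) \<times> (real^'d^'n) \<Rightarrow> _)"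
proof -
  have c: "continuous_on UNIV (fld v)" for v
    using dfld(1) has_derivative_continuous by (metis continuous_at_imp_continuous_on)
  have n: "norm (fld v z - fld u z) \<le> \<bar>C\<bar> * norm (v - u)" for v u z
    using field_le[of "v - u" z] by (simp add: fld_diff)
  show ?thesis
    unfolding grad_p_def
    by (intro continuous_on_vec_lambda continuous_on_eval[OF n c continuous_on_momentum_field] continuous_intros)
qed

lemma continuous_on_grad_x: "continuous_on UNIV (grad_x :: (real^'d^'n) \<times> (real^'d^'n) \<Rightarrow> _)"
proof -
  have n: "norm (dfld v z - dfld u z) \<le> \<bar>C\<bar> * norm (v - u)" for v u z
    using dfld_le[of "v - u" z] by (simp add: dfld_diff)
  have "continuous_on UNIV (\<lambda>z. dfld (momentum_field (fst z) (snd z)) (snd z $ i))" for i :: 'n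
    by (intro continuous_on_eval[OF n dfld(2) continuous_on_momentum_field] continuous_intros)
  then show ?thesis
    unfolding grad_x_def by (intro continuous_on_vec_lambda continuous_intros)
qed

lemma norm_grad_p_le:
  fixes p x :: "(real^'d^'n)"
  shows "norm (grad_p (p, x)) \<le> \<kappa> TYPE('n) * norm (momentum_field p x)"
proof -
  have "norm (grad_p (p, x)) \<le> (\<Sum>i\<in>UNIV. norm (fld (momentum_field p x) (x $ i)))"
    using norm_vec_le_sum[of "grad_p (p, x)"] by (simp add: grad_p_def)
  also have "\<dots> \<le> (\<Sum>i\<in>(UNIV::'n set). \<bar>C\<bar> * norm (momentum_field p x))" by (intro sum_mono field_le)
  finally show ?thesis by (simp add: mult_ac)
qed

text \<open>Testing the gradient against itself bounds its square, and one factor cancels. The bound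
  is linear in |p|, which is the homogeneity that the logarithm in the Lyapunov function
  absorbs.\<close>

lemma norm_grad_x_le:
  fixes p x :: "(real^'d^'n)"
  shows "norm (grad_x (p, x)) \<le> \<kappa> TYPE('n) * norm (momentum_field p x) * norm p"
proof -
  let ?g = "grad_x (p, x)" and ?v = "momentum_field p x"
  have "norm (dfld ?v (x $ i) (?g $ i)) \<le> \<bar>C\<bar> * norm ?v * norm ?g" for i
  proof -
    have "norm (dfld ?v (x $ i) (?g $ i)) \<le> norm (dfld ?v (x $ i)) * norm (?g $ i)" by (rule norm_blinfun)
    also have "\<dots> \<le> \<bar>C\<bar> * norm ?v * norm ?g"
      by (intro mult_mono dfld_le Finite_Cartesian_Product.norm_nth_le) auto
    finally show ?thesis .
  qed
  then have "?g \<bullet> ?g \<le> (\<bar>C\<bar> * norm ?v * norm ?g) * (CARD('n) * norm p)"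
    unfolding inner_grad_x by (rule sum_inner_le) simp
  then have "norm ?g * norm ?g \<le> (\<kappa> TYPE('n) * norm ?v * norm p) * norm ?g"
    by (simp add: dot_square_norm power2_eq_square mult_ac)
  then show ?thesis by (cases "norm ?g = 0") (auto simp: mult_le_cancel_right)
qed

text \<open>At fixed x, H_0 is a quadratic form in p, so its second-order expansion is
  exact.\<close>

lemma hamiltonian_add:
  "hamiltonian K p' x - hamiltonian K p x = grad_p (p, x) \<bullet> (p' - p) + (norm (momentum_field (p' - p) x))\<^sup>2 / 2"
  unfolding hamiltonian_eq inner_grad_p momentum_field_diff power2_norm_eq_inner
  by (simp add: inner_diff_left inner_diff_right inner_commute field_simps)

lemma has_derivative_hamiltonian_p:
  fixes p x :: "(real^'d^'n)"
  shows "((\<lambda>p. hamiltonian K p x) has_derivative (\<lambda>\<delta>. grad_p (p, x) \<bullet> \<delta>)) (at p)"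
proof (rule has_derivative_quadratic_remainder[where k="(\<kappa> TYPE('n))\<^sup>2 / 2"])
  fix q
  have "(norm (momentum_field (q - p) x))\<^sup>2 \<le> (\<kappa> TYPE('n) * norm (q - p))\<^sup>2"
    by (intro power_mono norm_momentum_field_le norm_ge_zero)
  then show "\<bar>hamiltonian K q x - hamiltonian K p x - grad_p (p, x) \<bullet> (q - p)\<bar> \<le> (\<kappa> TYPE('n))\<^sup>2 / 2 * (norm (q - p))\<^sup>2"
    unfolding hamiltonian_add by (simp add: power_mult_distrib)
qed (rule bounded_linear_inner_right)

text \<open>With \<open>v\<close> and \<open>w\<close> the momentum fields at \<open>x\<close> and \<open>y\<close>, \<open>\<bar>w\<bar>\<^sup>2 = 2 \<langle>v, w\<rangle> - \<bar>v\<bar>\<^sup>2 + \<bar>w - v\<bar>\<^sup>2\<close>. The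
  first term involves \<open>y\<close> only through values of the fixed \<open>C\<^sup>1\<close> field \<open>v\<close>, and the last one is
  quadratically small, so no differentiability of the kernel in both variables is needed.\<close>

lemma has_derivative_hamiltonian_x:
  fixes p x :: "(real^'d^'n)"
  shows "((\<lambda>x. hamiltonian K p x) has_derivative (\<lambda>\<delta>. grad_x (p, x) \<bullet> \<delta>)) (at x)"
proof -
  let ?v = "momentum_field p x"
  let ?f = "\<lambda>y. \<Sum>j\<in>UNIV. fld ?v (y $ j) \<bullet> p $ j" and ?r = "\<lambda>y. (norm (momentum_field p y - ?v))\<^sup>2 / 2"
  have "((\<lambda>y. fld ?v (y $ j) \<bullet> p $ j) has_derivative (\<lambda>\<delta>. dfld ?v (x $ j) (\<delta> $ j) \<bullet> p $ j)) (at x)" for j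
  proof -
    have "((\<lambda>y. y $ j) has_derivative (\<lambda>\<delta>. \<delta> $ j)) (at x)"
      by (rule bounded_linear_imp_has_derivative[OF bounded_linear_vec_nth])
    from has_derivative_inner_left[OF has_derivative_compose[OF this dfld(1)]] show ?thesis .
  qed
  then have f: "(?f has_derivative (\<lambda>\<delta>. grad_x (p, x) \<bullet> \<delta>)) (at x)"
    unfolding inner_grad_x by (intro has_derivative_sum)
  have r: "(?r has_derivative (\<lambda>\<delta>. 0)) (at x)"
  proof (rule has_derivative_quadratic_remainder[where k="(\<kappa> TYPE('n) * norm p)\<^sup>2 / 2"])
    fix y
    have "(norm (momentum_field p y - ?v))\<^sup>2 \<le> (\<kappa> TYPE('n) * norm p * norm (y - x))\<^sup>2"
      by (intro power_mono momentum_field_Lipschitz norm_ge_zero)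
    then show "\<bar>?r y - ?r x - 0\<bar> \<le> (\<kappa> TYPE('n) * norm p)\<^sup>2 / 2 * (norm (y - x))\<^sup>2"
      by (simp add: power_mult_distrib)
  qed simp
  have "hamiltonian K p y = ?f y + ?r y - (norm ?v)\<^sup>2 / 2" for y
    unfolding inner_momentum_field[symmetric] hamiltonian_eq power2_norm_eq_inner
    by (simp add: inner_diff_left inner_diff_right inner_commute field_simps)
  then have eq: "(\<lambda>x. hamiltonian K p x) = (\<lambda>y. ?f y + ?r y - (norm ?v)\<^sup>2 / 2)" by blast
  have "((\<lambda>y. ?f y + ?r y - (norm ?v)\<^sup>2 / 2) has_derivative (\<lambda>\<delta>. grad_x (p, x) \<bullet> \<delta> + 0 - 0)) (at x)"
    by (intro has_derivative_diff has_derivative_add f r has_derivative_const)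
  then show ?thesis unfolding eq by simp
qed

lemma gradient_hamiltonian_p: "gradient (\<lambda>p. hamiltonian K p x) p = grad_p (p, x)"
  by (rule gradient_eqI[OF has_derivative_hamiltonian_p])

lemma gradient_hamiltonian_x: "gradient (\<lambda>x. hamiltonian K p x) x = grad_x (p, x)"
  by (rule gradient_eqI[OF has_derivative_hamiltonian_x])

end

section \<open>The Lyapunov function and its inequalities\<close>

context C1_0_rkhs
begin

definition lyapunov :: "(real^'d^'n) \<times> (real^'d^'n) \<Rightarrow> real" where
  "lyapunov z = hamiltonian K (fst z) (snd z) + ln (1 + (norm (fst z))\<^sup>2) + (norm (snd z))\<^sup>2"

definition lyapunov_p :: "(real^'d^'n) \<times> (real^'d^'n) \<Rightarrow> real^'d^'n" where
  "lyapunov_p z = grad_p z + (2 / (1 + (norm (fst z))\<^sup>2)) *\<^sub>R fst z"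

definition lyapunov_x :: "(real^'d^'n) \<times> (real^'d^'n) \<Rightarrow> real^'d^'n" where
  "lyapunov_x z = grad_x z + 2 *\<^sub>R snd z"

lemma one_plus_norm_square_pos: "0 < 1 + (norm q)\<^sup>2"
  by (rule add_pos_nonneg) simp_all

lemma lyapunov_nonneg: "0 \<le> lyapunov z"
  unfolding lyapunov_def hamiltonian_eq by (intro add_nonneg_nonneg ln_ge_zero) auto

lemma continuous_on_lyapunov:
  "continuous_on UNIV (lyapunov :: (real^'d^'n) \<times> (real^'d^'n) \<Rightarrow> real)"
  "continuous_on UNIV (lyapunov_p :: (real^'d^'n) \<times> (real^'d^'n) \<Rightarrow> _)"
  "continuous_on UNIV (lyapunov_x :: (real^'d^'n) \<times> (real^'d^'n) \<Rightarrow> _)"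
proof -
  have ne: "1 + (norm q)\<^sup>2 \<noteq> 0" for q :: "real^'d^'n"
    using one_plus_norm_square_pos[of q] by simp
  show "continuous_on UNIV (lyapunov :: (real^'d^'n) \<times> (real^'d^'n) \<Rightarrow> real)"
    unfolding lyapunov_def hamiltonian_eq
    by (intro continuous_intros continuous_on_momentum_field) (use ne in auto)
  show "continuous_on UNIV (lyapunov_p :: (real^'d^'n) \<times> (real^'d^'n) \<Rightarrow> _)"
    unfolding lyapunov_p_def
    by (intro continuous_intros continuous_on_grad_p) (use ne in auto)
  show "continuous_on UNIV (lyapunov_x :: (real^'d^'n) \<times> (real^'d^'n) \<Rightarrow> _)"
    unfolding lyapunov_x_def by (intro continuous_intros continuous_on_grad_x)
qed

text \<open>The Hamiltonian contributes \<open>\<kappa>^2 / 2\<close> through its exact remainder.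
  For the logarithm, \<open>ln b - ln a \<le> (b - a) / a\<close> with \<open>a = 1 + |p|^2\<close>
  and \<open>b = 1 + |p'|^2\<close>: the part of \<open>b - a\<close> linear in
  \<open>p' - p\<close> gives the second summand of \<open>lyapunov_p\<close>, and the quadratic
  part costs at most 1 because \<open>a \<ge> 1\<close>.\<close>

lemma lyapunov_quadratic:
  fixes p p' x :: "real^'d^'n"
  shows "lyapunov (p', x) - lyapunov (p, x) \<le> lyapunov_p (p, x) \<bullet> (p' - p) + ((\<kappa> TYPE('n))\<^sup>2 / 2 + 1) * (norm (p' - p))\<^sup>2"
proof -
  let ?\<delta> = "p' - p" and ?s = "1 + (norm p)\<^sup>2"
  have s: "0 < ?s" "1 \<le> ?s" using one_plus_norm_square_pos[of p] by simp_all
  have "ln (1 + (norm p')\<^sup>2) - ln ?s = ln ((1 + (norm p')\<^sup>2) / ?s)"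
    using one_plus_norm_square_pos[of p'] s(1) by (simp add: ln_div less_imp_neq[OF s(1), symmetric])
  also have "\<dots> \<le> (1 + (norm p')\<^sup>2) / ?s - 1"
    using one_plus_norm_square_pos[of p'] s by (intro ln_le_minus_one divide_pos_pos)
  also have "\<dots> = (2 * (p \<bullet> ?\<delta>) + (norm ?\<delta>)\<^sup>2) / ?s"
  proof -
    have "(norm p')\<^sup>2 = (norm p)\<^sup>2 + 2 * (p \<bullet> ?\<delta>) + (norm ?\<delta>)\<^sup>2"
      unfolding power2_norm_eq_inner by (simp add: inner_diff_left inner_diff_right inner_commute)
    moreover have shift: "y / z - 1 = (y - z) / z" if "z \<noteq> 0" for y z :: real
      using that by (simp add: diff_divide_distrib)
    have "(1 + (norm p')\<^sup>2) / ?s - 1 = ((1 + (norm p')\<^sup>2) - ?s) / ?s"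
      using shift[OF less_imp_neq[OF s(1), symmetric]] by blast
    ultimately show ?thesis by simp
  qed
  also have "\<dots> = (2 / ?s) *\<^sub>R p \<bullet> ?\<delta> + (norm ?\<delta>)\<^sup>2 / ?s" by (simp add: add_divide_distrib)
  also have "(norm ?\<delta>)\<^sup>2 / ?s \<le> (norm ?\<delta>)\<^sup>2"
    using s mult_left_mono[of 1 ?s "(norm ?\<delta>)\<^sup>2"] by (subst pos_divide_le_eq[OF s(1)]) simp
  finally have ln: "ln (1 + (norm p')\<^sup>2) - ln ?s \<le> (2 / ?s) *\<^sub>R p \<bullet> ?\<delta> + (norm ?\<delta>)\<^sup>2" by simp
  have "(norm (momentum_field ?\<delta> x))\<^sup>2 \<le> (\<kappa> TYPE('n) * norm ?\<delta>)\<^sup>2"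
    by (intro power_mono norm_momentum_field_le norm_ge_zero)
  then have "hamiltonian K p' x - hamiltonian K p x \<le> grad_p (p, x) \<bullet> ?\<delta> + (\<kappa> TYPE('n))\<^sup>2 / 2 * (norm ?\<delta>)\<^sup>2"
    unfolding hamiltonian_add by (simp add: power_mult_distrib)
  with ln show ?thesis
    by (simp add: lyapunov_def lyapunov_p_def inner_add_left distrib_right)
qed

lemma has_derivative_lyapunov:
  fixes p x :: "real^'d^'n"
  shows "((\<lambda>x. lyapunov (p, x)) has_derivative (\<lambda>\<delta>. lyapunov_x (p, x) \<bullet> \<delta>)) (at x)"
proof -
  have "((\<lambda>x. hamiltonian K p x + ln (1 + (norm p)\<^sup>2) + x \<bullet> x) has_derivative (\<lambda>\<delta>. grad_x (p, x) \<bullet> \<delta> + 0 + (x \<bullet> \<delta> + \<delta> \<bullet> x))) (at x)"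
    by (intro has_derivative_add has_derivative_hamiltonian_x has_derivative_const has_derivative_inner has_derivative_ident)
  moreover have "(\<lambda>\<delta>. grad_x (p, x) \<bullet> \<delta> + 0 + (x \<bullet> \<delta> + \<delta> \<bullet> x)) = (\<lambda>\<delta>. lyapunov_x (p, x) \<bullet> \<delta>)"
    by (rule ext) (simp add: lyapunov_x_def inner_add_left inner_commute[of _ x])
  ultimately show ?thesis by (simp add: lyapunov_def power2_norm_eq_inner)
qed

text \<open>The Hamiltonian is conserved by the drift, so only the two auxiliary terms contribute.\<close>

lemma lyapunov_dissipation:
  fixes p x :: "real^'d^'n"
  shows "lyapunov_p (p, x) \<bullet> - grad_x (p, x) + lyapunov_x (p, x) \<bullet> grad_p (p, x) \<le> 4 * \<kappa> TYPE('n) * (1 + lyapunov (p, x))"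
proof -
  let ?k = "\<kappa> TYPE('n)" and ?v = "norm (momentum_field p x)" and ?s = "1 + (norm p)\<^sup>2"
  have s: "0 < ?s" by (rule one_plus_norm_square_pos)
  have k: "0 \<le> ?k" by simp
  have young: "2 * y * z \<le> y\<^sup>2 + z\<^sup>2" for y z :: real
    using zero_le_power2[of "y - z"] by (simp add: power2_diff)
  have "- ((2 / ?s) * (p \<bullet> grad_x (p, x))) \<le> (2 / ?s) * (norm p * (?k * ?v * norm p))"
  proof -
    have "- (p \<bullet> grad_x (p, x)) \<le> norm p * norm (grad_x (p, x))"
      using Cauchy_Schwarz_ineq2[of p "grad_x (p, x)"] by simp
    also have "\<dots> \<le> norm p * (?k * ?v * norm p)" by (intro mult_left_mono norm_grad_x_le norm_ge_zero)
    finally have "(2 / ?s) * - (p \<bullet> grad_x (p, x)) \<le> (2 / ?s) * (norm p * (?k * ?v * norm p))"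
      using s by (intro mult_left_mono) auto
    then show ?thesis by simp
  qed
  also have "\<dots> = ((norm p)\<^sup>2 / ?s) * (2 * ?k * ?v)" by (simp add: power2_eq_square)
  also have "\<dots> \<le> 1 * (2 * ?k * ?v)" using s by (intro mult_right_mono) (auto simp: divide_le_eq)
  also have "\<dots> \<le> ?k * (1 + ?v\<^sup>2)" using mult_left_mono[OF young[of 1 ?v] k] by (simp add: mult_ac)
  finally have 1: "- ((2 / ?s) * (p \<bullet> grad_x (p, x))) \<le> ?k * (1 + ?v\<^sup>2)" .
  have "2 * (x \<bullet> grad_p (p, x)) \<le> 2 * (norm x * (?k * ?v))"
    using norm_cauchy_schwarz[of x "grad_p (p, x)"] mult_left_mono[OF norm_grad_p_le[of p x] norm_ge_zero[of x]] by simp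
  also have "\<dots> = ?k * (2 * norm x * ?v)" by simp
  also have "\<dots> \<le> ?k * ((norm x)\<^sup>2 + ?v\<^sup>2)" by (intro mult_left_mono young k)
  finally have 2: "2 * (x \<bullet> grad_p (p, x)) \<le> ?k * ((norm x)\<^sup>2 + ?v\<^sup>2)" .
  have "lyapunov_p (p, x) \<bullet> - grad_x (p, x) + lyapunov_x (p, x) \<bullet> grad_p (p, x) =
      - ((2 / ?s) * (p \<bullet> grad_x (p, x))) + 2 * (x \<bullet> grad_p (p, x))"
    by (simp add: lyapunov_p_def lyapunov_x_def inner_add_left inner_commute[of "grad_x (p, x)" "grad_p (p, x)"])
  also have "\<dots> \<le> ?k * (1 + ?v\<^sup>2) + ?k * ((norm x)\<^sup>2 + ?v\<^sup>2)" using 1 2 by (rule add_mono)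
  also have "\<dots> = ?k * (1 + 2 * ?v\<^sup>2 + (norm x)\<^sup>2)" by (simp add: algebra_simps)
  \<comment> \<open>The 4 is forced by the energy: \<open>?v^2\<close> is twice the Hamiltonian, and
    it occurs twice.\<close>
  also have "\<dots> \<le> ?k * (4 * (1 + lyapunov (p, x)))"
  proof (rule mult_left_mono[OF _ k])
    have "0 \<le> ln ?s" by (rule ln_ge_zero) simp
    then show "1 + 2 * ?v\<^sup>2 + (norm x)\<^sup>2 \<le> 4 * (1 + lyapunov (p, x))"
      using zero_le_power2[of "norm x"] by (simp add: lyapunov_def hamiltonian_eq)
  qed
  finally show ?thesis by (simp only: mult_ac)
qed

lemma lyapunov_coercive:
  "\<exists>r. \<forall>p x :: real^'d^'n. r \<le> max (norm x) (norm p) \<longrightarrow> m \<le> lyapunov (p, x)"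
proof (intro exI allI impI)
  fix p x :: "real^'d^'n"
  \<comment> \<open>A large x gives \<open>|x|^2 \<ge> m\<close> once \<open>|x|\<close> exceeds
    \<open>m\<close>; a large p acts through the logarithm only, hence \<open>exp m\<close>. The 1
    ensures that squaring does not decrease the norm.\<close>
  assume r: "max 1 (max m (exp m)) \<le> max (norm x) (norm p)"
  have sq: "t \<le> t\<^sup>2" if "1 \<le> t" for t :: real
    using mult_left_mono[OF that, of t] that by (simp add: power2_eq_square)
  have H: "0 \<le> hamiltonian K p x" by (simp add: hamiltonian_eq)
  have L: "0 \<le> ln (1 + (norm p)\<^sup>2)" by (rule ln_ge_zero) simp
  consider "max 1 (max m (exp m)) \<le> norm x" | "max 1 (max m (exp m)) \<le> norm p"
    using r by (auto simp: le_max_iff_disj)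
  then show "m \<le> lyapunov (p, x)"
  proof cases
    case 1
    then have "m \<le> (norm x)\<^sup>2" using sq[of "norm x"] by simp
    then show ?thesis using H L unfolding lyapunov_def fst_conv snd_conv by linarith
  next
    case 2
    then have "exp m \<le> 1 + (norm p)\<^sup>2" using sq[of "norm p"] by simp
    then have "m \<le> ln (1 + (norm p)\<^sup>2)" by (simp add: ln_ge_iff one_plus_norm_square_pos)
    then show ?thesis using H zero_le_power2[of "norm x"] unfolding lyapunov_def fst_conv snd_conv by linarith
  qed
qed

end

theorem theorem4:
  fixes fld :: "'v::{real_inner, complete_space} \<Rightarrow> real^'d \<Rightarrow> real^'d"
    and K :: "real^'d \<Rightarrow> real^'d \<Rightarrow> real^'d^'d"
    and C L :: real
    and \<epsilon> :: "(real^'d^'n) \<times> (real^'d^'n) \<Rightarrow> (real^'d^'n) \<Rightarrow>\<^sub>L (real^'d^'n)"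
    and M :: "'w measure" and F :: "real \<Rightarrow> 'w measure"
    and B p x :: "real \<Rightarrow> 'w \<Rightarrow> real^'d^'n"
    and p0 x0 :: "real^'d^'n"
    and \<tau> :: "'w \<Rightarrow> ereal"
  assumes "hilbert_space_in_C1_0 fld"
    and "\<And>v. norm_1_inf (fld v) \<le> C * norm v"
    and "reproducing_kernel fld K"
    and "L-lipschitz_on UNIV \<epsilon>" and "bounded (range \<epsilon>)"
    and "filtered_prob_space M F"
    and "standard_brownian_motion M F B"
    and "sde_solution_until_explosion M F B
           (\<lambda>(p, x). - gradient (\<lambda>x. hamiltonian K p x) x) \<epsilon>
           (\<lambda>(p, x). gradient (\<lambda>p. hamiltonian K p x) p)
           p0 x0 \<tau> p x"
  shows "AE \<omega> in M. \<tau> \<omega> = \<infinity>"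
proof -
  interpret V: C1_0_rkhs fld K C
    by unfold_locales (fact assms(1-3))+
  \<comment> \<open>Differentiability of H_0 turns the gradients, which are definite descriptions,
    into the explicit fields whose continuity and size are known.\<close>
  have drift: "(\<lambda>(p, x). - gradient (\<lambda>x. hamiltonian K p x) x) = (\<lambda>z :: (real^'d^'n) \<times> (real^'d^'n). - V.grad_x z)"
    "(\<lambda>(p, x). gradient (\<lambda>p. hamiltonian K p x) p) = (V.grad_p :: (real^'d^'n) \<times> (real^'d^'n) \<Rightarrow> _)"
    by (auto simp: fun_eq_iff V.gradient_hamiltonian_x V.gradient_hamiltonian_p)
  interpret lyapunov_solution M F B "\<lambda>z. - V.grad_x z" V.grad_p \<epsilon> p0 x0 \<tau> p x
    V.lyapunov_p V.lyapunov_x V.lyapunov "(V.\<kappa> TYPE('n))\<^sup>2 / 2 + 1" "4 * V.\<kappa> TYPE('n)"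
  proof unfold_locales
    show "sde_solution_until_explosion M F B (\<lambda>z. - V.grad_x z) \<epsilon> V.grad_p p0 x0 \<tau> p x"
      using assms(8) unfolding drift .
    show "continuous_on UNIV (\<lambda>z :: (real^'d^'n) \<times> (real^'d^'n). - V.grad_x z)"
      by (intro continuous_on_minus V.continuous_on_grad_x)
  qed (use assms(5-7) V.continuous_on_grad_p V.continuous_on_lyapunov V.lyapunov_nonneg V.lyapunov_quadratic
      V.has_derivative_lyapunov V.lyapunov_dissipation V.lyapunov_coercive in auto)
  show ?thesis by (rule AE_nonexplosion)
qed

end
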